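(* Assume $\sigma^2=o(np)$ and $\frac{np}{\log n}\rightarrow\infty$. Then there exists some $\delta=o(1)$ such that the maximum likelihood estimator $$\widehat{z}=\mathop{\rm argmin}_{z\in\mathbb{C}_1^n}\sum_{1\leq j< k\leq n}A_{jk}|Y_{jk}-z_j\bar{z}_k|^2$$ satisfies $$\ell(\widehat{z},z^* ) \leq (1+\delta)\frac{\sigma^2}{2p},$$ with probability at least $1-n^{-1}-\exp\left(-\left(\frac{np}{\sigma^2}\right)^{1/4}\right)$. In particular, $\delta$ can be chosen to satisfy $\delta=O\left(\left(\frac{\log n+\sigma^2}{np}\right)^{1/4}\right)$.
   Context: Asymptotic conventions: $n\to\infty$; $p=p_n\in(0,1]$ and $\sigma=\sigma_n>0$ may depend on $n$; $o(\cdot)$, $O(\cdot)$ are as $n\to\infty$. $\delta=\delta_n$ depends only on the sequences $(p_n),(\sigma_n)$, not on $z^*$; nonasymptotic inequalities are understood for all sufficiently large $n$ and every $z^*$. Model: $\mathbb{C}_1=\{x\in\mathbb{C}:|x|=1\}$, $z^*\in\mathbb{C}_1^n$. For $1\le j<k\le n$, $A_{jk}\sim\text{Bernoulli}(p)$ independently, and $Y_{jk}=z_j^*\bar z_k^*+\sigma W_{jk}$, where the $W_{jk}$ are i.i.d. standard complex Gaussian $\mathcal{CN}(0,1)$ (real and imaginary parts are independent $\mathcal N(0,1/2)$), independent of $A$. Set $A_{kj}=A_{jk}$, $Y_{kj}=\bar Y_{jk}$ for $j<k$, and $A_{jj}=Y_{jj}=0$. Loss: $\ell(z,z^* )=\min_{a\in\mathbb{C}_1}\sum_{j=1}^n|z_j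 a-z_j^*|^2$. *)

theory Defs
  imports "HOL-Probability.Probability" "HOL-Library.Landau_Symbols"
begin

text \<open>Vectors in \<open>\<complex>\<^sub>1\<^sup>n\<close> are functions on the indices \<open>1, \<dots>, n\<close>, extensional
  elsewhere.\<close>

definition phase_vectors :: "nat \<Rightarrow> (nat \<Rightarrow> complex) set" where
  "phase_vectors n = {1..n} \<rightarrow>\<^sub>E sphere 0 1"

definition index_pairs :: "nat \<Rightarrow> (nat \<times> nat) set" where
  "index_pairs n = {(j, k). 1 \<le> j \<and> j < k \<and> k \<le> n}"

text \<open>The second parameter of \<^const>\<open>normal_density\<close> is the standard deviation, so the real and
  imaginary parts are independent with variance \<open>1/2\<close>.\<close>

definition std_complex_gaussian :: "complex measure" where
  "std_complex_gaussian =
     distr (density lborel (normal_density 0 (sqrt (1/2))) \<Otimes>\<^sub>M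
            density lborel (normal_density 0 (sqrt (1/2))))
       borel (\<lambda>(x, y). Complex x y)"

text \<open>The joint law of \<open>(A, W)\<close>. Both are indexed only by the pairs \<open>j < k\<close>: the remaining
  entries of \<open>A\<close> and \<open>Y\<close> are determined by symmetry and do not enter the likelihood.\<close>

definition sync_law ::
    "nat \<Rightarrow> real \<Rightarrow> ((nat \<times> nat \<Rightarrow> bool) \<times> (nat \<times> nat \<Rightarrow> complex)) measure" where
  "sync_law n p =
     (\<Pi>\<^sub>M e\<in>index_pairs n. measure_pmf (bernoulli_pmf p)) \<Otimes>\<^sub>M
     (\<Pi>\<^sub>M e\<in>index_pairs n. std_complex_gaussian)"

definition observation ::
    "real \<Rightarrow> (nat \<Rightarrow> complex) \<Rightarrow> (nat \<times> nat \<Rightarrow> complex) \<Rightarrow> nat \<times> nat \<Rightarrow> complex" where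
  "observation \<sigma> zstar W = (\<lambda>(j, k). zstar j * cnj (zstar k) + complex_of_real \<sigma> * W (j, k))"

definition sync_objective ::
    "nat \<Rightarrow> (nat \<times> nat \<Rightarrow> bool) \<Rightarrow> (nat \<times> nat \<Rightarrow> complex) \<Rightarrow> (nat \<Rightarrow> complex) \<Rightarrow> real" where
  "sync_objective n A Y z =
     (\<Sum>(j, k)\<in>index_pairs n. of_bool (A (j, k)) * (cmod (Y (j, k) - z j * cnj (z k)))\<^sup>2)"

text \<open>Minimizers are determined at best up to a global phase, hence a predicate.\<close>

definition is_MLE ::
    "nat \<Rightarrow> (nat \<times> nat \<Rightarrow> bool) \<Rightarrow> (nat \<times> nat \<Rightarrow> complex) \<Rightarrow> (nat \<Rightarrow> complex) \<Rightarrow> bool" where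
  "is_MLE n A Y zhat \<longleftrightarrow> is_arg_min (sync_objective n A Y) (\<lambda>z. z \<in> phase_vectors n) zhat"

text \<open>The infimum over the compact circle is attained, so it is the minimum.\<close>

definition sync_loss :: "nat \<Rightarrow> (nat \<Rightarrow> complex) \<Rightarrow> (nat \<Rightarrow> complex) \<Rightarrow> real" where
  "sync_loss n z zstar = (INF a\<in>sphere 0 1. \<Sum>j=1..n. (cmod (z j * a - zstar j))\<^sup>2)"

end

theory Submission
  imports Defs "HOL-Real_Asymp.Real_Asymp"
begin

text \<open>Write \<open>\<sigma>\<close>, \<open>p\<close> for the current noise level and edge probability. Everything is phrased in
  relative phases \<open>u\<^sub>j = conj (z\<^sup>*\<^sub>j) zhat\<^sub>j a\<close>, with the global phase \<open>a\<close> chosen so that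
  \<open>\<Sum>\<^sub>j u\<^sub>j = s \<ge> 0\<close>. Put \<open>x = u - 1\<close> and \<open>L = \<Sum>\<^sub>j |x\<^sub>j|\<^sup>2\<close>; the loss is at most \<open>L\<close>. The estimator maximizes
  \<open>w\<^sup>* M w\<close> over phase vectors \<open>w\<close>, where \<open>M = A + \<sigma> H\<close> with \<open>A\<close> the adjacency matrix and \<open>H\<close> the Hermitian
  noise matrix on its edges. Let \<open>g = H 1\<close> be the vector of row sums of \<open>H\<close>.

  \<^bold>\<open>Why the constant is 1/2.\<close> Maximality in each coordinate makes \<open>(M u)\<^sub>j\<close> a nonnegative multiple of
  \<open>u\<^sub>j\<close>, so \<open>Re (conj \<tau> (M u)\<^sub>j) \<ge> 0\<close> for every \<open>\<tau>\<close> in the half-plane \<open>Re (conj \<tau> u\<^sub>j) \<ge> 0\<close>. The choice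
  \<open>\<tau>\<^sub>j = i Im(u\<^sub>j) u\<^sub>j + |x\<^sub>j|\<^sup>2 x\<^sub>j / 2\<close> lies in this half-plane, has \<open>Re \<tau>\<^sub>j = - |x\<^sub>j|\<^sup>2\<close> exactly, and equals
  \<open>i Im(u\<^sub>j)\<close> up to \<open>2 |x\<^sub>j|\<^sup>2\<close> (\<open>tangent_test_vector\<close>). Summing over \<open>j\<close> and replacing \<open>A\<close> by its mean
  turns these inequalities into \<open>n p L \<le> \<sigma> \<Sum>\<^sub>j Im(u\<^sub>j) Im(g\<^sub>j)\<close> up to errors (\<open>fixed_point_inequality\<close>).
  As \<open>|Im u\<^sub>j| \<le> |x\<^sub>j|\<close>, this gives \<open>L \<le> \<sigma>\<^sup>2 \<Sum>\<^sub>j (Im g\<^sub>j)\<^sup>2 / (n p)\<^sup>2\<close>. Only the imaginary parts of the noise enter,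
  and they carry half of its variance: the last sum is about \<open>n\<^sup>2 p / 2\<close>, whence \<open>\<sigma>\<^sup>2 / (2 p)\<close>. Testing the
  first-order conditions in this way, rather than comparing the values of the objective at two points, makes an error of
  relative size \<open>\<epsilon>\<close> in the inequality cost only \<open>O(\<epsilon>)\<close>, and not \<open>O(sqrt \<epsilon>)\<close>, in \<open>L\<close>.

  \<^bold>\<open>Probabilistic input.\<close> All errors are \<open>O(\<epsilon>)\<close> with \<open>\<epsilon> = ((log n + \<sigma>\<^sup>2) / (n p))\<^bsup>1/4\<^esup>\<close>, by four facts.
  \<^item> \<open>A - p (J - I)\<close>, with \<open>J\<close> the all-ones matrix, has operator norm and row sums at most
    \<open>\<theta> = O(sqrt (n p log n))\<close> (\<open>near_regular_probability\<close>).
    This is a bound for \<open>E tr (A - E A)\<^bsup>2m\<^esup>\<close> with \<open>m\<close> about \<open>log n\<close>, proved by resampling one edge at a time.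
  \<^item> \<open>Re (y\<^sup>* H x)\<close> is small for all \<open>x\<close>, \<open>y\<close> with bounded entries (\<open>noise_bounded_probability\<close>). Given \<open>A\<close> it is
    Gaussian with variance at most a constant times \<open>\<Sum>\<^sub>j\<^sub>k A\<^sub>j\<^sub>k |y\<^sub>j|\<^sup>2 |x\<^sub>k|\<^sup>2\<close>, and for bounded entries this is
    \<open>O(p r\<^sup>2 + \<theta> r)\<close> when both squared norms are at most \<open>r\<close>. That is small enough for a union bound over a
    net of size \<open>exp (O(n))\<close>. Boundedness of the entries matters: for a
    general pair of unit vectors the variance can be of order 1, and the same argument would only give the order \<open>sqrt n\<close>.
  \<^item> \<open>\<Sum>\<^sub>j (Im g\<^sub>j)\<^sup>2\<close> exceeds \<open>(1 + \<epsilon>) n (n p + 2 \<theta>) / 2\<close> only with small probability (\<open>noise_row_Im_tail\<close>).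
  \<^item> The rows with \<open>|g\<^sub>j|\<close> above \<open>16 \<epsilon> n p / \<sigma>\<close> contribute little to \<open>\<Sum>\<^sub>j |g\<^sub>j|\<close> (\<open>noise_row_modulus_tail\<close>). The
    failure probability \<open>exp (- (n p / \<sigma>\<^sup>2)\<^bsup>1/4\<^esup>)\<close> of the theorem comes from Markov's inequality here.\<close>

section \<open>Powers of symmetric matrices\<close>

text \<open>At the first index where \<open>c\<^sub>i / S\<^sup>i\<close> exceeds 1 this sequence increases. Log-convexity keeps it increasing from
  there on, which contradicts the bound at \<open>K\<close>. For \<open>c\<^sub>i = (X\<^bsup>2i\<^esup>)\<^sub>v\<^sub>v\<close> this yields, by the Cauchy--Schwarz
  inequality alone, the interpolation of moments that one would otherwise read off from a diagonalization of \<open>X\<close>.\<close>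

lemma log_convex_bound:
  fixes c :: "nat \<Rightarrow> real"
  assumes nonneg: "\<And>i. 0 \<le> c i"
    and logconv: "\<And>i. (c (Suc i))\<^sup>2 \<le> c i * c (Suc (Suc i))"
    and "c 0 \<le> 1" and cK: "c K \<le> S ^ K" and S: "0 < S" and i: "i \<le> K"
  shows "c i \<le> S ^ i"
proof (rule ccontr)
  assume "\<not> c i \<le> S ^ i"
  define d where "d k = c k / S ^ k" for k
  have d_conv: "(d (Suc k))\<^sup>2 \<le> d k * d (Suc (Suc k))" for k
  proof -
    have "(d (Suc k))\<^sup>2 = (c (Suc k))\<^sup>2 / (S ^ k * S ^ Suc (Suc k))"
      by (simp add: d_def power_divide power2_eq_square ac_simps)
    also have "\<dots> \<le> (c k * c (Suc (Suc k))) / (S ^ k * S ^ Suc (Suc k))"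
      using S by (intro divide_right_mono logconv) auto
    finally show ?thesis by (simp add: d_def)
  qed
  have d_nonneg: "0 \<le> d k" for k using nonneg S by (simp add: d_def)
  have "1 < d i" using \<open>\<not> c i \<le> S ^ i\<close> S by (simp add: d_def field_simps)
  define l where "l = (LEAST k. 1 < d k)"
  have l1: "1 < d l" unfolding l_def using \<open>1 < d i\<close> by (rule LeastI)
  have "l \<le> i" unfolding l_def using \<open>1 < d i\<close> by (rule Least_le)
  have "l \<noteq> 0" using l1 \<open>c 0 \<le> 1\<close> by (auto simp: d_def intro!: Nat.gr0I)
  then obtain l' where l': "l = Suc l'" by (cases l) auto
  have "\<not> 1 < d l'" using not_less_Least[of l' "\<lambda>k. 1 < d k"] l' l_def by simp
  have incr: "1 < d (l + k) \<and> d (l' + k) \<le> d (l + k)" for k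
  proof (induction k)
    case 0 then show ?case using l1 \<open>\<not> 1 < d l'\<close> by simp
  next
    case (Suc k)
    let ?a = "d (l' + k)" and ?b = "d (l + k)" and ?c = "d (Suc (l + k))"
    have "?b * ?b \<le> ?a * ?c" using d_conv[of "l' + k"] by (simp add: l' power2_eq_square)
    also have "\<dots> \<le> ?b * ?c" using Suc d_nonneg by (intro mult_right_mono) auto
    finally have "?b \<le> ?c" using Suc by simp
    then show ?case using Suc by (auto simp: l')
  qed
  have "1 < d K" using incr[of "K - l"] \<open>l \<le> i\<close> i by simp
  then show False using cK S by (simp add: d_def field_simps)
qed

lemma sum_of_bool_eq_mult:
  fixes f :: "'a \<Rightarrow> real"
  assumes "finite I" "i \<in> I"
  shows "(\<Sum>k\<in>I. of_bool (i = k) * f k) = f i"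
proof -
  have "(\<Sum>k\<in>I. of_bool (i = k) * f k) = (\<Sum>k\<in>I. if i = k then f k else 0)"
    by (intro sum.cong) auto
  then show ?thesis using assms by simp
qed

text \<open>The index set is a parameter, and not a type, because the dimension \<open>n\<close> varies.\<close>

primrec mpow :: "'a set \<Rightarrow> ('a \<Rightarrow> 'a \<Rightarrow> real) \<Rightarrow> nat \<Rightarrow> 'a \<Rightarrow> 'a \<Rightarrow> real" where
  "mpow I X 0 i j = of_bool (i = j)"
| "mpow I X (Suc q) i j = (\<Sum>k\<in>I. X i k * mpow I X q k j)"

lemma mpow_add:
  assumes "finite I" "i \<in> I"
  shows "mpow I X (a + b) i j = (\<Sum>k\<in>I. mpow I X a i k * mpow I X b k j)"
  using assms(2)
proof (induction a arbitrary: i)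
  case 0
  then show ?case using sum_of_bool_eq_mult[OF assms(1), of i "\<lambda>k. mpow I X b k j"] by simp
next
  case (Suc a)
  have "mpow I X (Suc a + b) i j = (\<Sum>l\<in>I. \<Sum>k\<in>I. X i l * (mpow I X a l k * mpow I X b k j))"
    by (simp add: Suc sum_distrib_left)
  also have "\<dots> = (\<Sum>k\<in>I. \<Sum>l\<in>I. X i l * (mpow I X a l k * mpow I X b k j))"
    by (rule sum.swap)
  finally show ?case by (simp add: sum_distrib_right mult.assoc)
qed

lemma mpow_1: "finite I \<Longrightarrow> j \<in> I \<Longrightarrow> mpow I X (Suc 0) i j = X i j"
  by (simp add: of_bool_def if_distrib sum.delta' cong: if_cong)

lemma mpow_sym:
  assumes "finite I" "\<And>i j. i \<in> I \<Longrightarrow> j \<in> I \<Longrightarrow> X i j = X j i" "i \<in> I" "j \<in> I"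
  shows "mpow I X a i j = mpow I X a j i"
  using assms(3,4)
proof (induction a arbitrary: i j)
  case 0 then show ?case by auto
next
  case (Suc a)
  have "mpow I X (Suc a) i j = (\<Sum>k\<in>I. mpow I X a j k * X k i)"
    using Suc assms(2) by (simp add: mult.commute)
  also have "\<dots> = (\<Sum>k\<in>I. mpow I X a j k * mpow I X (Suc 0) k i)"
    using Suc.prems assms(1) by (intro sum.cong refl) (simp add: mpow_1 del: mpow.simps)
  also have "\<dots> = mpow I X (a + Suc 0) j i"
    using mpow_add[OF assms(1) Suc.prems(2), of X a "Suc 0" i] by simp
  finally show ?case by simp
qed

lemma mpow_double:
  assumes "finite I" "\<And>i j. i \<in> I \<Longrightarrow> j \<in> I \<Longrightarrow> X i j = X j i" "i \<in> I"
  shows "mpow I X (2 * a) i i = (\<Sum>k\<in>I. (mpow I X a i k)\<^sup>2)"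
proof -
  have "mpow I X (a + a) i i = (\<Sum>k\<in>I. (mpow I X a i k)\<^sup>2)"
    unfolding mpow_add[OF assms(1,3)] power2_eq_square
    by (intro sum.cong refl arg_cong2[where f = "(*)"] mpow_sym assms)
  then show ?thesis by (simp add: mult_2)
qed

lemma mpow_Cauchy_Schwarz:
  assumes "finite I" "\<And>i j. i \<in> I \<Longrightarrow> j \<in> I \<Longrightarrow> X i j = X j i" "i \<in> I" "j \<in> I"
  shows "(mpow I X (a + b) i j)\<^sup>2 \<le> mpow I X (2 * a) i i * mpow I X (2 * b) j j"
proof -
  have "mpow I X (a + b) i j = (\<Sum>k\<in>I. mpow I X a i k * mpow I X b j k)"
    unfolding mpow_add[OF assms(1,3)]
    by (intro sum.cong refl arg_cong2[where f = "(*)"] mpow_sym assms)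
  then show ?thesis
    using Cauchy_Schwarz_ineq_sum[of "\<lambda>k. mpow I X a i k" "\<lambda>k. mpow I X b j k" I]
      mpow_double[OF assms(1,2,3)] mpow_double[OF assms(1,2,4)] by simp
qed

lemma mpow_diag_bound:
  assumes "finite I" "\<And>i j. i \<in> I \<Longrightarrow> j \<in> I \<Longrightarrow> X i j = X j i" "i \<in> I"
    and "mpow I X (2 * K) i i \<le> S ^ K" "0 < S" "a \<le> K"
  shows "mpow I X (2 * a) i i \<le> S ^ a"
proof (rule log_convex_bound[of "\<lambda>a. mpow I X (2 * a) i i", OF _ _ _ assms(4-6)])
  show "0 \<le> mpow I X (2 * a) i i" for a
    using mpow_double[OF assms(1,2,3), where a = a] by (simp add: sum_nonneg)
  show "(mpow I X (2 * Suc a) i i)\<^sup>2 \<le> mpow I X (2 * a) i i * mpow I X (2 * Suc (Suc a)) i i" for a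
    using mpow_Cauchy_Schwarz[OF assms(1,2,3,3), where a = a and b = "Suc (Suc a)"]
    by (simp add: mult_2 del: mpow.simps)
qed simp

text \<open>The power \<open>a\<close> is split into two halves, so that the Cauchy--Schwarz inequality bounds the entry by diagonal
  entries of even powers. Odd powers, whose diagonal has no sign, are covered in this way too.\<close>

lemma mpow_entry_bound:
  assumes "finite I" "\<And>i j. i \<in> I \<Longrightarrow> j \<in> I \<Longrightarrow> X i j = X j i" "i \<in> I" "j \<in> I"
    and "mpow I X (2 * K) i i \<le> (R\<^sup>2) ^ K" "mpow I X (2 * K) j j \<le> (R\<^sup>2) ^ K"
    and "0 < R" "a \<le> 2 * K"
  shows "\<bar>mpow I X a i j\<bar> \<le> R ^ a"
proof -
  define s where "s = a div 2"
  have s: "s \<le> K" "a - s \<le> K" "s + (a - s) = a" using assms(8) by (auto simp: s_def)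
  have "(mpow I X a i j)\<^sup>2 \<le> mpow I X (2 * s) i i * mpow I X (2 * (a - s)) j j"
    using mpow_Cauchy_Schwarz[OF assms(1-4), where a = s and b = "a - s"] s(3) by simp
  also have "\<dots> \<le> (R\<^sup>2) ^ s * (R\<^sup>2) ^ (a - s)"
  proof (rule mult_mono)
    show "mpow I X (2 * s) i i \<le> (R\<^sup>2) ^ s"
      using assms(7) by (intro mpow_diag_bound[OF assms(1,2,3,5) _ s(1)]) auto
    show "mpow I X (2 * (a - s)) j j \<le> (R\<^sup>2) ^ (a - s)"
      using assms(7) by (intro mpow_diag_bound[OF assms(1,2,4,6) _ s(2)]) auto
    show "0 \<le> mpow I X (2 * (a - s)) j j"
      using mpow_double[OF assms(1,2,4), where a = "a - s"] by (simp add: sum_nonneg)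
  qed simp
  also have "\<dots> = (R ^ a)\<^sup>2"
    using s(3) by (metis power_add power_mult mult.commute)
  finally show ?thesis using assms(7) by (simp add: abs_le_square_iff[symmetric])
qed

lemma mpow_diff:
  assumes "finite I" "i \<in> I"
  shows "mpow I X (Suc N) i j - mpow I Y (Suc N) i j =
    (\<Sum>a\<le>N. \<Sum>k\<in>I. \<Sum>l\<in>I. mpow I X a i k * (X k l - Y k l) * mpow I Y (N - a) l j)"
  using assms(2)
proof (induction N arbitrary: i)
  case 0
  have "(\<Sum>k\<in>I. \<Sum>l\<in>I. of_bool (i = k) * (X k l - Y k l) * of_bool (l = j)) =
      (\<Sum>k\<in>I. of_bool (i = k) * (\<Sum>l\<in>I. (X k l - Y k l) * of_bool (l = j)))"
    by (simp add: sum_distrib_left mult.assoc)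
  also have "\<dots> = (\<Sum>l\<in>I. (X i l - Y i l) * of_bool (l = j))"
    by (rule sum_of_bool_eq_mult[OF assms(1) 0])
  finally show ?case by (simp add: left_diff_distrib sum_subtractf)
next
  case (Suc N)
  let ?T = "\<lambda>N a i. \<Sum>k\<in>I. \<Sum>l\<in>I. mpow I X a i k * (X k l - Y k l) * mpow I Y (N - a) l j"
  have "mpow I X (Suc (Suc N)) i j - mpow I Y (Suc (Suc N)) i j =
     (\<Sum>h\<in>I. X i h * (mpow I X (Suc N) h j - mpow I Y (Suc N) h j)) +
     (\<Sum>h\<in>I. (X i h - Y i h) * mpow I Y (Suc N) h j)"
    by (simp only: mpow.simps(2)[of I X "Suc N"] mpow.simps(2)[of I Y "Suc N"]
        sum_subtractf[symmetric] sum.distrib[symmetric] algebra_simps) (simp add: algebra_simps)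
  also have "(\<Sum>h\<in>I. X i h * (mpow I X (Suc N) h j - mpow I Y (Suc N) h j)) =
      (\<Sum>h\<in>I. \<Sum>a\<le>N. X i h * ?T N a h)"
    using Suc.IH by (simp add: sum_distrib_left del: mpow.simps)
  also have "\<dots> = (\<Sum>a\<le>N. \<Sum>h\<in>I. X i h * ?T N a h)" by (rule sum.swap)
  also have "\<dots> = (\<Sum>a\<le>N. ?T (Suc N) (Suc a) i)"
  proof (rule sum.cong[OF refl])
    fix a
    have "(\<Sum>h\<in>I. X i h * ?T N a h) = (\<Sum>h\<in>I. \<Sum>k\<in>I. \<Sum>l\<in>I. X i h * mpow I X a h k * (X k l - Y k l) * mpow I Y (N - a) l j)"
      by (simp add: sum_distrib_left mult.assoc)
    also have "\<dots> = (\<Sum>k\<in>I. \<Sum>h\<in>I. \<Sum>l\<in>I. X i h * mpow I X a h k * (X k l - Y k l) * mpow I Y (N - a) l j)"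
      by (rule sum.swap)
    also have "\<dots> = (\<Sum>k\<in>I. \<Sum>l\<in>I. \<Sum>h\<in>I. X i h * mpow I X a h k * (X k l - Y k l) * mpow I Y (N - a) l j)"
      by (intro sum.cong refl sum.swap)
    finally show "(\<Sum>h\<in>I. X i h * ?T N a h) = ?T (Suc N) (Suc a) i"
      by (simp add: sum_distrib_right)
  qed
  also have "(\<Sum>h\<in>I. (X i h - Y i h) * mpow I Y (Suc N) h j) = ?T (Suc N) 0 i"
    using sum_of_bool_eq_mult[OF assms(1) Suc.prems, of "\<lambda>k. \<Sum>l\<in>I. (X k l - Y k l) * mpow I Y (Suc N) l j"]
    by (simp add: sum_distrib_left mult.assoc del: mpow.simps(2))
  finally show ?case by (simp add: sum.atMost_Suc_shift del: mpow.simps sum.atMost_Suc)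
qed

text \<open>The sequence \<open>|X\<^sup>a g|\<^sup>2\<close> is log-convex in \<open>a\<close>, and its term at \<open>m\<close> is at most
  \<open>tr (X\<^bsup>2m\<^esup>) |g|\<^sup>2\<close>. This bounds its term at 1, and with it the bilinear form.\<close>

lemma symmetric_norm_le_trace:
  fixes f g :: "'a \<Rightarrow> real"
  assumes fin: "finite I" and sym: "\<And>i j. i \<in> I \<Longrightarrow> j \<in> I \<Longrightarrow> X i j = X j i"
    and m: "1 \<le> m" and tr: "(\<Sum>i\<in>I. mpow I X (2 * m) i i) \<le> (\<theta>\<^sup>2) ^ m" and th: "0 < \<theta>"
  shows "\<bar>\<Sum>i\<in>I. \<Sum>j\<in>I. X i j * f i * g j\<bar> \<le> \<theta> * sqrt (\<Sum>i\<in>I. (f i)\<^sup>2) * sqrt (\<Sum>i\<in>I. (g i)\<^sup>2)"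
proof -
  define v where "v a i = (\<Sum>j\<in>I. mpow I X a i j * g j)" for a i
  define G where "G = (\<Sum>i\<in>I. (g i)\<^sup>2)"
  define c where "c a = (\<Sum>i\<in>I. (v a i)\<^sup>2)" for a
  have v0: "v 0 i = g i" if "i \<in> I" for i
    using sum_of_bool_eq_mult[OF fin that, of g] by (simp add: v_def)
  have vS: "v (Suc a) i = (\<Sum>k\<in>I. X i k * v a k)" for a i
    unfolding v_def by (simp add: sum_distrib_left sum_distrib_right mult.assoc) (rule sum.swap)
  have c_eq: "c (Suc a) = (\<Sum>k\<in>I. v a k * v (Suc (Suc a)) k)" for a
  proof -
    have "c (Suc a) = (\<Sum>i\<in>I. \<Sum>k\<in>I. v (Suc a) i * (X i k * v a k))"
      unfolding c_def power2_eq_square by (subst (2) vS) (simp add: sum_distrib_left)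
    also have "\<dots> = (\<Sum>k\<in>I. \<Sum>i\<in>I. v a k * (X k i * v (Suc a) i))"
      by (subst sum.swap) (intro sum.cong refl, simp add: sym mult_ac)
    finally show ?thesis by (subst vS) (simp add: sum_distrib_left)
  qed
  have c_conv: "(c (Suc a))\<^sup>2 \<le> c a * c (Suc (Suc a))" for a
    unfolding c_eq[of a] unfolding c_def by (rule Cauchy_Schwarz_ineq_sum)
  have c0: "c 0 = G" unfolding c_def G_def by (intro sum.cong refl) (simp add: v0)
  have cm: "c m \<le> (\<Sum>i\<in>I. mpow I X (2 * m) i i) * G"
  proof -
    have "c m \<le> (\<Sum>i\<in>I. (\<Sum>j\<in>I. (mpow I X m i j)\<^sup>2) * G)"
      unfolding c_def v_def G_def by (intro sum_mono Cauchy_Schwarz_ineq_sum)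
    then show ?thesis
      by (simp add: sum_distrib_right mpow_double[OF fin sym] cong: sum.cong)
  qed
  have c1: "c 1 \<le> \<theta>\<^sup>2 * G"
  proof (cases "G = 0")
    case True
    then have "g i = 0" if "i \<in> I" for i
      using that fin unfolding G_def by (simp add: sum_nonneg_eq_0_iff)
    then show ?thesis by (simp add: c_def v_def True)
  next
    case False
    then have G: "0 < G" unfolding G_def using sum_nonneg[of I "\<lambda>i. (g i)\<^sup>2"] by simp
    have "c 1 / G \<le> (\<theta>\<^sup>2) ^ 1"
    proof (rule log_convex_bound[of "\<lambda>a. c a / G" m])
      show "0 \<le> c i / G" for i using G by (simp add: c_def sum_nonneg)
      show "(c (Suc i) / G)\<^sup>2 \<le> c i / G * (c (Suc (Suc i)) / G)" for i
        using c_conv[of i] G by (simp add: power2_eq_square field_simps)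
      show "c m / G \<le> (\<theta>\<^sup>2) ^ m"
        using order_trans[OF cm mult_right_mono[OF tr, of G]] G by (simp add: pos_divide_le_eq)
    qed (use c0 G m th in auto)
    then show ?thesis using G by (simp add: field_simps)
  qed
  have "v 1 i = (\<Sum>j\<in>I. X i j * g j)" for i
    using vS[of 0 i] v0 by simp
  then have "(\<Sum>i\<in>I. \<Sum>j\<in>I. X i j * f i * g j) = (\<Sum>i\<in>I. f i * v 1 i)"
    by (simp add: sum_distrib_left mult_ac)
  then have "(\<Sum>i\<in>I. \<Sum>j\<in>I. X i j * f i * g j)\<^sup>2 \<le> (\<Sum>i\<in>I. (f i)\<^sup>2) * c 1"
    unfolding c_def by (simp add: Cauchy_Schwarz_ineq_sum)
  also have "\<dots> \<le> (\<Sum>i\<in>I. (f i)\<^sup>2) * (\<theta>\<^sup>2 * G)" using c1 by (intro mult_left_mono sum_nonneg) auto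
  finally have "\<bar>\<Sum>i\<in>I. \<Sum>j\<in>I. X i j * f i * g j\<bar> \<le> sqrt ((\<Sum>i\<in>I. (f i)\<^sup>2) * (\<theta>\<^sup>2 * G))"
    using real_sqrt_le_mono real_sqrt_abs by fastforce
  then show ?thesis using th by (simp add: G_def[symmetric] real_sqrt_mult mult_ac)
qed

text \<open>The difference of the powers telescopes into \<open>2 K + 1\<close> terms \<open>X\<^sup>a (X - Y) Y\<^bsup>2K-a\<^esup>\<close>. Since \<open>X - Y\<close> has only the entries
  \<open>(j, k)\<close> and \<open>(k, j)\<close>, each of them is a sum of two products of an entry of \<open>X\<^sup>a\<close> and an entry of \<open>Y\<^bsup>2K-a\<^esup>\<close>. If
  \<open>R\<^bsup>2K\<^esup>\<close> is the sum of the four diagonal entries, such a product is at most \<open>R\<^sup>a R\<^bsup>2K-a\<^esup>\<close>.\<close>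

lemma mpow_perturb_edge:
  assumes fin: "finite I" and j: "j \<in> I" and k: "k \<in> I" and "j \<noteq> k"
    and symX: "\<And>a b. a \<in> I \<Longrightarrow> b \<in> I \<Longrightarrow> X a b = X b a"
    and symY: "\<And>a b. a \<in> I \<Longrightarrow> b \<in> I \<Longrightarrow> Y a b = Y b a"
    and diff: "\<And>a b. a \<in> I \<Longrightarrow> b \<in> I \<Longrightarrow> X a b - Y a b = of_bool (a = j \<and> b = k \<or> a = k \<and> b = j)"
  shows "mpow I X (Suc (2 * K)) j k - mpow I Y (Suc (2 * K)) j k \<le> 2 * (2 * real K + 1) *
    (mpow I X (2 * K) j j + mpow I X (2 * K) k k + mpow I Y (2 * K) j j + mpow I Y (2 * K) k k)"
    (is "?lhs \<le> _ * ?S")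
proof (rule field_le_epsilon)
  \<comment> \<open>The slack keeps \<open>R\<close> positive when all four diagonal entries vanish.\<close>
  fix \<eta> :: real assume "0 < \<eta>"
  define \<kappa> where "\<kappa> = \<eta> / (2 * (2 * real K + 1))"
  have \<kappa>: "0 < \<kappa>" using \<open>0 < \<eta>\<close> by (simp add: \<kappa>_def)
  have nn: "0 \<le> mpow I X (2 * K) a a" "0 \<le> mpow I Y (2 * K) a a" if "a \<in> I" for a
    using mpow_double[OF fin symX that, where a = K] mpow_double[OF fin symY that, where a = K]
    by (simp_all add: sum_nonneg)
  obtain R where R: "0 < R" "?S \<le> (R\<^sup>2) ^ K \<or> K = 0" "R ^ (2 * K) \<le> ?S + \<kappa>"
  proof (cases "K = 0")
    case True then show ?thesis using that[of 1] \<kappa> by simp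
  next
    case False
    let ?R = "root (2 * K) (?S + \<kappa>)"
    have "0 < ?S + \<kappa>" using nn j k \<kappa> by (intro add_nonneg_pos add_nonneg_nonneg) auto
    then have "0 < ?R" "?R ^ (2 * K) = ?S + \<kappa>" using False by simp_all
    then show ?thesis using that[of ?R] \<kappa> by (simp add: power_mult)
  qed
  have diagX: "mpow I X (2 * K) a a \<le> (R\<^sup>2) ^ K" and diagY: "mpow I Y (2 * K) a a \<le> (R\<^sup>2) ^ K"
    if "a \<in> {j, k}" for a
    using R(2) that nn[OF j] nn[OF k] by auto
  have ent: "\<bar>mpow I X a u v\<bar> \<le> R ^ a" "\<bar>mpow I Y a u v\<bar> \<le> R ^ a"
    if "u \<in> {j, k}" "v \<in> {j, k}" "a \<le> 2 * K" for a u v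
  proof -
    have uv: "u \<in> I" "v \<in> I" using that j k by auto
    show "\<bar>mpow I X a u v\<bar> \<le> R ^ a"
      by (rule mpow_entry_bound[OF fin symX uv diagX[OF that(1)] diagX[OF that(2)] R(1) that(3)])
    show "\<bar>mpow I Y a u v\<bar> \<le> R ^ a"
      by (rule mpow_entry_bound[OF fin symY uv diagY[OF that(1)] diagY[OF that(2)] R(1) that(3)])
  qed
  have prod_le: "mpow I X a u v * mpow I Y (2 * K - a) w z \<le> ?S + \<kappa>"
    if "u \<in> {j, k}" "v \<in> {j, k}" "w \<in> {j, k}" "z \<in> {j, k}" "a \<le> 2 * K" for a u v w z
  proof -
    have "\<bar>mpow I X a u v * mpow I Y (2 * K - a) w z\<bar> \<le> R ^ a * R ^ (2 * K - a)"
      unfolding abs_mult using that R(1) by (intro mult_mono ent) auto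
    also have "\<dots> = R ^ (2 * K)" using that by (simp flip: power_add)
    finally show ?thesis using R(3) by linarith
  qed
  have "?lhs = (\<Sum>a\<le>2 * K. \<Sum>u\<in>I. \<Sum>v\<in>I. mpow I X a j u * (X u v - Y u v) * mpow I Y (2 * K - a) v k)"
    by (rule mpow_diff[OF fin j])
  also have "\<dots> = (\<Sum>a\<le>2 * K. mpow I X a j j * mpow I Y (2 * K - a) k k
      + mpow I X a j k * mpow I Y (2 * K - a) j k)"
  proof (rule sum.cong[OF refl])
    fix a
    have "(\<Sum>u\<in>I. \<Sum>v\<in>I. mpow I X a j u * (X u v - Y u v) * mpow I Y (2 * K - a) v k) =
       (\<Sum>u\<in>I. \<Sum>v\<in>I. of_bool (j = u) * (of_bool (k = v) * (mpow I X a j u * mpow I Y (2 * K - a) v k))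
        + of_bool (k = u) * (of_bool (j = v) * (mpow I X a j u * mpow I Y (2 * K - a) v k)))"
      using \<open>j \<noteq> k\<close> by (intro sum.cong refl) (auto simp: diff)
    then show "(\<Sum>u\<in>I. \<Sum>v\<in>I. mpow I X a j u * (X u v - Y u v) * mpow I Y (2 * K - a) v k) =
       mpow I X a j j * mpow I Y (2 * K - a) k k + mpow I X a j k * mpow I Y (2 * K - a) j k"
      using fin j k by (simp add: sum.distrib sum_distrib_left[symmetric] sum_of_bool_eq_mult)
  qed
  also have "\<dots> \<le> (\<Sum>a\<le>2 * K. (?S + \<kappa>) + (?S + \<kappa>))"
    by (intro sum_mono add_mono prod_le) auto
  also have "\<dots> = 2 * (2 * real K + 1) * ?S + 2 * (2 * real K + 1) * \<kappa>"
    by (simp add: algebra_simps)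
  also have "2 * (2 * real K + 1) * \<kappa> = \<eta>" by (simp add: \<kappa>_def add_pos_nonneg)
  finally show "?lhs \<le> 2 * (2 * real K + 1) * ?S + \<eta>" .
qed

text \<open>A form of Young's inequality: if \<open>B\<close> is below the growth rate of the diagonal moments, the next moment
  dominates, and otherwise \<open>B\<close> to the power \<open>K + 1\<close> does. It lets the trace moment below be absorbed into itself,
  in place of an induction on the exponent.\<close>

lemma mpow_Young:
  assumes fin: "finite I" and i: "i \<in> I" and sym: "\<And>a b. a \<in> I \<Longrightarrow> b \<in> I \<Longrightarrow> X a b = X b a"
    and B: "0 < B"
  shows "B * mpow I X (2 * K) i i \<le> mpow I X (2 * Suc K) i i + B ^ Suc K"
proof -
  define t where "t = mpow I X (2 * Suc K) i i"
  have "t = (\<Sum>k\<in>I. (mpow I X (Suc K) i k)\<^sup>2)"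
    unfolding t_def by (rule mpow_double[OF fin sym i])
  then have t0: "0 \<le> t" by (simp only: sum_nonneg zero_le_power2)
  define S where "S = max B (root (Suc K) t)"
  have S: "0 < S" using B by (simp add: S_def)
  have "t = root (Suc K) t ^ Suc K" using t0 by (simp only: real_root_pow_pos2 zero_less_Suc)
  also have "\<dots> \<le> S ^ Suc K" using t0 by (intro power_mono) (auto simp: S_def)
  finally have "mpow I X (2 * K) i i \<le> S ^ K"
    using mpow_diag_bound[OF fin sym i _ S, where K = "Suc K" and a = K]
    by (simp add: t_def del: mpow.simps power_Suc mult_Suc_right)
  then have "B * mpow I X (2 * K) i i \<le> B * S ^ K" using B by simp
  also have "\<dots> \<le> S ^ Suc K" using B by (simp add: S_def mult_right_mono)
  also have "\<dots> \<le> t + B ^ Suc K"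
  proof (cases "S = B")
    case False
    then have "S = root (Suc K) t" by (auto simp: S_def max_def split: if_splits)
    then have "S ^ Suc K = t" using t0 by (simp only: real_root_pow_pos2 zero_less_Suc)
    then show ?thesis using B by simp
  qed (use t0 in auto)
  finally show ?thesis by (simp add: t_def)
qed

section \<open>The random graph is nearly regular\<close>

lemma finite_index_pairs [simp]: "finite (index_pairs n)"
proof -
  have "index_pairs n \<subseteq> {1..n} \<times> {1..n}" by (auto simp: index_pairs_def)
  then show ?thesis by (rule finite_subset) auto
qed

lemma sum_square_eq_sum_pairs:
  fixes F :: "nat \<Rightarrow> nat \<Rightarrow> 'a :: comm_monoid_add"
  assumes "\<And>j. F j j = 0"
  shows "(\<Sum>j=1..n. \<Sum>k=1..n. F j k) = (\<Sum>(j, k)\<in>index_pairs n. F j k + F k j)"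
proof -
  let ?P = "index_pairs n" and ?Q = "(\<lambda>(j, k). (k, j)) ` index_pairs n"
  have "(\<Sum>j=1..n. \<Sum>k=1..n. F j k) = (\<Sum>(j, k)\<in>{1..n} \<times> {1..n}. F j k)"
    by (simp add: sum.cartesian_product)
  also have "\<dots> = (\<Sum>(j, k)\<in>?P \<union> ?Q. F j k)"
  proof (intro sum.mono_neutral_right ballI)
    fix e assume "e \<in> {1..n} \<times> {1..n} - (?P \<union> ?Q)"
    then have "fst e = snd e" by (force simp: index_pairs_def image_iff prod_eq_iff)
    then show "(case e of (j, k) \<Rightarrow> F j k) = 0" using assms by (simp add: case_prod_unfold)
  next
    show "finite ({1..n} \<times> {1..n})" by simp
    show "?P \<union> ?Q \<subseteq> {1..n} \<times> {1..n}" by (auto simp: index_pairs_def)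
  qed
  also have "\<dots> = (\<Sum>(j, k)\<in>?P. F j k) + (\<Sum>(j, k)\<in>?Q. F j k)"
  proof (rule sum.union_disjoint)
    show "?P \<inter> ?Q = {}" by (auto simp: index_pairs_def)
  qed auto
  also have "(\<Sum>(j, k)\<in>?Q. F j k) = (\<Sum>(j, k)\<in>?P. F k j)"
    by (subst sum.reindex) (auto simp: inj_on_def case_prod_unfold)
  finally show ?thesis by (simp add: sum.distrib case_prod_unfold)
qed

abbreviation graph_law :: "'e set \<Rightarrow> real \<Rightarrow> ('e \<Rightarrow> bool) measure" where
  "graph_law I p \<equiv> (\<Pi>\<^sub>M e\<in>I. measure_pmf (bernoulli_pmf p))"

lemma sets_graph_law: "finite I \<Longrightarrow> sets (graph_law I p) = Pow (I \<rightarrow>\<^sub>E UNIV)"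
proof -
  assume "finite I"
  have "sets (graph_law I p) = sets (\<Pi>\<^sub>M e\<in>I. count_space (UNIV :: bool set))"
    by (intro sets_PiM_cong) auto
  also have "\<dots> = sets (count_space (I \<rightarrow>\<^sub>E (UNIV :: bool set)))"
    using \<open>finite I\<close> by (subst count_space_PiM_finite) auto
  finally show ?thesis by simp
qed

lemma space_graph_law: "space (graph_law I p) = (I \<rightarrow>\<^sub>E UNIV)"
  by (simp add: space_PiM)

lemma prob_space_graph_law: "prob_space (graph_law I p)"
  by (intro prob_space_PiM measure_pmf.prob_space_axioms)

lemma borel_measurable_graph_law [measurable]:
  "finite I \<Longrightarrow> f \<in> measurable (graph_law I p) borel"
  by (auto simp: measurable_def sets_graph_law space_graph_law)

lemma integrable_graph_law:
  fixes f :: "('e \<Rightarrow> bool) \<Rightarrow> real"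
  assumes "finite I"
  shows "integrable (graph_law I p) f"
proof -
  interpret prob_space "graph_law I p" by (rule prob_space_graph_law)
  have fin: "finite (I \<rightarrow>\<^sub>E (UNIV :: bool set))" using assms by (intro finite_PiE) auto
  define B where "B = Max (insert 0 ((\<lambda>A. \<bar>f A\<bar>) ` (I \<rightarrow>\<^sub>E UNIV)))"
  have "\<bar>f A\<bar> \<le> B" if "A \<in> I \<rightarrow>\<^sub>E UNIV" for A
    unfolding B_def using fin that by (intro Max_ge) auto
  then show ?thesis
    using assms by (intro integrable_const_bound[of _ B] AE_I2) (auto simp: space_graph_law)
qed

lemma expectation_graph_law_mono:
  fixes f g :: "('e \<Rightarrow> bool) \<Rightarrow> real"
  assumes "finite I" "\<And>A. A \<in> I \<rightarrow>\<^sub>E UNIV \<Longrightarrow> f A \<le> g A"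
  shows "integral\<^sup>L (graph_law I p) f \<le> integral\<^sup>L (graph_law I p) g"
  using assms by (intro integral_mono integrable_graph_law) (auto simp: space_graph_law)

text \<open>Conditioning on all edges but \<open>e\<close>.\<close>

lemma expectation_graph_law_resample:
  fixes f :: "('e \<Rightarrow> bool) \<Rightarrow> real"
  assumes I: "finite I" "e \<in> I" and p: "0 \<le> p" "p \<le> 1"
  shows "integral\<^sup>L (graph_law I p) f =
    integral\<^sup>L (graph_law I p) (\<lambda>A. p * f (A(e := True)) + (1 - p) * f (A(e := False)))"
proof -
  interpret product_sigma_finite "\<lambda>e :: 'e. measure_pmf (bernoulli_pmf p)" ..
  let ?J = "I - {e}"
  have I': "I = insert e ?J" "finite ?J" "e \<notin> ?J" using I by auto
  have fold: "integral\<^sup>L (graph_law I p) g =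
      (\<integral>x. p * g (x(e := True)) + (1 - p) * g (x(e := False)) \<partial>graph_law ?J p)" for g :: "_ \<Rightarrow> real"
  proof -
    have "integral\<^sup>L (graph_law I p) g = (\<integral>x. (\<integral>y. g (x(e := y)) \<partial>measure_pmf (bernoulli_pmf p)) \<partial>graph_law ?J p)"
      using product_integral_insert[OF I'(2,3), of g] I'(1) integrable_graph_law[OF I(1), of p g] by simp
    then show ?thesis using p by (simp add: mult.commute)
  qed
  show ?thesis by (subst (1 2) fold) (simp add: algebra_simps)
qed

text \<open>Only the values of \<open>A\<close> on pairs \<open>j < k\<close> count; they are extended symmetrically, with zero diagonal.\<close>

definition adj :: "(nat \<times> nat \<Rightarrow> bool) \<Rightarrow> nat \<Rightarrow> nat \<Rightarrow> real" where
  "adj A j k = of_bool (j < k \<and> A (j, k)) + of_bool (k < j \<and> A (k, j))"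

definition adj_dev :: "real \<Rightarrow> (nat \<times> nat \<Rightarrow> bool) \<Rightarrow> nat \<Rightarrow> nat \<Rightarrow> real" where
  "adj_dev p A j k = (if j = k then 0 else adj A j k - p)"

lemma adj_sym: "adj A j k = adj A k j" by (simp add: adj_def)
lemma adj_diag [simp]: "adj A j j = 0" by (simp add: adj_def)
lemma adj_bounds: "0 \<le> adj A j k" "adj A j k \<le> 1" by (auto simp: adj_def)
lemma adj_dev_sym: "adj_dev p A j k = adj_dev p A k j" by (simp add: adj_dev_def adj_sym)
lemma adj_edge: "j < k \<Longrightarrow> adj A j k = of_bool (A (j, k))" by (simp add: adj_def)

text \<open>The trace is \<open>2 \<Sum> \<xi>\<^sub>e F\<^sub>e\<close> over the edges \<open>e = (j, k)\<close>, where \<open>\<xi>\<^sub>e\<close> is the centred entry and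
  \<open>F\<^sub>e\<close> the \<open>(j, k)\<close> entry of the power \<open>2 K + 1\<close>. Resampling \<open>e\<close> gives
  \<open>E (\<xi>\<^sub>e F\<^sub>e) = p (1 - p) E (F\<^sub>e[e present] - F\<^sub>e[e absent])\<close>, and a single edge changes \<open>F\<^sub>e\<close> by no more than
  \<open>O(K)\<close> diagonal entries of the power \<open>2 K\<close>. Undoing the resampling, the sum over \<open>e\<close> collects into
  \<open>O(K) \<Sum>\<^sub>i D\<^sub>i (X\<^bsup>2K\<^esup>)\<^sub>i\<^sub>i\<close> with the degree-like factors \<open>D\<^sub>i = \<Sum>\<^sub>k (A\<^sub>i\<^sub>k + p)\<close>. Young's inequality bounds this
  by half of the original trace plus a multiple of \<open>\<Sum>\<^sub>i (16 (K + 1) D\<^sub>i)\<^bsup>K+1\<^esup>\<close>.\<close>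

lemma trace_moment_bound:
  fixes K :: nat
  assumes p: "0 < p" "p \<le> 1" and n: "2 \<le> n"
  defines "G \<equiv> graph_law (index_pairs n) p"
  shows "(\<integral>A. (\<Sum>i=1..n. mpow {1..n} (adj_dev p A) (2 * Suc K) i i) \<partial>G) \<le>
    (\<Sum>i=1..n. \<integral>A. (16 * Suc K * (\<Sum>k\<in>{1..n} - {i}. adj A i k + p)) ^ Suc K \<partial>G)"
proof -
  let ?V = "{1..n}" and ?I = "index_pairs n"
  define E :: "_ \<Rightarrow> real" where "E = integral\<^sup>L G"
  define mp where "mp A a = mpow ?V (adj_dev p A) a" for A a
  define \<alpha> where "\<alpha> A i = mp A (2 * K) i i" for A i
  define D where "D A i = (\<Sum>k\<in>?V - {i}. adj A i k + p)" for A i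
  define c where "c = 2 * real K + 1"
  have int: "integrable G f" for f :: "_ \<Rightarrow> real"
    unfolding G_def by (rule integrable_graph_law) simp
  have E_add: "E (\<lambda>A. f A + g A) = E f + E g" for f g unfolding E_def by (simp add: int)
  have E_diff: "E (\<lambda>A. f A - g A) = E f - E g" for f g unfolding E_def by (simp add: int)
  have E_cmult: "E (\<lambda>A. r * f A) = r * E f" for f r unfolding E_def by simp
  have E_sum: "E (\<lambda>A. \<Sum>i\<in>S. f i A) = (\<Sum>i\<in>S. E (f i))" for f and S :: "'s set"
    unfolding E_def by (rule Bochner_Integration.integral_sum) (rule int)
  have E_mono: "E f \<le> E g" if "\<And>A. f A \<le> g A" for f g
    unfolding E_def G_def using that by (intro expectation_graph_law_mono) auto
  have E_res: "E f = E (\<lambda>A. p * f (A(e := True)) + (1 - p) * f (A(e := False)))" if "e \<in> ?I" for f e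
    unfolding E_def G_def using that p by (intro expectation_graph_law_resample) auto
  have mp_sym: "mp A a j k = mp A a k j" if "j \<in> ?V" "k \<in> ?V" for A a j k
    unfolding mp_def using that by (intro mpow_sym adj_dev_sym) auto
  have \<alpha>_nn: "0 \<le> \<alpha> A i" if "i \<in> ?V" for A i
    unfolding \<alpha>_def mp_def using mpow_double[of ?V "adj_dev p A" i K] that adj_dev_sym by (simp add: sum_nonneg)
  have D_pos: "0 < D A i" if "i \<in> ?V" for A i
  proof -
    have "(if i = 1 then 2 else 1) \<in> ?V - {i}" using n that by auto
    then have "?V - {i} \<noteq> {}" by blast
    then show ?thesis unfolding D_def using adj_bounds p by (intro sum_pos) (auto intro: add_nonneg_pos)
  qed
  have tr_eq: "(\<Sum>i=1..n. mp A (2 * Suc K) i i) = (\<Sum>(j, k)\<in>?I. 2 * (adj_dev p A j k * mp A (Suc (2 * K)) j k))" for A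
  proof -
    have "(\<Sum>i=1..n. mp A (2 * Suc K) i i) = (\<Sum>j=1..n. \<Sum>k=1..n. adj_dev p A j k * mp A (Suc (2 * K)) k j)"
      by (simp add: mp_def)
    also have "\<dots> = (\<Sum>(j, k)\<in>?I. adj_dev p A j k * mp A (Suc (2 * K)) k j + adj_dev p A k j * mp A (Suc (2 * K)) j k)"
      by (rule sum_square_eq_sum_pairs) (simp add: adj_dev_def)
    also have "\<dots> = (\<Sum>(j, k)\<in>?I. 2 * (adj_dev p A j k * mp A (Suc (2 * K)) j k))"
    proof (intro sum.cong refl, clarify)
      fix j k assume "(j, k) \<in> ?I"
      then have "mp A (Suc (2 * K)) k j = mp A (Suc (2 * K)) j k" "adj_dev p A k j = adj_dev p A j k"
        by (auto intro!: mp_sym adj_dev_sym simp: index_pairs_def)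
      then show "adj_dev p A j k * mp A (Suc (2 * K)) k j + adj_dev p A k j * mp A (Suc (2 * K)) j k =
          2 * (adj_dev p A j k * mp A (Suc (2 * K)) j k)" by simp
    qed
    finally show ?thesis .
  qed
  have edge: "E (\<lambda>A. adj_dev p A j k * mp A (Suc (2 * K)) j k) \<le>
      2 * c * E (\<lambda>A. (adj A j k + p) * (\<alpha> A j + \<alpha> A k))" if e: "(j, k) \<in> ?I" for j k
  proof -
    let ?F = "\<lambda>A. mp A (Suc (2 * K)) j k" and ?s = "\<lambda>A. \<alpha> A j + \<alpha> A k"
    have jk: "j < k" "j \<in> ?V" "k \<in> ?V" using e by (auto simp: index_pairs_def)
    have "E (\<lambda>A. adj_dev p A j k * ?F A) =
        E (\<lambda>A. p * (1 - p) * (?F (A((j, k) := True)) - ?F (A((j, k) := False))))"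
      using jk by (subst E_res[OF e]) (simp add: adj_dev_def adj_edge algebra_simps)
    also have "\<dots> \<le> E (\<lambda>A. p * (1 - p) * (2 * c * (?s (A((j, k) := True)) + ?s (A((j, k) := False)))))"
    proof (intro E_mono mult_left_mono)
      fix A
      have "adj_dev p (A((j, k) := True)) a b - adj_dev p (A((j, k) := False)) a b =
          of_bool (a = j \<and> b = k \<or> a = k \<and> b = j)" for a b
        using jk by (auto simp: adj_dev_def adj_def)
      then show "?F (A((j, k) := True)) - ?F (A((j, k) := False)) \<le> 2 * c * (?s (A((j, k) := True)) + ?s (A((j, k) := False)))"
        unfolding \<alpha>_def mp_def c_def add.assoc[symmetric] using jk
        by (intro mpow_perturb_edge adj_dev_sym) auto
    qed (use p in auto)
    \<comment> \<open>Enlarging \<open>1 - p\<close> to \<open>1 + p\<close> makes the right-hand side the resampled form of \<open>(A\<^sub>j\<^sub>k + p) (\<alpha>\<^sub>j + \<alpha>\<^sub>k)\<close>.\<close>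
    also have "\<dots> \<le> E (\<lambda>A. p * (2 * c * ((1 + p) * ?s (A((j, k) := True)))) +
        (1 - p) * (2 * c * (p * ?s (A((j, k) := False)))))"
    proof (intro E_mono)
      fix A
      have "p * (2 * c) * ((1 - p) * ?s (A((j, k) := True))) \<le> p * (2 * c) * ((1 + p) * ?s (A((j, k) := True)))"
        using p \<alpha>_nn jk by (intro mult_left_mono mult_right_mono) (auto simp: c_def)
      then show "p * (1 - p) * (2 * c * (?s (A((j, k) := True)) + ?s (A((j, k) := False)))) \<le>
          p * (2 * c * ((1 + p) * ?s (A((j, k) := True)))) + (1 - p) * (2 * c * (p * ?s (A((j, k) := False))))"
        by (simp add: algebra_simps)
    qed
    also have "\<dots> = E (\<lambda>A. 2 * c * ((adj A j k + p) * ?s A))"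
      using jk by (subst (2) E_res[OF e]) (simp add: adj_edge algebra_simps)
    finally show ?thesis by (simp add: E_cmult)
  qed
  have "E (\<lambda>A. \<Sum>i=1..n. mp A (2 * Suc K) i i) =
      (\<Sum>(j, k)\<in>?I. 2 * E (\<lambda>A. adj_dev p A j k * mp A (Suc (2 * K)) j k))"
    unfolding tr_eq by (simp add: case_prod_unfold E_sum E_cmult)
  also have "\<dots> \<le> (\<Sum>(j, k)\<in>?I. 2 * (2 * c * E (\<lambda>A. (adj A j k + p) * (\<alpha> A j + \<alpha> A k))))"
    by (intro sum_mono) (use edge in \<open>auto simp: mult.assoc\<close>)
  also have "\<dots> = E (\<lambda>A. 4 * c * (\<Sum>(j, k)\<in>?I. (adj A j k + p) * (\<alpha> A j + \<alpha> A k)))"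
    by (simp add: case_prod_unfold E_sum E_cmult sum_distrib_left mult.assoc)
  also have "\<dots> = E (\<lambda>A. 4 * c * (\<Sum>i=1..n. D A i * \<alpha> A i))"
  proof (intro arg_cong[of _ _ E] ext arg_cong2[of _ _ _ _ "(*)"] refl)
    fix A
    let ?H = "\<lambda>j k. of_bool (j \<noteq> k) * ((adj A j k + p) * \<alpha> A j)"
    have "(\<Sum>i=1..n. D A i * \<alpha> A i) = (\<Sum>j=1..n. \<Sum>k=1..n. ?H j k)"
    proof (rule sum.cong[OF refl])
      fix j assume j: "j \<in> ?V"
      have "(\<Sum>k=1..n. ?H j k) = (\<Sum>k\<in>?V - {j}. ?H j k)"
        using j by (intro sum.mono_neutral_right) auto
      also have "\<dots> = (\<Sum>k\<in>?V - {j}. (adj A j k + p) * \<alpha> A j)" by (intro sum.cong) auto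
      finally show "D A j * \<alpha> A j = (\<Sum>k=1..n. ?H j k)" by (simp add: D_def sum_distrib_right)
    qed
    also have "\<dots> = (\<Sum>(j, k)\<in>?I. ?H j k + ?H k j)"
      by (rule sum_square_eq_sum_pairs) simp
    also have "\<dots> = (\<Sum>(j, k)\<in>?I. (adj A j k + p) * (\<alpha> A j + \<alpha> A k))"
      by (intro sum.cong refl) (auto simp: index_pairs_def adj_sym algebra_simps)
    finally show "(\<Sum>(j, k)\<in>?I. (adj A j k + p) * (\<alpha> A j + \<alpha> A k)) = (\<Sum>i=1..n. D A i * \<alpha> A i)" by simp
  qed
  also have "\<dots> \<le> E (\<lambda>A. (\<Sum>i=1..n. mp A (2 * Suc K) i i) / 2 + (\<Sum>i=1..n. (16 * Suc K * D A i) ^ Suc K) / 2)"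
  proof (rule E_mono)
    fix A
    have "8 * c * D A i * \<alpha> A i \<le> mp A (2 * Suc K) i i + (16 * Suc K * D A i) ^ Suc K" if i: "i \<in> ?V" for i
    proof -
      have "8 * c * D A i * \<alpha> A i \<le> (16 * Suc K * D A i) * \<alpha> A i"
        using less_imp_le[OF D_pos[OF i]] \<alpha>_nn[OF i] by (intro mult_right_mono) (auto simp: c_def)
      also have "\<dots> \<le> mp A (2 * Suc K) i i + (16 * Suc K * D A i) ^ Suc K"
        unfolding \<alpha>_def mp_def using i D_pos[OF i] by (intro mpow_Young adj_dev_sym) auto
      finally show ?thesis .
    qed
    then have "(\<Sum>i=1..n. 8 * c * D A i * \<alpha> A i) \<le> (\<Sum>i=1..n. mp A (2 * Suc K) i i + (16 * Suc K * D A i) ^ Suc K)"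
      by (intro sum_mono)
    moreover have "(\<Sum>i=1..n. 8 * c * D A i * \<alpha> A i) = 2 * (4 * c * (\<Sum>i=1..n. D A i * \<alpha> A i))"
      by (simp add: sum_distrib_left mult.assoc)
    ultimately show "4 * c * (\<Sum>i=1..n. D A i * \<alpha> A i) \<le> (\<Sum>i=1..n. mp A (2 * Suc K) i i) / 2 + (\<Sum>i=1..n. (16 * Suc K * D A i) ^ Suc K) / 2"
      unfolding sum.distrib by linarith
  qed
  also have "\<dots> = E (\<lambda>A. \<Sum>i=1..n. mp A (2 * Suc K) i i) / 2 + (\<Sum>i=1..n. E (\<lambda>A. (16 * Suc K * D A i) ^ Suc K)) / 2"
  proof -
    have half: "E (\<lambda>A. f A / 2) = E f / 2" for f using E_cmult[of "1/2" f] by simp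
    show ?thesis unfolding E_add half by (simp only: E_sum)
  qed
  finally have "E (\<lambda>A. \<Sum>i=1..n. mp A (2 * Suc K) i i) \<le> (\<Sum>i=1..n. E (\<lambda>A. (16 * Suc K * D A i) ^ Suc K))"
    by linarith
  then show ?thesis unfolding E_def mp_def D_def .
qed

lemma sum_neighbours_eq_sum_pairs:
  fixes g :: "nat \<times> nat \<Rightarrow> real"
  assumes i: "i \<in> {1..n}"
  shows "(\<Sum>k\<in>{1..n} - {i}. if i < k then g (i, k) else g (k, i)) =
    (\<Sum>e\<in>index_pairs n. of_bool (i = fst e \<or> i = snd e) * g e)"
proof -
  have "(\<Sum>e\<in>index_pairs n. of_bool (i = fst e \<or> i = snd e) * g e) =
      (\<Sum>e | e \<in> index_pairs n \<and> (i = fst e \<or> i = snd e). g e)"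
    by (simp add: sum.inter_filter[symmetric] if_distrib if_distribR of_bool_def cong: if_cong)
  also have "\<dots> = (\<Sum>k\<in>{1..n} - {i}. if i < k then g (i, k) else g (k, i))"
    using i by (intro sum.reindex_bij_witness[of _ "\<lambda>k. if i < k then (i, k) else (k, i)"
          "\<lambda>e. if i = fst e then snd e else fst e"]) (auto simp: index_pairs_def split: if_splits)
  finally show ?thesis by simp
qed

lemma degree_mgf_le:
  assumes p: "0 \<le> p" "p \<le> 1" and i: "i \<in> {1..n}"
  shows "(\<integral>A. exp (l * (\<Sum>k\<in>{1..n} - {i}. adj A i k)) \<partial>graph_law (index_pairs n) p)
    \<le> exp ((n - 1) * p * (exp l - 1))"
proof -
  interpret product_sigma_finite "\<lambda>e :: nat \<times> nat. measure_pmf (bernoulli_pmf p)" ..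
  let ?I = "index_pairs n"
  let ?b = "\<lambda>e :: nat \<times> nat. of_bool (i = fst e \<or> i = snd e) :: real"
  have deg: "(\<Sum>k\<in>{1..n} - {i}. adj A i k) = (\<Sum>e\<in>?I. ?b e * of_bool (A e))" for A
    unfolding sum_neighbours_eq_sum_pairs[OF i, symmetric] by (intro sum.cong refl) (auto simp: adj_def)
  have card: "(\<Sum>e\<in>?I. ?b e) = real n - 1"
    using sum_neighbours_eq_sum_pairs[OF i, of "\<lambda>_. 1"] i by (simp add: of_nat_diff)
  have "(\<integral>A. exp (l * (\<Sum>k\<in>{1..n} - {i}. adj A i k)) \<partial>graph_law ?I p) =
      (\<integral>A. (\<Prod>e\<in>?I. exp (l * (?b e * of_bool (A e)))) \<partial>graph_law ?I p)"
    unfolding deg sum_distrib_left by (subst exp_sum) auto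
  also have "\<dots> = (\<Prod>e\<in>?I. \<integral>y. exp (l * (?b e * of_bool y)) \<partial>measure_pmf (bernoulli_pmf p))"
    by (rule product_integral_prod) (auto intro: integrable_measure_pmf_finite)
  also have "\<dots> \<le> (\<Prod>e\<in>?I. exp (?b e * (p * (exp l - 1))))"
  proof (intro prod_mono conjI)
    fix e
    show "(\<integral>y. exp (l * (?b e * of_bool y)) \<partial>measure_pmf (bernoulli_pmf p)) \<le> exp (?b e * (p * (exp l - 1)))"
      using p exp_ge_add_one_self[of "p * (exp l - 1)"]
      by (cases "i = fst e \<or> i = snd e") (auto simp: algebra_simps)
  qed (use p in auto)
  also have "\<dots> = exp ((\<Sum>e\<in>?I. ?b e) * (p * (exp l - 1)))"
    by (simp add: exp_sum sum_distrib_right)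
  finally show ?thesis unfolding card by (simp add: mult.assoc)
qed

lemma exp_le_quadratic:
  fixes l :: real
  assumes "\<bar>l\<bar> \<le> 1"
  shows "exp l \<le> 1 + l + l\<^sup>2"
proof (cases "0 \<le> l")
  case True then show ?thesis using assms exp_bound[of l] by simp
next
  case False
  define x where "x = - l"
  have x: "0 \<le> x" "x \<le> 1" using False assms by (auto simp: x_def)
  have "exp (- x) = 1 / exp x" by (simp add: exp_minus divide_inverse)
  also have "\<dots> \<le> 1 / (1 + x)" using x by (intro divide_left_mono) auto
  also have "\<dots> \<le> 1 - x + x\<^sup>2"
  proof -
    have "(1 - x + x\<^sup>2) * (1 + x) = 1 + x ^ 3" by (simp add: power2_eq_square power3_eq_cube algebra_simps)
    then show ?thesis using x by (simp add: pos_divide_le_eq)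
  qed
  finally show ?thesis by (simp add: x_def)
qed

text \<open>Chernoff's bound with the exponent \<open>l = t / (2 n p)\<close>. The upper limit for \<open>t\<close> ensures \<open>l \<le> 1\<close>, where the exponential
  is at most quadratic.\<close>

lemma degree_deviation:
  assumes p: "0 < p" "p \<le> 1" and i: "i \<in> {1..n}" and t: "0 < t" "t \<le> 2 * (n * p)"
  shows "measure (graph_law (index_pairs n) p)
      {A \<in> space (graph_law (index_pairs n) p). t < \<bar>\<Sum>k=1..n. adj_dev p A i k\<bar>}
    \<le> 2 * exp (- t\<^sup>2 / (4 * (n * p)))"
proof -
  let ?G = "graph_law (index_pairs n) p"
  interpret prob_space ?G by (rule prob_space_graph_law)
  define d where "d A = (\<Sum>k\<in>{1..n} - {i}. adj A i k)" for A
  define N where "N = n * p"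
  define M where "M = (n - 1) * p"
  define l where "l = t / (2 * N)"
  have N: "0 < N" using p i by (simp add: N_def)
  have M: "0 \<le> M" "M \<le> N" using p by (auto simp: M_def N_def intro!: mult_right_mono)
  have l: "0 < l" "l \<le> 1" using t N by (auto simp: l_def N_def)
  have dev: "(\<Sum>k=1..n. adj_dev p A i k) = d A - M" for A
  proof -
    have "(\<Sum>k=1..n. adj_dev p A i k) = (\<Sum>k\<in>{1..n} - {i}. adj A i k - p)"
      using i by (intro sum.mono_neutral_cong_right) (auto simp: adj_dev_def)
    then show ?thesis using i by (simp add: d_def M_def sum_subtractf)
  qed
  have tail: "prob {A \<in> space ?G. t < s * (d A - M)} \<le> exp (- t\<^sup>2 / (4 * N))" if s: "s = 1 \<or> s = -1" for s
  proof -
    have "prob {A \<in> space ?G. t < s * (d A - M)} \<le> prob {A \<in> space ?G. exp (l * t) \<le> exp (l * s * (d A - M))}"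
      using l by (intro finite_measure_mono) (auto simp: mult.assoc sets_graph_law space_graph_law)
    also have "\<dots> \<le> (\<integral>A. exp (l * s * (d A - M)) \<partial>?G) / exp (l * t)"
      by (intro integral_Markov_inequality_measure[where A = "{}"] integrable_graph_law) auto
    also have "(\<integral>A. exp (l * s * (d A - M)) \<partial>?G) = exp (- l * s * M) * (\<integral>A. exp (l * s * d A) \<partial>?G)"
      by (subst integral_mult_right_zero[symmetric]) (simp add: exp_add[symmetric] algebra_simps)
    also have "\<dots> / exp (l * t) \<le> exp (- l * s * M) * exp (M * (exp (l * s) - 1)) / exp (l * t)"
      using degree_mgf_le[of p i n "l * s"] p i
      by (intro divide_right_mono mult_left_mono) (auto simp: d_def M_def)
    also have "\<dots> = exp (M * (exp (l * s) - 1 - l * s) - l * t)"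
      by (simp add: exp_add[symmetric] exp_diff[symmetric] algebra_simps)
    also have "\<dots> \<le> exp (N * l\<^sup>2 - l * t)"
    proof -
      have "\<bar>l * s\<bar> \<le> 1" "(l * s)\<^sup>2 = l\<^sup>2" using s l by auto
      then have "M * (exp (l * s) - 1 - l * s) \<le> M * l\<^sup>2"
        using exp_le_quadratic[of "l * s"] M by (intro mult_left_mono) auto
      also have "\<dots> \<le> N * l\<^sup>2" using M by (intro mult_right_mono) auto
      finally show ?thesis by simp
    qed
    also have "N * l\<^sup>2 - l * t = - t\<^sup>2 / (4 * N)"
      using N by (simp add: l_def power2_eq_square field_simps)
    finally show ?thesis .
  qed
  let ?D = "{A \<in> space ?G. t < \<bar>\<Sum>k=1..n. adj_dev p A i k\<bar>}"
  let ?P = "{A \<in> space ?G. t < 1 * (d A - M)}"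
  let ?Q = "{A \<in> space ?G. t < -1 * (d A - M)}"
  have "?D \<subseteq>
      ?P \<union> ?Q"
    unfolding dev by auto
  then have "prob ?D \<le>
      prob (?P \<union> ?Q)"
    by (intro finite_measure_mono) (auto simp: sets_graph_law space_graph_law)
  also have "\<dots> \<le> prob ?P + prob ?Q"
    by (intro measure_Un_le) (auto simp: sets_graph_law space_graph_law)
  also have "\<dots> \<le> 2 * exp (- t\<^sup>2 / (4 * N))" using tail[of 1] tail[of "-1"] by simp
  finally show ?thesis by (simp add: N_def)
qed

text \<open>With slope \<open>l = m / (n p) \<le> 1\<close> one has \<open>(D / (n p))\<^sup>m \<le> exp (l D)\<close>, and the exponential moment at \<open>l\<close> costs
  at most \<open>exp (3 l n p) = exp (3 m)\<close>.\<close>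

lemma degree_moment_le:
  assumes p: "0 < p" "p \<le> 1" and i: "i \<in> {1..n}" and m: "real m \<le> n * p"
  shows "(\<integral>A. (\<Sum>k\<in>{1..n} - {i}. adj A i k + p) ^ m \<partial>graph_law (index_pairs n) p) \<le> (exp 3 * (n * p)) ^ m"
proof -
  let ?G = "graph_law (index_pairs n) p"
  define N where "N = n * p"
  define M where "M = (n - 1) * p"
  define l where "l = m / N"
  define d where "d A = (\<Sum>k\<in>{1..n} - {i}. adj A i k)" for A
  have N: "0 < N" using p i by (simp add: N_def)
  have M: "0 \<le> M" "M \<le> N" using p by (auto simp: M_def N_def intro!: mult_right_mono)
  have l: "0 \<le> l" "l \<le> 1" "l * N = m" using m N by (auto simp: l_def N_def)
  have D: "(\<Sum>k\<in>{1..n} - {i}. adj A i k + p) = d A + M" for A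
    using i by (simp add: d_def M_def sum.distrib)
  have d0: "0 \<le> d A" for A by (simp add: d_def sum_nonneg adj_bounds)
  have "(d A + M) ^ m \<le> N ^ m * (exp (l * M) * exp (l * d A))" for A
  proof -
    have "(d A + M) / N \<le> exp ((d A + M) / N)"
      using exp_ge_add_one_self[of "(d A + M) / N"] by linarith
    then have "((d A + M) / N) ^ m \<le> exp ((d A + M) / N) ^ m"
      using d0[of A] M N by (intro power_mono) auto
    also have "\<dots> = exp (l * (d A + M))" by (simp add: l_def exp_of_nat_mult[symmetric])
    also have "\<dots> = exp (l * M) * exp (l * d A)" by (simp add: exp_add[symmetric] algebra_simps)
    finally show ?thesis using N by (simp add: power_divide field_simps)
  qed
  then have "(\<integral>A. (d A + M) ^ m \<partial>?G) \<le> (\<integral>A. N ^ m * (exp (l * M) * exp (l * d A)) \<partial>?G)"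
    by (intro expectation_graph_law_mono) auto
  also have "\<dots> = N ^ m * exp (l * M) * (\<integral>A. exp (l * d A) \<partial>?G)" by simp
  also have "\<dots> \<le> N ^ m * exp (l * M) * exp (M * (exp l - 1))"
    using degree_mgf_le[of p i n l] p i N by (intro mult_left_mono) (auto simp: d_def M_def)
  also have "\<dots> = N ^ m * exp (M * (exp l - 1 + l))" by (simp add: exp_add[symmetric] algebra_simps)
  also have "\<dots> \<le> N ^ m * exp (3 * m)"
  proof -
    have "l\<^sup>2 \<le> l" using l by (simp add: power2_eq_square mult_left_le_one_le)
    then have "exp l - 1 + l \<le> 3 * l" using exp_le_quadratic[of l] l by simp
    moreover have "0 \<le> exp l - 1 + l" using l exp_ge_add_one_self[of l] by linarith
    ultimately have "M * (exp l - 1 + l) \<le> N * (3 * l)"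
      using M N by (intro mult_mono) auto
    also have "\<dots> = 3 * m" using l(3) by (simp add: mult.commute)
    finally show ?thesis using N by simp
  qed
  also have "\<dots> = (exp 3 * N) ^ m" using exp_of_nat2_mult[of "3 :: real" m] by (simp add: power_mult_distrib)
  finally show ?thesis unfolding D N_def .
qed

text \<open>All that is used of the graph: its adjacency matrix is close to \<open>p (J - I)\<close>, with \<open>J\<close> the all-ones matrix,
  in operator norm and in every row sum.\<close>

definition near_regular :: "nat \<Rightarrow> real \<Rightarrow> real \<Rightarrow> (nat \<times> nat \<Rightarrow> bool) \<Rightarrow> bool" where
  "near_regular n p \<theta> A \<longleftrightarrow>
     (\<forall>f g :: nat \<Rightarrow> real. \<bar>\<Sum>i=1..n. \<Sum>j=1..n. adj_dev p A i j * f i * g j\<bar>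
        \<le> \<theta> * sqrt (\<Sum>i=1..n. (f i)\<^sup>2) * sqrt (\<Sum>i=1..n. (g i)\<^sup>2)) \<and>
     (\<forall>i\<in>{1..n}. \<bar>\<Sum>j=1..n. adj_dev p A i j\<bar> \<le> \<theta>)"

text \<open>Markov's inequality for the trace moment of order \<open>2 m\<close> with \<open>m = \<lceil>ln n\<rceil>\<close>. The moment is at most
  \<open>n (16 e\<^sup>3 m n p)\<^sup>m\<close>, while \<open>\<theta>\<^sup>2 \<ge> 16 e\<^sup>7 m n p\<close> because \<open>m \<le> 2 ln n\<close>. The constant in \<open>\<theta>\<close> thus leaves
  \<open>n exp (- 4 m) \<le> n\<^bsup>-3\<^esup>\<close>. The row sums are deviations of degrees and are covered by \<open>degree_deviation\<close>.\<close>

lemma near_regular_probability: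
  fixes n :: nat and p :: real
  assumes p: "0 < p" "p \<le> 1" and n: "3 \<le> n" and dense: "32 * exp 7 * ln n \<le> n * p"
  defines "\<theta> \<equiv> sqrt (32 * exp 7 * ln n * (n * p))"
  shows "measure (graph_law (index_pairs n) p)
      {A \<in> space (graph_law (index_pairs n) p). \<not> near_regular n p \<theta> A} \<le> 3 / real n ^ 3"
proof -
  let ?G = "graph_law (index_pairs n) p"
  interpret prob_space ?G by (rule prob_space_graph_law)
  define N where "N = n * p"
  define m where "m = nat \<lceil>ln (real n)\<rceil>"
  define tr where "tr A = (\<Sum>i=1..n. mpow {1..n} (adj_dev p A) (2 * m) i i)" for A
  have "exp 1 \<le> real n" using n exp_le by linarith
  then have ln1: "1 \<le> ln (real n)" using n by (simp add: ln_ge_iff)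
  have m: "ln n \<le> m" "m \<le> 2 * ln n" "1 \<le> m"
    using ln1 unfolding m_def by linarith+
  have N: "0 < N" using p n by (simp add: N_def)
  have e7: "1 \<le> exp (7 :: real)" by simp
  have big: "32 * ln n \<le> N"
  proof -
    have "32 * ln n \<le> 32 * exp 7 * ln n" using ln1 e7 by (intro mult_right_mono) auto
    then show ?thesis using dense by (simp add: N_def)
  qed
  have th2: "\<theta>\<^sup>2 = 32 * exp 7 * ln n * N" using ln1 N by (simp add: \<theta>_def N_def)
  have th: "0 < \<theta>" using ln1 N by (simp add: \<theta>_def N_def)
  have th_le: "\<theta> \<le> 2 * N"
  proof -
    have "\<theta>\<^sup>2 \<le> N * N" unfolding th2 using dense N by (intro mult_right_mono) (auto simp: N_def)
    also have "\<dots> \<le> (2 * N)\<^sup>2" using N by (simp add: power2_eq_square)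
    finally show ?thesis using N by (intro power2_le_imp_le[of \<theta> "2 * N"]) auto
  qed
  have tr_nn: "0 \<le> tr A" for A
    unfolding tr_def by (intro sum_nonneg) (subst mpow_double, auto simp: adj_dev_sym intro: sum_nonneg)
  obtain K where K: "m = Suc K" using m(3) by (cases m) auto
  have nexp: "exp (- (real c * m)) \<le> 1 / real n ^ c" for c
  proof -
    have "exp (- (real c * m)) \<le> exp (- (real c * ln n))" using m(1) by (simp add: mult_left_mono)
    also have "\<dots> = 1 / real n ^ c" using n by (simp add: exp_minus exp_of_nat_mult inverse_eq_divide)
    finally show ?thesis .
  qed
  have "expectation tr \<le> (\<Sum>i=1..n. \<integral>A. (16 * m * (\<Sum>k\<in>{1..n} - {i}. adj A i k + p)) ^ m \<partial>?G)"
    using trace_moment_bound[OF p, of n K] n by (simp add: tr_def[abs_def] K del: mpow.simps power_Suc of_nat_Suc)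
  also have "\<dots> = (\<Sum>i=1..n. (16 * m) ^ m * (\<integral>A. (\<Sum>k\<in>{1..n} - {i}. adj A i k + p) ^ m \<partial>?G))"
    by (simp add: power_mult_distrib)
  also have "\<dots> \<le> (\<Sum>i=1..n. (16 * m) ^ m * (exp 3 * N) ^ m)"
    unfolding N_def using p m big ln1 by (intro sum_mono mult_left_mono degree_moment_le) (auto simp: N_def)
  also have "\<dots> = n * (16 * m * exp 3 * N) ^ m" by (simp add: power_mult_distrib mult_ac)
  finally have Etr: "expectation tr \<le> n * (16 * m * exp 3 * N) ^ m" .
  have "prob {A \<in> space ?G. (\<theta>\<^sup>2) ^ m \<le> tr A} \<le> expectation tr / (\<theta>\<^sup>2) ^ m"
    using tr_nn th by (intro integral_Markov_inequality_measure[where A = "{}"] integrable_graph_law) auto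
  also have "\<dots> \<le> n * (16 * m * exp 3 * N) ^ m / (16 * m * exp 7 * N) ^ m"
  proof (intro frac_le Etr power_mono)
    have "m * (16 * exp 7 * N) \<le> (2 * ln n) * (16 * exp 7 * N)" using m N by (intro mult_right_mono) auto
    then show "16 * m * exp 7 * N \<le> \<theta>\<^sup>2" unfolding th2 by (simp add: mult_ac)
  qed (use m N in auto)
  also have "\<dots> = n * exp (- (real 4 * m))"
  proof -
    have "exp (7 :: real) = exp 4 * exp 3" by (simp add: exp_add[symmetric])
    then have "(16 * m * exp 3 * N) / (16 * m * exp 7 * N) = exp (- 4)"
      using m N by (simp add: exp_minus field_simps)
    then have "(16 * m * exp 3 * N) ^ m / (16 * m * exp 7 * N) ^ m = exp (- 4) ^ m"
      by (simp add: power_divide[symmetric])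
    then show ?thesis by (simp only: times_divide_eq_right[symmetric]) (simp add: exp_of_nat2_mult[symmetric])
  qed
  also have "\<dots> \<le> n * (1 / real n ^ 4)" by (intro mult_left_mono nexp) auto
  also have "\<dots> = 1 / real n ^ 3" using n by (simp add: field_simps eval_nat_numeral)
  finally have P1: "prob {A \<in> space ?G. (\<theta>\<^sup>2) ^ m \<le> tr A} \<le> 1 / real n ^ 3" .
  have P2: "prob (\<Union>i\<in>{1..n}. {A \<in> space ?G. \<theta> < \<bar>\<Sum>k=1..n. adj_dev p A i k\<bar>}) \<le> 2 / real n ^ 3"
  proof -
    have "prob (\<Union>i\<in>{1..n}. {A \<in> space ?G. \<theta> < \<bar>\<Sum>k=1..n. adj_dev p A i k\<bar>})
        \<le> (\<Sum>i=1..n. prob {A \<in> space ?G. \<theta> < \<bar>\<Sum>k=1..n. adj_dev p A i k\<bar>})"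
      by (intro measure_UNION_le) (auto simp: sets_graph_law space_graph_law)
    also have "\<dots> \<le> (\<Sum>i=1..n. 2 * (1 / real n ^ 4))"
    proof (intro sum_mono order_trans[OF degree_deviation[OF p _ th th_le[unfolded N_def]]] mult_left_mono)
      have "4 * ln n \<le> 8 * exp 7 * ln n" using ln1 e7 by (intro mult_right_mono) linarith+
      then have "real 4 * ln n \<le> \<theta>\<^sup>2 / (4 * (n * p))"
        unfolding th2 N_def[symmetric] using N by simp
      then have "exp (- \<theta>\<^sup>2 / (4 * (n * p))) \<le> exp (- (real 4 * ln n))" by simp
      also have "\<dots> = 1 / real n ^ 4" using n exp_of_nat_mult[of 4 "ln n"] by (simp add: exp_minus inverse_eq_divide)
      finally show "exp (- \<theta>\<^sup>2 / (4 * (n * p))) \<le> 1 / real n ^ 4" .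
    qed auto
    also have "\<dots> = 2 / real n ^ 3" using n by (simp add: field_simps eval_nat_numeral)
    finally show ?thesis .
  qed
  let ?T = "{A \<in> space ?G. (\<theta>\<^sup>2) ^ m \<le> tr A}"
  let ?U = "\<Union>i\<in>{1..n}. {A \<in> space ?G. \<theta> < \<bar>\<Sum>k=1..n. adj_dev p A i k\<bar>}"
  let ?B = "{A \<in> space ?G. \<not> near_regular n p \<theta> A}"
  have "?B \<subseteq> ?T \<union>
     ?U"
  proof (rule subsetI)
    fix A assume A: "A \<in> ?B"
    show "A \<in> ?T \<union>
       ?U"
    proof (cases "(\<theta>\<^sup>2) ^ m \<le> tr A")
      case False
      then have "\<bar>\<Sum>i=1..n. \<Sum>j=1..n. adj_dev p A i j * f i * g j\<bar>
          \<le> \<theta> * sqrt (\<Sum>i=1..n. (f i)\<^sup>2) * sqrt (\<Sum>i=1..n. (g i)\<^sup>2)" for f g :: "nat \<Rightarrow> real"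
        using m(3) th by (intro symmetric_norm_le_trace[where m = m] adj_dev_sym) (auto simp: tr_def)
      then have "\<not> (\<forall>i\<in>{1..n}. \<bar>\<Sum>j=1..n. adj_dev p A i j\<bar> \<le> \<theta>)"
        using A unfolding near_regular_def by blast
      then show ?thesis using A by (auto simp: not_le)
    qed (use A in auto)
  qed
  then have "prob ?B \<le> prob (?T \<union>
     ?U)"
    by (intro finite_measure_mono) (auto simp: sets_graph_law space_graph_law)
  also have "\<dots> \<le> prob ?T +
     prob ?U"
    by (intro measure_Un_le) (auto simp: sets_graph_law space_graph_law)
  also have "\<dots> \<le> 1 / real n ^ 3 + 2 / real n ^ 3" using P1 P2 by (rule add_mono)
  finally show ?thesis by (simp add: add_divide_distrib[symmetric])
qed

section \<open>Gaussian linear and quadratic forms\<close>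

abbreviation gaussian :: "real \<Rightarrow> real measure" where
  "gaussian s \<equiv> density lborel (normal_density 0 s)"

lemma nn_integral_normal_density: "0 < s \<Longrightarrow> (\<integral>\<^sup>+x. ennreal (normal_density \<mu> s x) \<partial>lborel) = 1"
  by (simp add: nn_integral_eq_integral)

lemma gaussian_mgf:
  assumes s: "0 < s"
  shows "(\<integral>\<^sup>+x. ennreal (exp (t * x)) \<partial>gaussian s) = ennreal (exp (s\<^sup>2 * t\<^sup>2 / 2))"
proof -
  have "normal_density 0 s x * exp (t * x) = exp (s\<^sup>2 * t\<^sup>2 / 2) * normal_density (s\<^sup>2 * t) s x" for x
  proof -
    have "- x\<^sup>2 / (2 * s\<^sup>2) + t * x = s\<^sup>2 * t\<^sup>2 / 2 + - (x - s\<^sup>2 * t)\<^sup>2 / (2 * s\<^sup>2)"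
      using s by (simp add: field_simps power2_eq_square)
    then have "exp (- x\<^sup>2 / (2 * s\<^sup>2)) * exp (t * x) = exp (s\<^sup>2 * t\<^sup>2 / 2) * exp (- (x - s\<^sup>2 * t)\<^sup>2 / (2 * s\<^sup>2))"
      by (simp only: exp_add[symmetric])
    then show ?thesis by (simp add: normal_density_def)
  qed
  then have "(\<integral>\<^sup>+x. ennreal (exp (t * x)) \<partial>gaussian s) =
      (\<integral>\<^sup>+x. ennreal (exp (s\<^sup>2 * t\<^sup>2 / 2)) * ennreal (normal_density (s\<^sup>2 * t) s x) \<partial>lborel)"
    by (simp add: nn_integral_density ennreal_mult'[symmetric])
  also have "\<dots> = ennreal (exp (s\<^sup>2 * t\<^sup>2 / 2))"
    using s by (subst nn_integral_cmult) (auto simp: nn_integral_normal_density)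
  finally show ?thesis .
qed

lemma gaussian_square_mgf:
  assumes k: "k < 1 / 2"
  shows "(\<integral>\<^sup>+x. ennreal (exp (k * x\<^sup>2)) \<partial>gaussian 1) = ennreal (1 / sqrt (1 - 2 * k))"
proof -
  define s where "s = 1 / sqrt (1 - 2 * k)"
  have s: "0 < s" "s\<^sup>2 = 1 / (1 - 2 * k)" using k by (auto simp: s_def power_divide)
  have "normal_density 0 1 x * exp (k * x\<^sup>2) = s * normal_density 0 s x" for x
  proof -
    have "exp (- x\<^sup>2 / 2) * exp (k * x\<^sup>2) = exp (- x\<^sup>2 / (2 * s\<^sup>2))"
      using k by (simp add: exp_add[symmetric] s(2) field_simps)
    then show ?thesis using s(1) by (simp add: normal_density_def real_sqrt_mult field_simps)
  qed
  then have "(\<integral>\<^sup>+x. ennreal (exp (k * x\<^sup>2)) \<partial>gaussian 1) =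
      (\<integral>\<^sup>+x. ennreal s * ennreal (normal_density 0 s x) \<partial>lborel)"
    using s(1) by (simp add: nn_integral_density ennreal_mult'[symmetric])
  also have "\<dots> = ennreal s"
    using s(1) by (subst nn_integral_cmult) (auto simp: nn_integral_normal_density)
  finally show ?thesis by (simp add: s_def)
qed

lemma measurable_Complex [measurable]:
  "(\<lambda>(x, y). Complex x y) \<in> borel_measurable (borel \<Otimes>\<^sub>M borel)"
  by (simp add: borel_measurable_complex_iff case_prod_unfold)

lemma sets_std_complex_gaussian [simp, measurable_cong]: "sets std_complex_gaussian = sets borel"
  by (simp add: std_complex_gaussian_def)

lemma space_std_complex_gaussian [simp]: "space std_complex_gaussian = UNIV"
  by (simp add: std_complex_gaussian_def)

lemma prob_space_gaussian: "0 < s \<Longrightarrow> prob_space (gaussian s)"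
  by (rule prob_space_normal_density)

lemma measurable_Complex_gaussian:
  "(\<lambda>(x, y). Complex x y) \<in> measurable (gaussian s \<Otimes>\<^sub>M gaussian s) borel"
proof -
  have "sets (gaussian s \<Otimes>\<^sub>M gaussian s) = sets (borel \<Otimes>\<^sub>M borel)" by (intro sets_pair_measure_cong) auto
  then show ?thesis using measurable_Complex measurable_cong_sets by blast
qed

lemma prob_space_std_complex_gaussian: "prob_space std_complex_gaussian"
proof -
  interpret g: prob_space "gaussian (sqrt (1/2))" by (rule prob_space_gaussian) simp
  interpret pair_prob_space "gaussian (sqrt (1/2))" "gaussian (sqrt (1/2))" ..
  show ?thesis unfolding std_complex_gaussian_def
    by (rule prob_space_distr) (rule measurable_Complex_gaussian)
qed

lemma std_complex_gaussian_mgf: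
  "(\<integral>\<^sup>+z. ennreal (exp (Re (w * z))) \<partial>std_complex_gaussian) = ennreal (exp ((cmod w)\<^sup>2 / 4))"
proof -
  let ?g = "gaussian (sqrt (1/2))"
  interpret g: prob_space ?g by (rule prob_space_gaussian) simp
  have [measurable]: "(\<lambda>(x, y). exp (Re w * x + - Im w * y)) \<in> borel_measurable (?g \<Otimes>\<^sub>M ?g)"
  proof -
    have "sets (?g \<Otimes>\<^sub>M ?g) = sets (borel \<Otimes>\<^sub>M borel)" by (intro sets_pair_measure_cong) auto
    then show ?thesis by (subst measurable_cong_sets[OF _ refl]) (auto simp: case_prod_unfold)
  qed
  have "(\<integral>\<^sup>+z. ennreal (exp (Re (w * z))) \<partial>std_complex_gaussian) =
      (\<integral>\<^sup>+(x, y). ennreal (exp (Re w * x + - Im w * y)) \<partial>(?g \<Otimes>\<^sub>M ?g))"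
    unfolding std_complex_gaussian_def
    by (subst nn_integral_distr[OF measurable_Complex_gaussian]) (auto simp: case_prod_unfold)
  also have "\<dots> = (\<integral>\<^sup>+x. \<integral>\<^sup>+y. ennreal (exp (Re w * x + - Im w * y)) \<partial>?g \<partial>?g)"
    by (subst g.nn_integral_fst[symmetric]) (auto simp: case_prod_unfold)
  also have "\<dots> = (\<integral>\<^sup>+x. ennreal (exp (Re w * x)) * (\<integral>\<^sup>+y. ennreal (exp (- Im w * y)) \<partial>?g) \<partial>?g)"
    by (subst nn_integral_cmult[symmetric]) (simp_all only: exp_add ennreal_mult' exp_ge_zero, auto)
  also have "\<dots> = ennreal (exp ((Re w)\<^sup>2 / 4)) * ennreal (exp ((Im w)\<^sup>2 / 4))"
    using gaussian_mgf[of "sqrt (1/2)" "Re w"] gaussian_mgf[of "sqrt (1/2)" "- Im w"]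
    by (simp add: nn_integral_multc)
  also have "\<dots> = ennreal (exp ((cmod w)\<^sup>2 / 4))"
    by (simp add: ennreal_mult'[symmetric] exp_add[symmetric] cmod_power2 add_divide_distrib)
  finally show ?thesis .
qed

abbreviation noise_law :: "'e set \<Rightarrow> ('e \<Rightarrow> complex) measure" where
  "noise_law I \<equiv> (\<Pi>\<^sub>M e\<in>I. std_complex_gaussian)"

text \<open>These real linear forms are centred Gaussian variables of variance \<open>\<Sum>\<^sub>e |w\<^sub>e|\<^sup>2 / 2\<close>. All functionals of the noise that
  are estimated below are built from them.\<close>

definition lin_form :: "'e set \<Rightarrow> ('e \<Rightarrow> complex) \<Rightarrow> ('e \<Rightarrow> complex) \<Rightarrow> real" where
  "lin_form I w W = (\<Sum>e\<in>I. Re (w e * W e))"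

lemma prob_space_noise_law: "prob_space (noise_law I)"
  by (intro prob_space_PiM prob_space_std_complex_gaussian)

lemma borel_measurable_lin_form [measurable]: "lin_form I w \<in> borel_measurable (noise_law I)"
  unfolding lin_form_def[abs_def] by measurable

lemma lin_form_cmult: "lin_form I (\<lambda>e. of_real r * w e) W = r * lin_form I w W"
  by (simp add: lin_form_def sum_distrib_left mult.assoc algebra_simps)

lemma lin_form_sum: "lin_form I (\<lambda>e. \<Sum>j\<in>S. w j e) W = (\<Sum>j\<in>S. lin_form I (w j) W)"
  unfolding lin_form_def by (simp add: sum_distrib_right) (rule sum.swap)

lemma lin_form_mgf:
  assumes "finite I"
  shows "(\<integral>\<^sup>+W. ennreal (exp (lin_form I w W)) \<partial>noise_law I) = ennreal (exp ((\<Sum>e\<in>I. (cmod (w e))\<^sup>2) / 4))"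
proof -
  interpret prob_space "std_complex_gaussian" by (rule prob_space_std_complex_gaussian)
  interpret product_sigma_finite "\<lambda>e :: 'a. std_complex_gaussian" ..
  have "(\<integral>\<^sup>+W. ennreal (exp (lin_form I w W)) \<partial>noise_law I) =
      (\<integral>\<^sup>+W. (\<Prod>e\<in>I. ennreal (exp (Re (w e * W e)))) \<partial>noise_law I)"
    using assms by (simp add: lin_form_def exp_sum prod_ennreal)
  also have "\<dots> = (\<Prod>e\<in>I. ennreal (exp ((cmod (w e))\<^sup>2 / 4)))"
    using assms by (subst product_nn_integral_prod) (auto simp only: std_complex_gaussian_mgf, measurable)
  finally show ?thesis using assms by (simp add: prod_ennreal exp_sum sum_divide_distrib)
qed

lemma (in prob_space) Markov_nn_integral:
  assumes [measurable]: "f \<in> borel_measurable M" and le: "(\<integral>\<^sup>+x. ennreal (f x) \<partial>M) \<le> ennreal B"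
    and t: "0 < t" and B: "0 \<le> B"
  shows "prob {x \<in> space M. t \<le> f x} \<le> B / t"
proof -
  have "emeasure M {x \<in> space M. 1 \<le> ennreal (1 / t) * ennreal (f x)} \<le>
      ennreal (1 / t) * (\<integral>\<^sup>+x. ennreal (f x) * indicator (space M) x \<partial>M)"
    by (intro nn_integral_Markov_inequality) auto
  also have "(\<integral>\<^sup>+x. ennreal (f x) * indicator (space M) x \<partial>M) = (\<integral>\<^sup>+x. ennreal (f x) \<partial>M)"
    by (intro nn_integral_cong) simp
  also have "ennreal (1 / t) * (\<integral>\<^sup>+x. ennreal (f x) \<partial>M) \<le> ennreal (1 / t) * ennreal B"
    using le by (rule mult_left_mono) simp
  also have "\<dots> = ennreal (B / t)" using t by (simp add: ennreal_mult'[symmetric])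
  finally have *: "emeasure M {x \<in> space M. 1 \<le> ennreal (1 / t) * ennreal (f x)} \<le> ennreal (B / t)" .
  have "{x \<in> space M. t \<le> f x} \<subseteq> {x \<in> space M. 1 \<le> ennreal (1 / t) * ennreal (f x)}"
    using t by (auto simp: ennreal_mult'[symmetric] ennreal_1[symmetric] simp del: ennreal_1)
  then have "emeasure M {x \<in> space M. t \<le> f x} \<le> emeasure M {x \<in> space M. 1 \<le> ennreal (1 / t) * ennreal (f x)}"
    by (intro emeasure_mono) auto
  with * have "emeasure M {x \<in> space M. t \<le> f x} \<le> ennreal (B / t)" by (rule order_trans[rotated])
  then show ?thesis using t B by (simp add: emeasure_eq_measure)
qed

lemma lin_form_tail:
  assumes I: "finite I" and v: "(\<Sum>e\<in>I. (cmod (w e))\<^sup>2) \<le> v" "0 < v" and t: "0 < t"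
  shows "measure (noise_law I) {W \<in> space (noise_law I). t < lin_form I w W} \<le> exp (- t\<^sup>2 / v)"
proof -
  interpret prob_space "noise_law I" by (rule prob_space_noise_law)
  define l where "l = 2 * t / v"
  have l: "0 < l" using v t by (simp add: l_def)
  have "prob {W \<in> space (noise_law I). t < lin_form I w W} \<le>
      prob {W \<in> space (noise_law I). exp (l * t) \<le> exp (lin_form I (\<lambda>e. of_real l * w e) W)}"
    using l by (intro finite_measure_mono) (auto simp: lin_form_cmult)
  also have "\<dots> \<le> exp (l\<^sup>2 * v / 4) / exp (l * t)"
  proof (rule Markov_nn_integral)
    have "(\<Sum>e\<in>I. (cmod (of_real l * w e))\<^sup>2) = l\<^sup>2 * (\<Sum>e\<in>I. (cmod (w e))\<^sup>2)"
      by (simp add: norm_mult power_mult_distrib sum_distrib_left)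
    also have "\<dots> \<le> l\<^sup>2 * v" using v by (intro mult_left_mono) auto
    finally show "(\<integral>\<^sup>+W. ennreal (exp (lin_form I (\<lambda>e. of_real l * w e) W)) \<partial>noise_law I) \<le> ennreal (exp (l\<^sup>2 * v / 4))"
      unfolding lin_form_mgf[OF I] by (intro ennreal_leI) simp
  qed auto
  also have "\<dots> = exp (l\<^sup>2 * v / 4 - l * t)" by (simp add: exp_diff)
  also have "l\<^sup>2 * v / 4 - l * t = - t\<^sup>2 / v" using v by (simp add: l_def power2_eq_square field_simps)
  finally show ?thesis .
qed

text \<open>The square in the exponent is linearized by an independent standard Gaussian vector \<open>t\<close>, since
  \<open>exp (l a\<^sup>2) = E exp (sqrt (2 l) t a)\<close>. Exchanging the integrals and integrating over the noise first leaves
  the exponential of a quadratic form in \<open>t\<close>. The hypothesis bounds it by a multiple of \<open>|t|\<^sup>2\<close>, and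
  the remaining integral factors. Only the largest eigenvalue of the form enters; where it is close to the
  average of the eigenvalues nothing is lost in the leading constant.\<close>

lemma quadratic_form_mgf:
  fixes b :: "'v \<Rightarrow> 'e \<Rightarrow> complex" and K :: real
  assumes I: "finite I" and V: "finite V"
    and K: "\<And>t :: 'v \<Rightarrow> real. (\<Sum>e\<in>I. (cmod (\<Sum>j\<in>V. of_real (t j) * b j e))\<^sup>2) \<le> K * (\<Sum>j\<in>V. (t j)\<^sup>2)"
    and l: "0 \<le> l" "l * K < 1"
  shows "(\<integral>\<^sup>+W. ennreal (exp (l * (\<Sum>j\<in>V. (lin_form I (b j) W)\<^sup>2))) \<partial>noise_law I)
    \<le> ennreal ((1 / sqrt (1 - l * K)) ^ card V)"
proof -
  interpret g: prob_space "gaussian 1" by (rule prob_space_gaussian) simp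
  interpret T: product_sigma_finite "\<lambda>j :: 'v. gaussian 1" ..
  let ?T = "\<Pi>\<^sub>M j\<in>V. gaussian 1" and ?N = "noise_law I"
  interpret PT: prob_space ?T by (intro prob_space_PiM g.prob_space_axioms)
  interpret PN: prob_space ?N by (rule prob_space_noise_law)
  interpret pair_sigma_finite ?N ?T ..
  define r where "r = sqrt (2 * l)"
  have r2: "r\<^sup>2 = 2 * l" using l by (simp add: r_def)
  have lin: "r * (\<Sum>j\<in>V. t j * lin_form I (b j) W) = lin_form I (\<lambda>e. of_real r * (\<Sum>j\<in>V. of_real (t j) * b j e)) W" for t W
    by (simp add: lin_form_cmult lin_form_sum)
  have 1: "ennreal (exp (l * (\<Sum>j\<in>V. (lin_form I (b j) W)\<^sup>2))) =
      (\<integral>\<^sup>+t. ennreal (exp (r * (\<Sum>j\<in>V. t j * lin_form I (b j) W))) \<partial>?T)" for W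
  proof -
    have "(\<integral>\<^sup>+t. ennreal (exp (r * (\<Sum>j\<in>V. t j * lin_form I (b j) W))) \<partial>?T) =
        (\<integral>\<^sup>+t. (\<Prod>j\<in>V. ennreal (exp ((r * lin_form I (b j) W) * t j))) \<partial>?T)"
      using V by (simp add: sum_distrib_left exp_sum prod_ennreal mult_ac)
    also have "\<dots> = (\<Prod>j\<in>V. ennreal (exp (1\<^sup>2 * (r * lin_form I (b j) W)\<^sup>2 / 2)))"
      using V by (subst T.product_nn_integral_prod) (simp_all add: gaussian_mgf)
    also have "\<dots> = ennreal (exp (l * (\<Sum>j\<in>V. (lin_form I (b j) W)\<^sup>2)))"
      using V by (simp add: prod_ennreal exp_sum sum_distrib_left power_mult_distrib r2)
    finally show ?thesis by simp
  qed
  have [measurable]: "case_prod (\<lambda>W t. ennreal (exp (r * (\<Sum>j\<in>V. t j * lin_form I (b j) W)))) \<in> borel_measurable (?N \<Otimes>\<^sub>M ?T)"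
    unfolding lin_form_def by measurable
  have "(\<integral>\<^sup>+W. ennreal (exp (l * (\<Sum>j\<in>V. (lin_form I (b j) W)\<^sup>2))) \<partial>?N) =
      (\<integral>\<^sup>+t. \<integral>\<^sup>+W. ennreal (exp (r * (\<Sum>j\<in>V. t j * lin_form I (b j) W))) \<partial>?N \<partial>?T)"
    unfolding 1 by (rule Fubini'[symmetric]) measurable
  also have "\<dots> \<le> (\<integral>\<^sup>+t. (\<Prod>j\<in>V. ennreal (exp ((l * K / 2) * (t j)\<^sup>2))) \<partial>?T)"
  proof (rule nn_integral_mono)
    fix t :: "'v \<Rightarrow> real"
    have "(\<Sum>e\<in>I. (cmod (of_real r * (\<Sum>j\<in>V. of_real (t j) * b j e)))\<^sup>2) = 2 * l * (\<Sum>e\<in>I. (cmod (\<Sum>j\<in>V. of_real (t j) * b j e))\<^sup>2)"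
      by (simp only: norm_mult power_mult_distrib norm_of_real power2_abs r2 sum_distrib_left[symmetric])
    also have "\<dots> \<le> 2 * l * (K * (\<Sum>j\<in>V. (t j)\<^sup>2))" using l by (intro mult_left_mono K) auto
    also have "\<dots> = 4 * (\<Sum>j\<in>V. (l * K / 2) * (t j)\<^sup>2)"
      unfolding sum_distrib_left[symmetric] by simp
    finally have "(\<Sum>e\<in>I. (cmod (of_real r * (\<Sum>j\<in>V. of_real (t j) * b j e)))\<^sup>2) / 4 \<le> (\<Sum>j\<in>V. (l * K / 2) * (t j)\<^sup>2)"
      by linarith
    then show "(\<integral>\<^sup>+W. ennreal (exp (r * (\<Sum>j\<in>V. t j * lin_form I (b j) W))) \<partial>?N) \<le> (\<Prod>j\<in>V. ennreal (exp ((l * K / 2) * (t j)\<^sup>2)))"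
      unfolding lin lin_form_mgf[OF I] using V by (simp add: prod_ennreal exp_sum[symmetric])
  qed
  also have "\<dots> = (\<Prod>j\<in>V. ennreal (1 / sqrt (1 - l * K)))"
    using V l gaussian_square_mgf[of "l * K / 2"] by (subst T.product_nn_integral_prod) auto
  also have "\<dots> = ennreal ((1 / sqrt (1 - l * K)) ^ card V)"
    using l by (simp add: ennreal_power)
  finally show ?thesis .
qed

lemma quadratic_form_tail:
  fixes b :: "'v \<Rightarrow> 'e \<Rightarrow> complex" and K :: real
  assumes I: "finite I" and V: "finite V" and Kpos: "0 < K"
    and K: "\<And>t :: 'v \<Rightarrow> real. (\<Sum>e\<in>I. (cmod (\<Sum>j\<in>V. of_real (t j) * b j e))\<^sup>2) \<le> K * (\<Sum>j\<in>V. (t j)\<^sup>2)"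
    and \<epsilon>: "0 < \<epsilon>" "\<epsilon> \<le> 1"
  shows "measure (noise_law I) {W \<in> space (noise_law I).
      (1 + \<epsilon>) * (card V * K / 2) < (\<Sum>j\<in>V. (lin_form I (b j) W)\<^sup>2)} \<le> exp (- real (card V) * \<epsilon>\<^sup>2 / 16)"
proof -
  let ?N = "noise_law I" and ?n = "card V"
  interpret prob_space ?N by (rule prob_space_noise_law)
  define Q where "Q W = (\<Sum>j\<in>V. (lin_form I (b j) W)\<^sup>2)" for W
  \<comment> \<open>The minimizer of the exponent \<open>a + 2 a\<^sup>2 - (1 + \<epsilon>) a\<close> below.\<close>
  define a where "a = \<epsilon> / 4"
  define l where "l = a / K"
  have a: "0 < a" "a \<le> 1 / 2" and l: "0 < l" "l * K = a" using \<epsilon> Kpos by (auto simp: a_def l_def)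
  have [measurable]: "Q \<in> borel_measurable ?N" unfolding Q_def[abs_def] by measurable
  define q where "q = (1 + \<epsilon>) * (?n * K / 2)"
  have "prob {W \<in> space ?N. q < Q W} \<le> prob {W \<in> space ?N. exp (l * q) \<le> exp (l * Q W)}"
    using l by (intro finite_measure_mono) auto
  also have "\<dots> \<le> (1 / sqrt (1 - a)) ^ ?n / exp (l * q)"
    using quadratic_form_mgf[OF I V K, of l] l a by (intro Markov_nn_integral) (auto simp: Q_def)
  also have "\<dots> \<le> exp ((a + 2 * a\<^sup>2) / 2) ^ ?n / exp (l * q)"
  proof (intro divide_right_mono power_mono)
    define y where "y = (a + 2 * a\<^sup>2) / 2"
    have "exp (- y) ^ 2 = exp (- a - 2 * a\<^sup>2)"
      by (simp add: y_def power2_eq_square exp_add[symmetric])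
    also have "\<dots> \<le> exp (ln (1 - a))"
      unfolding exp_le_cancel_iff using ln_one_minus_pos_lower_bound[of a] a by simp
    also have "\<dots> = 1 - a" using a by simp
    finally have "exp (- y) \<le> sqrt (1 - a)" by (rule real_le_rsqrt)
    then have "1 / sqrt (1 - a) \<le> 1 / exp (- y)" using a by (intro divide_left_mono) auto
    also have "\<dots> = exp y" by (simp add: exp_minus inverse_eq_divide)
    finally show "1 / sqrt (1 - a) \<le> exp ((a + 2 * a\<^sup>2) / 2)" by (simp only: y_def)
  qed (use a in auto)
  also have "\<dots> = exp (?n * ((a + 2 * a\<^sup>2) / 2) - l * q)"
    by (simp only: exp_diff exp_of_nat_mult)
  also have "?n * ((a + 2 * a\<^sup>2) / 2) - l * q = - real ?n * \<epsilon>\<^sup>2 / 16"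
  proof -
    have lq: "l * q = (1 + \<epsilon>) * (?n * a / 2)" by (simp add: q_def l(2)[symmetric])
    show ?thesis unfolding lq a_def by (simp add: power2_eq_square field_simps)
  qed
  finally show ?thesis by (simp add: q_def Q_def)
qed

lemma exp_modulus_le:
  fixes a b :: real
  assumes "0 \<le> l"
  shows "exp (2 * l * sqrt (a\<^sup>2 + b\<^sup>2)) \<le>
    (exp (4 * l * a) + exp (- 4 * l * a) + exp (4 * l * b) + exp (- 4 * l * b)) / 2"
proof -
  have amgm: "exp (x + y) \<le> (exp (2 * x) + exp (2 * y)) / 2" for x y :: real
  proof -
    have "0 \<le> (exp x - exp y)\<^sup>2" by simp
    also have "\<dots> = exp (2 * x) + exp (2 * y) - 2 * exp (x + y)"
      by (simp only: exp_add mult_2) (simp add: power2_eq_square algebra_simps)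
    finally show ?thesis by simp
  qed
  have abs: "exp (2 * (2 * l * \<bar>x\<bar>)) \<le> exp (4 * l * x) + exp (- 4 * l * x)" for x :: real
    by (cases "0 \<le> x") (auto simp: mult.assoc)
  have "exp (2 * l * sqrt (a\<^sup>2 + b\<^sup>2)) \<le> exp (2 * l * \<bar>a\<bar> + 2 * l * \<bar>b\<bar>)"
    using assms sqrt_sum_squares_le_sum_abs[of a b]
    by (simp add: distrib_left[symmetric] mult_left_mono)
  also have "\<dots> \<le> (exp (2 * (2 * l * \<bar>a\<bar>)) + exp (2 * (2 * l * \<bar>b\<bar>))) / 2" by (rule amgm)
  also have "\<dots> \<le> (exp (4 * l * a) + exp (- 4 * l * a) + exp (4 * l * b) + exp (- 4 * l * b)) / 2"
    using abs[of a] abs[of b] by simp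
  finally show ?thesis .
qed

lemma lin_form_modulus_mgf:
  assumes I: "finite I" and u: "(\<Sum>e\<in>I. (cmod (u e))\<^sup>2) \<le> d" and v: "(\<Sum>e\<in>I. (cmod (v e))\<^sup>2) \<le> d"
    and l: "0 \<le> l"
  shows "(\<integral>\<^sup>+W. ennreal (exp (2 * l * sqrt ((lin_form I u W)\<^sup>2 + (lin_form I v W)\<^sup>2))) \<partial>noise_law I)
    \<le> ennreal (2 * exp (4 * l\<^sup>2 * d))"
proof -
  let ?N = "noise_law I"
  have mgf: "(\<integral>\<^sup>+W. ennreal (exp (s * lin_form I w W)) \<partial>?N) \<le> ennreal (exp (4 * l\<^sup>2 * d))"
    if "(\<Sum>e\<in>I. (cmod (w e))\<^sup>2) \<le> d" "s = 4 * l \<or> s = - 4 * l" for w s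
  proof -
    have "s\<^sup>2 = 16 * l\<^sup>2" using that(2) by (auto simp: power2_eq_square)
    then have "(\<Sum>e\<in>I. (cmod (of_real s * w e))\<^sup>2) = 16 * l\<^sup>2 * (\<Sum>e\<in>I. (cmod (w e))\<^sup>2)"
      by (simp only: norm_mult power_mult_distrib norm_of_real power2_abs sum_distrib_left[symmetric])
    also have "\<dots> \<le> 16 * l\<^sup>2 * d" using that(1) by (intro mult_left_mono) auto
    finally show ?thesis
      unfolding lin_form_cmult[symmetric] lin_form_mgf[OF I] by (intro ennreal_leI) simp
  qed
  have "(\<integral>\<^sup>+W. ennreal (exp (2 * l * sqrt ((lin_form I u W)\<^sup>2 + (lin_form I v W)\<^sup>2))) \<partial>?N) \<le>
      (\<integral>\<^sup>+W. ennreal (1/2) * (ennreal (exp (4 * l * lin_form I u W)) + ennreal (exp (- 4 * l * lin_form I u W)) +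
        ennreal (exp (4 * l * lin_form I v W)) + ennreal (exp (- 4 * l * lin_form I v W))) \<partial>?N)"
  proof (rule nn_integral_mono)
    fix W
    show "ennreal (exp (2 * l * sqrt ((lin_form I u W)\<^sup>2 + (lin_form I v W)\<^sup>2))) \<le>
      ennreal (1/2) * (ennreal (exp (4 * l * lin_form I u W)) + ennreal (exp (- 4 * l * lin_form I u W)) +
        ennreal (exp (4 * l * lin_form I v W)) + ennreal (exp (- 4 * l * lin_form I v W)))"
      using exp_modulus_le[OF l, of "lin_form I u W" "lin_form I v W"]
      by (simp only: ennreal_plus[symmetric] ennreal_mult[symmetric] exp_ge_zero add_nonneg_nonneg) (intro ennreal_leI, simp)
  qed
  also have "\<dots> = ennreal (1/2) * ((\<integral>\<^sup>+W. ennreal (exp (4 * l * lin_form I u W)) \<partial>?N) +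
      (\<integral>\<^sup>+W. ennreal (exp (- 4 * l * lin_form I u W)) \<partial>?N) +
      (\<integral>\<^sup>+W. ennreal (exp (4 * l * lin_form I v W)) \<partial>?N) +
      (\<integral>\<^sup>+W. ennreal (exp (- 4 * l * lin_form I v W)) \<partial>?N))"
    by (simp add: nn_integral_cmult nn_integral_add)
  also have "\<dots> \<le> ennreal (1/2) * (ennreal (exp (4 * l\<^sup>2 * d)) + ennreal (exp (4 * l\<^sup>2 * d)) +
      ennreal (exp (4 * l\<^sup>2 * d)) + ennreal (exp (4 * l\<^sup>2 * d)))"
    using u v by (intro mult_left_mono add_mono mgf) auto
  also have "\<dots> = ennreal (2 * exp (4 * l\<^sup>2 * d))"
    by (simp only: ennreal_plus[symmetric] ennreal_mult[symmetric] exp_ge_zero add_nonneg_nonneg) (simp add: ennreal_mult[symmetric])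
  finally show ?thesis .
qed

text \<open>Markov's inequality for the truncated sum, with
  \<open>g [T < g] \<le> exp (2 l g - l T) / l\<close>; the choice \<open>l = T / (8 d)\<close> minimizes the resulting exponent \<open>4 l\<^sup>2 d - l T\<close>.\<close>

lemma truncated_modulus_sum_tail:
  fixes u v :: "'v \<Rightarrow> 'e \<Rightarrow> complex"
  assumes I: "finite I" and V: "finite V" and d: "0 < d"
    and u: "\<And>j. j \<in> V \<Longrightarrow> (\<Sum>e\<in>I. (cmod (u j e))\<^sup>2) \<le> d"
    and v: "\<And>j. j \<in> V \<Longrightarrow> (\<Sum>e\<in>I. (cmod (v j e))\<^sup>2) \<le> d"
    and T: "0 < T" and B: "0 < B"
  defines "g \<equiv> \<lambda>j W. sqrt ((lin_form I (u j) W)\<^sup>2 + (lin_form I (v j) W)\<^sup>2)"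
  shows "measure (noise_law I) {W \<in> space (noise_law I). B \<le> (\<Sum>j\<in>V. g j W * of_bool (T < g j W))}
    \<le> card V * (16 * d / T) * exp (- T\<^sup>2 / (16 * d)) / B"
proof -
  let ?N = "noise_law I"
  interpret prob_space ?N by (rule prob_space_noise_law)
  define l where "l = T / (8 * d)"
  have l: "0 < l" using T d by (simp add: l_def)
  have [measurable]: "g j \<in> borel_measurable ?N" for j unfolding g_def by measurable
  have g0: "0 \<le> g j W" for j W by (simp add: g_def)
  have each: "(\<integral>\<^sup>+W. ennreal (g j W * of_bool (T < g j W)) \<partial>?N) \<le> ennreal (16 * d / T * exp (- T\<^sup>2 / (16 * d)))"
    if "j \<in> V" for j
  proof -
    have "(\<integral>\<^sup>+W. ennreal (g j W * of_bool (T < g j W)) \<partial>?N) \<le>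
        (\<integral>\<^sup>+W. ennreal (exp (- (l * T)) / l) * ennreal (exp (2 * l * g j W)) \<partial>?N)"
    proof (rule nn_integral_mono)
      fix W
      have "g j W * of_bool (T < g j W) \<le> exp (- (l * T)) / l * exp (2 * l * g j W)"
      proof (cases "T < g j W")
        case True
        have "l * g j W \<le> exp (l * g j W)" using exp_ge_add_one_self[of "l * g j W"] by linarith
        also have "\<dots> * 1 \<le> exp (l * g j W) * exp (l * g j W - l * T)"
          using True l by (intro mult_left_mono) auto
        finally have "l * g j W \<le> exp (- (l * T)) * exp (2 * l * g j W)"
          by (simp add: exp_add[symmetric] algebra_simps)
        then show ?thesis using True l by (simp add: pos_le_divide_eq mult.commute)
      qed (use l in auto)
      then show "ennreal (g j W * of_bool (T < g j W)) \<le> ennreal (exp (- (l * T)) / l) * ennreal (exp (2 * l * g j W))"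
        using l by (simp add: ennreal_mult[symmetric] ennreal_leI)
    qed
    also have "\<dots> = ennreal (exp (- (l * T)) / l) * (\<integral>\<^sup>+W. ennreal (exp (2 * l * g j W)) \<partial>?N)"
      by (rule nn_integral_cmult) measurable
    also have "\<dots> \<le> ennreal (exp (- (l * T)) / l) * ennreal (2 * exp (4 * l\<^sup>2 * d))"
      unfolding g_def using l that by (intro mult_left_mono lin_form_modulus_mgf I u v) auto
    also have "\<dots> = ennreal (2 / l * exp (4 * l\<^sup>2 * d - l * T))"
      using l by (simp add: ennreal_mult[symmetric] exp_diff exp_minus field_simps)
    also have "4 * l\<^sup>2 * d - l * T = - T\<^sup>2 / (16 * d)"
      using d by (simp add: l_def power2_eq_square field_simps)
    also have "2 / l = 16 * d / T" using d T by (simp add: l_def)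
    finally show ?thesis .
  qed
  have "prob {W \<in> space ?N. B \<le> (\<Sum>j\<in>V. g j W * of_bool (T < g j W))} \<le>
      card V * (16 * d / T * exp (- T\<^sup>2 / (16 * d))) / B"
  proof (rule Markov_nn_integral)
    have "(\<integral>\<^sup>+W. ennreal (\<Sum>j\<in>V. g j W * of_bool (T < g j W)) \<partial>?N) =
        (\<Sum>j\<in>V. \<integral>\<^sup>+W. ennreal (g j W * of_bool (T < g j W)) \<partial>?N)"
      using g0 by (subst nn_integral_sum[symmetric]) (auto intro!: nn_integral_cong)
    also have "\<dots> \<le> (\<Sum>j\<in>V. ennreal (16 * d / T * exp (- T\<^sup>2 / (16 * d))))"
      by (intro sum_mono each)
    also have "\<dots> = ennreal (card V * (16 * d / T * exp (- T\<^sup>2 / (16 * d))))"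
      using d T by (subst sum_ennreal) auto
    finally show "(\<integral>\<^sup>+W. ennreal (\<Sum>j\<in>V. g j W * of_bool (T < g j W)) \<partial>?N) \<le>
        ennreal (card V * (16 * d / T * exp (- T\<^sup>2 / (16 * d))))" .
  qed (use B d T in auto)
  then show ?thesis by (simp add: mult.assoc)
qed

section \<open>A lattice net for bounded vectors\<close>

text \<open>Points of the integer lattice in \<open>2 n\<close> real dimensions, one pair for each complex coordinate. The radius \<open>sqrt (6 n)\<close> is the
  largest that rounding to the lattice can produce in \<open>net_rounding\<close>.\<close>

definition net_codes :: "nat \<Rightarrow> (nat \<Rightarrow> int \<times> int) set" where
  "net_codes n = {f \<in> {1..n} \<rightarrow>\<^sub>E UNIV. (\<Sum>j=1..n. (fst (f j))\<^sup>2 + (snd (f j))\<^sup>2) \<le> 6 * int n}"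

definition decode :: "real \<Rightarrow> (nat \<Rightarrow> int \<times> int) \<Rightarrow> nat \<Rightarrow> complex" where
  "decode h f j = of_real h * Complex (of_int (fst (f j))) (of_int (snd (f j)))"

lemma sum_half_power_le:
  "(\<Sum>k\<in>{- int M..int M}. (1 / 2) ^ nat \<bar>k\<bar>) = (3 :: real) - 2 * (1 / 2) ^ M"
proof (induction M)
  case (Suc M)
  have "{- int (Suc M)..int (Suc M)} = insert (int (Suc M)) (insert (- int (Suc M)) {- int M..int M})"
    by auto
  then have "(\<Sum>k\<in>{- int (Suc M)..int (Suc M)}. (1 / 2) ^ nat \<bar>k\<bar>) =
      (1 / 2) ^ Suc M + (1 / 2) ^ Suc M + (\<Sum>k\<in>{- int M..int M}. (1 / 2 :: real) ^ nat \<bar>k\<bar>)"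
    by (simp add: nat_add_distrib del: of_nat_Suc)
  then show ?case using Suc by simp
qed simp

lemma net_codes_subset: "net_codes n \<subseteq> {1..n} \<rightarrow>\<^sub>E ({- int (6 * n)..int (6 * n)} \<times> {- int (6 * n)..int (6 * n)})"
proof
  fix f assume f: "f \<in> net_codes n"
  have "\<bar>fst (f j)\<bar> \<le> int (6 * n) \<and> \<bar>snd (f j)\<bar> \<le> int (6 * n)" if "j \<in> {1..n}" for j
  proof -
    have "(fst (f j))\<^sup>2 + (snd (f j))\<^sup>2 \<le> (\<Sum>j=1..n. (fst (f j))\<^sup>2 + (snd (f j))\<^sup>2)"
      using that by (intro member_le_sum) auto
    then have le: "(fst (f j))\<^sup>2 + (snd (f j))\<^sup>2 \<le> 6 * int n" using f by (simp add: net_codes_def)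
    have sq: "\<bar>k\<bar> \<le> k\<^sup>2" for k :: int
      using self_le_power[of "\<bar>k\<bar>" 2] by (cases "k = 0") auto
    show ?thesis using le sq[of "fst (f j)"] sq[of "snd (f j)"] zero_le_power2[of "fst (f j)"] zero_le_power2[of "snd (f j)"]
      by linarith
  qed
  then show "f \<in> {1..n} \<rightarrow>\<^sub>E ({- int (6 * n)..int (6 * n)} \<times> {- int (6 * n)..int (6 * n)})"
    using f unfolding net_codes_def PiE_iff mem_Times_iff abs_le_iff by (auto simp: minus_le_iff)
qed

lemma finite_net_codes: "finite (net_codes n)"
  by (rule finite_subset[OF net_codes_subset]) (intro finite_PiE, auto)

text \<open>Each code has weight \<open>exp (6 n - |f|\<^sup>2) \<ge> 1\<close>. The total weight factors over the \<open>2 n\<close> coordinates, and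
  each factor \<open>\<Sum>\<^sub>k exp (- k\<^sup>2)\<close> is at most 3.\<close>

lemma card_net_codes_le: "real (card (net_codes n)) \<le> exp (9 * real n)"
proof -
  let ?R = "{- int (6 * n)..int (6 * n)}"
  let ?w = "\<lambda>k :: int. exp (- (of_int k)\<^sup>2) :: real"
  have one: "(\<Sum>k\<in>?R. ?w k) \<le> 3"
  proof -
    have "?w k \<le> (1 / 2) ^ nat \<bar>k\<bar>" for k
    proof -
      have sq: "\<bar>k\<bar> \<le> k\<^sup>2" using self_le_power[of "\<bar>k\<bar>" 2] by (cases "k = 0") auto
      have "real (nat \<bar>k\<bar>) \<le> (of_int k)\<^sup>2"
        using sq by (metis of_int_le_iff of_int_power of_nat_nat abs_ge_zero)
      then have "?w k \<le> exp (- real (nat \<bar>k\<bar>))" by simp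
      also have "\<dots> = exp (- 1) ^ nat \<bar>k\<bar>" by (simp add: exp_of_nat_mult[symmetric])
      also have "\<dots> \<le> (1 / 2) ^ nat \<bar>k\<bar>"
        using exp_ge_add_one_self[of 1] by (intro power_mono) (auto simp: exp_minus inverse_eq_divide field_simps)
      finally show ?thesis .
    qed
    then have "(\<Sum>k\<in>?R. ?w k) \<le> (\<Sum>k\<in>?R. (1 / 2) ^ nat \<bar>k\<bar>)" by (intro sum_mono)
    then show ?thesis using sum_half_power_le[of "6 * n"] by (smt (verit) zero_le_power zero_le_divide_1_iff)
  qed
  have two: "(\<Sum>x\<in>?R \<times> ?R. ?w (fst x) * ?w (snd x)) \<le> 9"
  proof -
    have "(\<Sum>x\<in>?R \<times> ?R. ?w (fst x) * ?w (snd x)) = (\<Sum>k\<in>?R. ?w k) * (\<Sum>k\<in>?R. ?w k)"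
      by (simp add: sum_product sum.cartesian_product case_prod_unfold)
    also have "\<dots> \<le> 3 * 3" using one by (intro mult_mono) (auto intro: sum_nonneg)
    finally show ?thesis by simp
  qed
  have "real (card (net_codes n)) = (\<Sum>f\<in>net_codes n. 1)" by simp
  also have "\<dots> \<le> (\<Sum>f\<in>net_codes n. exp (6 * real n) * (\<Prod>j=1..n. ?w (fst (f j)) * ?w (snd (f j))))"
  proof (rule sum_mono)
    fix f assume "f \<in> net_codes n"
    then have "real_of_int (\<Sum>j=1..n. (fst (f j))\<^sup>2 + (snd (f j))\<^sup>2) \<le> of_int (6 * int n)"
      unfolding of_int_le_iff by (simp add: net_codes_def)
    then have "0 \<le> 6 * real n + (\<Sum>j=1..n. - (of_int (fst (f j)))\<^sup>2 + - (of_int (snd (f j)))\<^sup>2)"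
      by (simp add: sum.distrib sum_negf sum_subtractf)
    then have "1 \<le> exp (6 * real n + (\<Sum>j=1..n. - (of_int (fst (f j)))\<^sup>2 + - (of_int (snd (f j)))\<^sup>2))"
      unfolding one_le_exp_iff .
    then show "1 \<le> exp (6 * real n) * (\<Prod>j=1..n. ?w (fst (f j)) * ?w (snd (f j)))"
      by (simp add: exp_add exp_sum mult_exp_exp)
  qed
  also have "\<dots> \<le> (\<Sum>f\<in>{1..n} \<rightarrow>\<^sub>E (?R \<times> ?R). exp (6 * real n) * (\<Prod>j=1..n. ?w (fst (f j)) * ?w (snd (f j))))"
    by (intro sum_mono2 net_codes_subset finite_PiE mult_nonneg_nonneg prod_nonneg) auto
  also have "\<dots> = exp (6 * real n) * (\<Prod>j=1..n. \<Sum>x\<in>?R \<times> ?R. ?w (fst x) * ?w (snd x))"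
    by (simp only: sum_distrib_left[symmetric]) (subst prod_sum_PiE, auto)
  also have "\<dots> \<le> exp (6 * real n) * (\<Prod>j=1..n. 9)"
    using two by (intro mult_left_mono prod_mono conjI) (auto intro!: sum_nonneg)
  also have "\<dots> \<le> exp (6 * real n) * exp 3 ^ n"
  proof -
    have "(5 / 2 :: real) \<le> exp 1" using exp_lower_Taylor_quadratic[of "1 :: real"] by (simp add: power2_eq_square)
    then have "(5 / 2 :: real) ^ 3 \<le> exp 1 ^ 3" by (intro power_mono) auto
    also have "exp 1 ^ 3 = (exp 3 :: real)" by (simp add: exp_of_nat_mult[symmetric])
    finally have "(9 :: real) \<le> exp 3" by (simp add: power3_eq_cube)
    then show ?thesis by (simp add: power_mono)
  qed
  also have "\<dots> = exp (9 * real n)" by (simp add: exp_of_nat2_mult[symmetric] exp_add[symmetric])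
  finally show ?thesis by simp
qed

text \<open>A linear functional on a cell of the lattice attains its maximum at a vertex. Rounding every coordinate in the direction given
  by the sign of its coefficient therefore never decreases the functional, so that a supremum over a continuous set is a maximum
  over the net without any approximation error. The price is a constant factor in the norm: the mesh \<open>h\<close> makes
  \<open>2 r + 4 n h\<^sup>2 = 6 r\<close>.\<close>

lemma net_rounding:
  fixes x c :: "nat \<Rightarrow> complex"
  assumes n: "1 \<le> n" and r: "0 < r" and x: "(\<Sum>j=1..n. (cmod (x j))\<^sup>2) \<le> r"
  defines "h \<equiv> sqrt (r / n)"
  shows "\<exists>f\<in>net_codes n. (\<forall>j\<in>{1..n}. cmod (decode h f j) \<le> cmod (x j) + 2 * h) \<and>
     (\<Sum>j=1..n. Re (c j * x j)) \<le> (\<Sum>j=1..n. Re (c j * decode h f j))"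
proof -
  have h: "0 < h" "h\<^sup>2 = r / n" using n r by (auto simp: h_def)
  define rd where "rd a y = (if 0 \<le> (a :: real) then \<lceil>y / h\<rceil> else \<lfloor>y / h\<rfloor>)" for a y
  have rd_near: "\<bar>h * rd a y - y\<bar> \<le> h" for a y
  proof -
    have "\<bar>of_int (rd a y) - y / h\<bar> \<le> 1" unfolding rd_def by (cases "0 \<le> a") (simp_all, linarith+)
    then have "h * \<bar>of_int (rd a y) - y / h\<bar> \<le> h * 1" using h by (intro mult_left_mono) auto
    also have "h * \<bar>of_int (rd a y) - y / h\<bar> = \<bar>h * (of_int (rd a y) - y / h)\<bar>" using h by (simp add: abs_mult)
    also have "h * (of_int (rd a y) - y / h) = h * rd a y - y" using h by (simp add: right_diff_distrib)
    finally show ?thesis by simp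
  qed
  have rd_mono: "a * y \<le> a * (h * rd a y)" for a y
  proof (cases "0 \<le> a")
    case True
    have "y / h \<le> \<lceil>y / h\<rceil>" by linarith
    then have "y \<le> h * \<lceil>y / h\<rceil>" using h(1) pos_divide_le_eq mult.commute by metis
    then show ?thesis using True by (simp add: rd_def mult_left_mono)
  next
    case False
    have "\<lfloor>y / h\<rfloor> \<le> y / h" by linarith
    then have "h * \<lfloor>y / h\<rfloor> \<le> y" using h(1) pos_le_divide_eq mult.commute by metis
    then show ?thesis using False by (simp add: rd_def mult_left_mono_neg)
  qed
  have rd_sq: "h\<^sup>2 * (rd a y)\<^sup>2 \<le> 2 * y\<^sup>2 + 2 * h\<^sup>2" for a y
  proof -
    \<comment> \<open>The parallelogram law for \<open>y\<close> and the rounding error.\<close>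
    have "(h * rd a y)\<^sup>2 + (2 * y - h * rd a y)\<^sup>2 = 2 * y\<^sup>2 + 2 * (h * rd a y - y)\<^sup>2"
      by (simp add: power2_eq_square algebra_simps)
    moreover have "(h * rd a y - y)\<^sup>2 \<le> h\<^sup>2" using rd_near[of a y] h(1) by (intro iffD1[OF abs_le_square_iff]) linarith
    ultimately have "(h * rd a y)\<^sup>2 \<le> 2 * y\<^sup>2 + 2 * h\<^sup>2"
      using zero_le_power2[of "2 * y - h * rd a y"] by linarith
    then show ?thesis by (simp add: power_mult_distrib)
  qed
  define f where "f = (\<lambda>j\<in>{1..n}. (rd (Re (c j)) (Re (x j)), rd (- Im (c j)) (Im (x j))))"
  have dec: "decode h f j = Complex (h * rd (Re (c j)) (Re (x j))) (h * rd (- Im (c j)) (Im (x j)))"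
    if "j \<in> {1..n}" for j
    using that by (simp add: decode_def f_def complex_eq_iff)
  have "h\<^sup>2 * (\<Sum>j=1..n. (of_int (fst (f j)))\<^sup>2 + (of_int (snd (f j)))\<^sup>2) \<le> (\<Sum>j=1..n. 2 * (cmod (x j))\<^sup>2 + 4 * h\<^sup>2)"
    unfolding sum_distrib_left
  proof (rule sum_mono)
    fix j assume "j \<in> {1..n}"
    then show "h\<^sup>2 * ((of_int (fst (f j)))\<^sup>2 + (of_int (snd (f j)))\<^sup>2) \<le> 2 * (cmod (x j))\<^sup>2 + 4 * h\<^sup>2"
      using rd_sq[of "Re (c j)" "Re (x j)"] rd_sq[of "- Im (c j)" "Im (x j)"]
      by (simp add: f_def cmod_power2 distrib_left)
  qed
  also have "\<dots> = 2 * (\<Sum>j=1..n. (cmod (x j))\<^sup>2) + 4 * (n * h\<^sup>2)" by (simp add: sum.distrib sum_distrib_left)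
  also have "\<dots> \<le> h\<^sup>2 * (6 * n)" using x n by (simp add: h(2))
  finally have "(\<Sum>j=1..n. (real_of_int (fst (f j)))\<^sup>2 + (of_int (snd (f j)))\<^sup>2) \<le> 6 * n"
    by (rule mult_left_le_imp_le) (use h(1) in simp)
  then have "real_of_int (\<Sum>j=1..n. (fst (f j))\<^sup>2 + (snd (f j))\<^sup>2) \<le> of_int (6 * int n)" by simp
  then have "(\<Sum>j=1..n. (fst (f j))\<^sup>2 + (snd (f j))\<^sup>2) \<le> 6 * int n" unfolding of_int_le_iff .
  then have f: "f \<in> net_codes n" by (simp add: net_codes_def) (auto simp: f_def)
  have "cmod (decode h f j) \<le> cmod (x j) + 2 * h" if "j \<in> {1..n}" for j
  proof -
    have "cmod (decode h f j) \<le> cmod (x j) + cmod (decode h f j - x j)"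
      using norm_triangle_ineq[of "x j" "decode h f j - x j"] by simp
    also have "cmod (decode h f j - x j) \<le> \<bar>Re (decode h f j - x j)\<bar> + \<bar>Im (decode h f j - x j)\<bar>" by (rule cmod_le)
    also have "\<dots> \<le> h + h" using rd_near by (intro add_mono) (simp_all add: dec[OF that])
    finally show ?thesis by simp
  qed
  moreover have "(\<Sum>j=1..n. Re (c j * x j)) \<le> (\<Sum>j=1..n. Re (c j * decode h f j))"
  proof (rule sum_mono)
    fix j assume j: "j \<in> {1..n}"
    show "Re (c j * x j) \<le> Re (c j * decode h f j)"
      using rd_mono[of "Re (c j)" "Re (x j)"] rd_mono[of "- Im (c j)" "Im (x j)"] by (simp add: dec[OF j])
  qed
  ultimately show ?thesis using f by blast
qed

section \<open>The noise matrix\<close>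

text \<open>On a nearly regular graph the edges carry the weight \<open>Y \<otimes> X\<close> as the complete graph does with edge weight \<open>p\<close>, up to
  the operator norm error.\<close>

lemma near_regular_weighted_edges:
  assumes reg: "near_regular n p \<theta> A" and p: "0 \<le> p"
    and X: "\<And>j. j \<in> {1..n} \<Longrightarrow> 0 \<le> X j" and Y: "\<And>j. j \<in> {1..n} \<Longrightarrow> 0 \<le> Y j"
  shows "(\<Sum>j=1..n. \<Sum>k=1..n. adj A j k * Y j * X k) \<le>
    p * (\<Sum>j=1..n. Y j) * (\<Sum>j=1..n. X j) + \<theta> * sqrt (\<Sum>j=1..n. (Y j)\<^sup>2) * sqrt (\<Sum>j=1..n. (X j)\<^sup>2)"
proof -
  have "(\<Sum>j=1..n. \<Sum>k=1..n. adj A j k * Y j * X k) \<le>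
      (\<Sum>j=1..n. \<Sum>k=1..n. p * (Y j * X k) + adj_dev p A j k * Y j * X k)"
    using X Y p by (intro sum_mono) (auto simp: adj_dev_def algebra_simps)
  also have "\<dots> = p * (\<Sum>j=1..n. Y j) * (\<Sum>j=1..n. X j) + (\<Sum>j=1..n. \<Sum>k=1..n. adj_dev p A j k * Y j * X k)"
  proof -
    have "(\<Sum>j=1..n. \<Sum>k=1..n. p * (Y j * X k)) = p * ((\<Sum>j=1..n. Y j) * (\<Sum>j=1..n. X j))"
      unfolding sum_product by (simp only: sum_distrib_left)
    then show ?thesis by (simp add: sum.distrib mult.assoc)
  qed
  also have "(\<Sum>j=1..n. \<Sum>k=1..n. adj_dev p A j k * Y j * X k) \<le>
      \<theta> * sqrt (\<Sum>j=1..n. (Y j)\<^sup>2) * sqrt (\<Sum>j=1..n. (X j)\<^sup>2)"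
    using reg unfolding near_regular_def by (meson abs_le_D1)
  finally show ?thesis by simp
qed

text \<open>The noise seen in the frame of the true phases: entry \<open>(j, k)\<close> is \<open>conj (zs j) W\<^sub>j\<^sub>k zs k\<close> on the edges of the graph, extended
  to a Hermitian matrix. The rotation removes the true signal from all later formulas.\<close>

definition noise :: "(nat \<times> nat \<Rightarrow> bool) \<Rightarrow> (nat \<Rightarrow> complex) \<Rightarrow> (nat \<times> nat \<Rightarrow> complex) \<Rightarrow> nat \<Rightarrow> nat \<Rightarrow> complex" where
  "noise A zs W j k = of_real (adj A j k) *
     (if j < k then cnj (zs j) * zs k * W (j, k) else cnj (cnj (zs k) * zs j * W (k, j)))"

definition noise_form :: "nat \<Rightarrow> (nat \<times> nat \<Rightarrow> bool) \<Rightarrow> (nat \<Rightarrow> complex) \<Rightarrow> (nat \<times> nat \<Rightarrow> complex) \<Rightarrow>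
    (nat \<Rightarrow> complex) \<Rightarrow> (nat \<Rightarrow> complex) \<Rightarrow> real" where
  "noise_form n A zs W y x = (\<Sum>j=1..n. \<Sum>k=1..n. Re (cnj (y j) * noise A zs W j k * x k))"

definition noise_coef :: "(nat \<times> nat \<Rightarrow> bool) \<Rightarrow> (nat \<Rightarrow> complex) \<Rightarrow> (nat \<Rightarrow> complex) \<Rightarrow> (nat \<Rightarrow> complex) \<Rightarrow>
    nat \<times> nat \<Rightarrow> complex" where
  "noise_coef A zs y x = (\<lambda>(j, k). of_bool (A (j, k)) * (cnj (zs j) * zs k) * (cnj (y j) * x k + y k * cnj (x j)))"

lemma noise_form_eq_lin_form:
  "noise_form n A zs W y x = lin_form (index_pairs n) (noise_coef A zs y x) W"
proof -
  have "noise_form n A zs W y x = (\<Sum>(j, k)\<in>index_pairs n.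
      Re (cnj (y j) * noise A zs W j k * x k) + Re (cnj (y k) * noise A zs W k j * x j))"
    unfolding noise_form_def by (rule sum_square_eq_sum_pairs) (simp add: noise_def)
  also have "\<dots> = lin_form (index_pairs n) (noise_coef A zs y x) W"
    unfolding lin_form_def
  proof (intro sum.cong refl, clarify)
    fix j k assume "(j, k) \<in> index_pairs n"
    then have jk: "j < k" "\<not> k < j" by (auto simp: index_pairs_def)
    define w where "w = cnj (zs j) * zs k * W (j, k)"
    have *: "Re (cnj (y k) * cnj w * x j) = Re (y k * w * cnj (x j))"
      by (metis complex_cnj_cnj complex_cnj_mult cnj.simps(1))
    show "Re (cnj (y j) * noise A zs W j k * x k) + Re (cnj (y k) * noise A zs W k j * x j) =
        Re (noise_coef A zs y x (j, k) * W (j, k))"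
    proof (cases "A (j, k)")
      case True
      then have "noise A zs W j k = w" "noise A zs W k j = cnj w"
        using jk by (simp_all only: noise_def adj_def w_def) simp_all
      moreover have "noise_coef A zs y x (j, k) * W (j, k) = cnj (y j) * w * x k + y k * w * cnj (x j)"
        using True by (simp add: noise_coef_def w_def algebra_simps)
      ultimately show ?thesis using * by simp
    qed (use jk in \<open>simp add: noise_def noise_coef_def adj_def\<close>)
  qed
  finally show ?thesis .
qed

lemma noise_coef_norm_le:
  assumes zs: "\<And>j. j \<in> {1..n} \<Longrightarrow> cmod (zs j) = 1"
  shows "(\<Sum>e\<in>index_pairs n. (cmod (noise_coef A zs y x e))\<^sup>2) \<le>
    2 * (\<Sum>j=1..n. \<Sum>k=1..n. adj A j k * (cmod (y j))\<^sup>2 * (cmod (x k))\<^sup>2)"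
proof -
  have "(\<Sum>e\<in>index_pairs n. (cmod (noise_coef A zs y x e))\<^sup>2) \<le>
      (\<Sum>(j, k)\<in>index_pairs n. 2 * (adj A j k * (cmod (y j))\<^sup>2 * (cmod (x k))\<^sup>2) +
        2 * (adj A k j * (cmod (y k))\<^sup>2 * (cmod (x j))\<^sup>2))"
  proof (intro sum_mono, clarify)
    fix j k assume e: "(j, k) \<in> index_pairs n"
    then have jk: "j < k" "cmod (zs j) = 1" "cmod (zs k) = 1" using zs by (auto simp: index_pairs_def)
    have "(cmod (cnj (y j) * x k + y k * cnj (x j)))\<^sup>2 \<le> (cmod (y j) * cmod (x k) + cmod (y k) * cmod (x j))\<^sup>2"
      using norm_triangle_ineq[of "cnj (y j) * x k" "y k * cnj (x j)"] by (intro power_mono) (auto simp: norm_mult)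
    also have "\<dots> \<le> 2 * (cmod (y j) * cmod (x k))\<^sup>2 + 2 * (cmod (y k) * cmod (x j))\<^sup>2"
      using sum_squares_bound[of "cmod (y j) * cmod (x k)" "cmod (y k) * cmod (x j)"]
      by (simp add: power2_sum)
    finally show "(cmod (noise_coef A zs y x (j, k)))\<^sup>2 \<le> 2 * (adj A j k * (cmod (y j))\<^sup>2 * (cmod (x k))\<^sup>2) +
        2 * (adj A k j * (cmod (y k))\<^sup>2 * (cmod (x j))\<^sup>2)"
      using jk by (cases "A (j, k)") (simp_all add: noise_coef_def adj_def norm_mult power_mult_distrib)
  qed
  also have "\<dots> = (\<Sum>j=1..n. \<Sum>k=1..n. 2 * (adj A j k * (cmod (y j))\<^sup>2 * (cmod (x k))\<^sup>2))"
    by (rule sum_square_eq_sum_pairs[symmetric]) simp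
  finally show ?thesis by (simp add: sum_distrib_left)
qed

text \<open>This equation and the next show the form as a real linear functional of one argument, so that \<open>net_rounding\<close> applies to
  each argument in turn.\<close>

lemma noise_form_right: "noise_form n A zs W y x = (\<Sum>k=1..n. Re ((\<Sum>j=1..n. cnj (y j) * noise A zs W j k) * x k))"
  unfolding noise_form_def by (subst sum.swap) (simp only: sum_distrib_right Re_sum)

lemma noise_form_left: "noise_form n A zs W y x = (\<Sum>j=1..n. Re (cnj (\<Sum>k=1..n. noise A zs W j k * x k) * y j))"
proof -
  have "(\<Sum>k=1..n. Re (cnj (y j) * noise A zs W j k * x k)) = Re (cnj (\<Sum>k=1..n. noise A zs W j k * x k) * y j)" for j
  proof -
    have "(\<Sum>k=1..n. Re (cnj (y j) * noise A zs W j k * x k)) = Re (cnj (y j) * (\<Sum>k=1..n. noise A zs W j k * x k))"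
      by (simp only: sum_distrib_left Re_sum mult.assoc)
    also have "\<dots> = Re (cnj (cnj (y j) * (\<Sum>k=1..n. noise A zs W j k * x k)))" by (simp only: cnj.simps(1))
    also have "\<dots> = Re (cnj (\<Sum>k=1..n. noise A zs W j k * x k) * y j)"
      by (simp only: complex_cnj_mult complex_cnj_cnj mult.commute)
    finally show ?thesis .
  qed
  then show ?thesis by (simp add: noise_form_def)
qed

text \<open>The scale \<open>r\<close> runs over the integers, so that a union bound over all scales costs only a factor \<open>4 n\<close>; smaller vectors are
  treated by homogeneity in \<open>noise_form_small\<close>.\<close>

definition noise_bounded :: "nat \<Rightarrow> real \<Rightarrow> real \<Rightarrow> (nat \<times> nat \<Rightarrow> bool) \<Rightarrow> (nat \<Rightarrow> complex) \<Rightarrow> (nat \<times> nat \<Rightarrow> complex) \<Rightarrow> bool" where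
  "noise_bounded n p \<theta> A zs W \<longleftrightarrow> (\<forall>r\<in>{1..4 * n}. \<forall>y x.
     (\<forall>j\<in>{1..n}. cmod (y j) \<le> 2 \<and> cmod (x j) \<le> 2) \<longrightarrow>
     (\<Sum>j=1..n. (cmod (y j))\<^sup>2) \<le> r \<longrightarrow> (\<Sum>j=1..n. (cmod (x j))\<^sup>2) \<le> r \<longrightarrow>
     noise_form n A zs W y x \<le> 100 * sqrt (n * (p * (real r)\<^sup>2 + \<theta> * r)))"

text \<open>After rounding both arguments to the net of scale \<open>r\<close>, entries are at most 6 and squared norms at most \<open>6 r\<close>. For
  a fixed pair of net vectors the form is Gaussian with variance parameter at most \<open>432 (p r\<^sup>2 + \<theta> r)\<close>. Here the bounded
  entries are essential, as they give \<open>\<Sum>\<^sub>j |x\<^sub>j|\<^sup>4 \<le> 36 \<Sum>\<^sub>j |x\<^sub>j|\<^sup>2\<close>. The factor 100 in the bound yields the tail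
  \<open>exp (- 23 n)\<close>, since \<open>100\<^sup>2 / 432 > 23\<close>, against \<open>exp (18 n)\<close> pairs.\<close>

lemma noise_bounded_probability:
  assumes n: "1 \<le> n" and p: "0 < p" and \<theta>: "0 < \<theta>" and reg: "near_regular n p \<theta> A"
    and zs: "\<And>j. j \<in> {1..n} \<Longrightarrow> cmod (zs j) = 1"
  shows "\<exists>F\<in>sets (noise_law (index_pairs n)). measure (noise_law (index_pairs n)) (space (noise_law (index_pairs n)) - F) \<le> 4 * real n * exp (- 5 * real n)
    \<and> (\<forall>W\<in>F. noise_bounded n p \<theta> A zs W)"
proof -
  let ?I = "index_pairs n" and ?N = "noise_law (index_pairs n)" and ?C = "net_codes n"
  interpret prob_space ?N by (rule prob_space_noise_law)
  define h where "h r = sqrt (real r / n)" for r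
  define t where "t r = 100 * sqrt (n * (p * (real r)\<^sup>2 + \<theta> * r))" for r
  define small where "small r f \<longleftrightarrow> (\<forall>j\<in>{1..n}. cmod (decode (h r) f j) \<le> 6)" for r f
  define S where "S r = {(f, g). f \<in> ?C \<and> g \<in> ?C \<and> small r f \<and> small r g}" for r
  define bad where "bad r fg = {W \<in> space ?N. t r < noise_form n A zs W (decode (h r) (fst fg)) (decode (h r) (snd fg))}" for r fg
  have S_sub: "S r \<subseteq> ?C \<times> ?C" for r by (auto simp: S_def)
  have finS: "finite (S r)" for r by (rule finite_subset[OF S_sub]) (simp add: finite_net_codes)
  have bad_sets [measurable]: "bad r fg \<in> sets ?N" for r fg
    unfolding bad_def noise_form_eq_lin_form by measurable
  have prob_bad: "prob (bad r fg) \<le> exp (- 23 * real n)" if r: "r \<in> {1..4 * n}" and fg: "fg \<in> S r" for r fg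
  proof -
    obtain f g where fg_eq: "fg = (f, g)" and C: "f \<in> ?C" "g \<in> ?C" and sm: "small r f" "small r g"
      using fg by (auto simp: S_def)
    let ?d = "\<lambda>f j. cmod (decode (h r) f j)"
    have hr: "(h r)\<^sup>2 = r / n" by (simp add: h_def)
    have sq: "(\<Sum>j=1..n. (?d f j)\<^sup>2) \<le> 6 * r" "(\<Sum>j=1..n. ((?d f j)\<^sup>2)\<^sup>2) \<le> 216 * r"
      if "f \<in> ?C" "small r f" for f
    proof -
      have "(\<Sum>j=1..n. (?d f j)\<^sup>2) = (r / n) * (\<Sum>j=1..n. (of_int (fst (f j)))\<^sup>2 + (of_int (snd (f j)))\<^sup>2)"
        by (simp add: decode_def norm_mult power_mult_distrib hr sum_distrib_left cmod_power2)
      also have "\<dots> = (r / n) * of_int (\<Sum>j=1..n. (fst (f j))\<^sup>2 + (snd (f j))\<^sup>2)" by simp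
      also have "\<dots> \<le> (r / n) * of_int (6 * int n)"
        using that(1) by (intro mult_left_mono, unfold of_int_le_iff) (auto simp: net_codes_def)
      also have "\<dots> = 6 * r" using n by simp
      finally show le: "(\<Sum>j=1..n. (?d f j)\<^sup>2) \<le> 6 * r" .
      have "(\<Sum>j=1..n. ((?d f j)\<^sup>2)\<^sup>2) \<le> (\<Sum>j=1..n. 36 * (?d f j)\<^sup>2)"
      proof (rule sum_mono)
        fix j assume "j \<in> {1..n}"
        then have "(?d f j)\<^sup>2 \<le> 6\<^sup>2"
          using that(2) by (intro power_mono) (auto simp: small_def)
        then show "((?d f j)\<^sup>2)\<^sup>2 \<le> 36 * (?d f j)\<^sup>2"
          unfolding power2_eq_square[of "(?d f j)\<^sup>2"] by (intro mult_right_mono) auto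
      qed
      also have "\<dots> \<le> 216 * r" using le by (simp add: sum_distrib_left[symmetric])
      finally show "(\<Sum>j=1..n. ((?d f j)\<^sup>2)\<^sup>2) \<le> 216 * r" .
    qed
    define v where "v = 432 * (p * (real r)\<^sup>2 + \<theta> * r)"
    have v0: "0 < v" using p \<theta> r by (auto simp: v_def intro!: add_pos_pos)
    have "(\<Sum>e\<in>?I. (cmod (noise_coef A zs (decode (h r) f) (decode (h r) g) e))\<^sup>2) \<le>
        2 * (\<Sum>j=1..n. \<Sum>k=1..n. adj A j k * (?d f j)\<^sup>2 * (?d g k)\<^sup>2)"
      by (rule noise_coef_norm_le[OF zs])
    also have "(\<Sum>j=1..n. \<Sum>k=1..n. adj A j k * (?d f j)\<^sup>2 * (?d g k)\<^sup>2) \<le>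
        p * (\<Sum>j=1..n. (?d f j)\<^sup>2) * (\<Sum>j=1..n. (?d g j)\<^sup>2) +
        \<theta> * sqrt (\<Sum>j=1..n. ((?d f j)\<^sup>2)\<^sup>2) * sqrt (\<Sum>j=1..n. ((?d g j)\<^sup>2)\<^sup>2)"
      using p by (intro near_regular_weighted_edges[OF reg]) auto
    also have "\<dots> \<le> p * (6 * real r) * (6 * real r) + \<theta> * sqrt (216 * real r) * sqrt (216 * real r)"
      using p \<theta> sq[OF C(1) sm(1)] sq[OF C(2) sm(2)]
      by (intro add_mono mult_mono real_sqrt_le_mono) (auto intro: sum_nonneg mult_nonneg_nonneg)
    also have "2 * \<dots> \<le> v"
    proof -
      have "sqrt (216 * real r) * sqrt (216 * real r) = 216 * r" by simp
      then have eq: "\<theta> * sqrt (216 * real r) * sqrt (216 * real r) = \<theta> * (216 * r)" by (simp only: mult.assoc)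
      show ?thesis using p unfolding eq v_def by (simp add: power2_eq_square)
    qed
    finally have sum_v: "(\<Sum>e\<in>?I. (cmod (noise_coef A zs (decode (h r) f) (decode (h r) g) e))\<^sup>2) \<le> v" by simp
    have t0: "0 < t r" using p \<theta> r n unfolding t_def by (auto intro!: mult_pos_pos add_pos_pos)
    have "prob (bad r fg) \<le> exp (- (t r)\<^sup>2 / v)"
      unfolding bad_def noise_form_eq_lin_form fg_eq using lin_form_tail[OF _ sum_v v0 t0] by simp
    also have "\<dots> \<le> exp (- 23 * real n)"
    proof -
      define D where "D = p * (real r)\<^sup>2 + \<theta> * r"
      have "0 < D" using v0 by (simp add: v_def D_def)
      then have "(t r)\<^sup>2 / v = 10000 / 432 * n"
        by (simp add: t_def v_def D_def[symmetric] power_mult_distrib)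
      then have "23 * real n \<le> (t r)\<^sup>2 / v" by linarith
      then show ?thesis by simp
    qed
    finally show ?thesis .
  qed
  define F where "F = space ?N - (\<Union>r\<in>{1..4 * n}. \<Union>fg\<in>S r. bad r fg)"
  have "F \<in> sets ?N" unfolding F_def using finS by (intro sets.Diff sets.finite_UN) auto
  moreover have "prob (space ?N - F) \<le> 4 * real n * exp (- 5 * real n)"
  proof -
    have "space ?N - F = (\<Union>r\<in>{1..4 * n}. \<Union>fg\<in>S r. bad r fg)"
      using sets.sets_into_space[OF bad_sets] unfolding F_def by blast
    also have "prob \<dots> \<le> (\<Sum>r\<in>{1..4 * n}. prob (\<Union>fg\<in>S r. bad r fg))"
      using finS by (intro measure_UNION_le) auto
    also have "\<dots> \<le> (\<Sum>r\<in>{1..4 * n}. exp (- 5 * real n))"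
    proof (rule sum_mono)
      fix r assume r: "r \<in> {1..4 * n}"
      have "prob (\<Union>fg\<in>S r. bad r fg) \<le> (\<Sum>fg\<in>S r. prob (bad r fg))"
        using finS by (intro measure_UNION_le) auto
      also have "\<dots> \<le> card (S r) * exp (- 23 * real n)"
        using prob_bad[OF r] by (intro sum_bounded_above) auto
      also have "\<dots> \<le> exp (9 * real n) * exp (9 * real n) * exp (- 23 * real n)"
      proof (rule mult_right_mono)
        have "card (S r) \<le> card (?C \<times> ?C)" using S_sub by (intro card_mono) (auto simp: finite_net_codes)
        then have "real (card (S r)) \<le> real (card ?C) * real (card ?C)"
          unfolding card_cartesian_product of_nat_mult[symmetric] of_nat_le_iff .
        also have "\<dots> \<le> exp (9 * real n) * exp (9 * real n)" using card_net_codes_le[of n] by (intro mult_mono) auto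
        finally show "real (card (S r)) \<le> exp (9 * real n) * exp (9 * real n)" .
      qed simp
      also have "\<dots> = exp (- 5 * real n)" by (simp add: exp_add[symmetric])
      finally show "prob (\<Union>fg\<in>S r. bad r fg) \<le> exp (- 5 * real n)" .
    qed
    finally show ?thesis by simp
  qed
  moreover have "noise_bounded n p \<theta> A zs W" if W: "W \<in> F" for W
    unfolding noise_bounded_def
  proof (intro ballI allI impI)
    fix r y x
    assume r: "r \<in> {1..4 * n}" and le2: "\<forall>j\<in>{1..n}. cmod (y j) \<le> 2 \<and> cmod (x j) \<le> 2"
      and y: "(\<Sum>j=1..n. (cmod (y j))\<^sup>2) \<le> real r" and x: "(\<Sum>j=1..n. (cmod (x j))\<^sup>2) \<le> real r"
    have h2: "h r \<le> 2"
    proof -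
      have "real r / n \<le> 2\<^sup>2" using r n by (simp add: divide_le_eq)
      then show ?thesis unfolding h_def by (intro real_le_lsqrt) auto
    qed
    obtain g where g: "g \<in> ?C" "\<forall>j\<in>{1..n}. cmod (decode (h r) g j) \<le> cmod (x j) + 2 * h r"
      and gle: "noise_form n A zs W y x \<le> noise_form n A zs W y (decode (h r) g)"
      using net_rounding[OF n _ x, of "\<lambda>k. \<Sum>j=1..n. cnj (y j) * noise A zs W j k"] r
      unfolding noise_form_right h_def by auto
    obtain f where f: "f \<in> ?C" "\<forall>j\<in>{1..n}. cmod (decode (h r) f j) \<le> cmod (y j) + 2 * h r"
      and fle: "noise_form n A zs W y (decode (h r) g) \<le> noise_form n A zs W (decode (h r) f) (decode (h r) g)"
      using net_rounding[OF n _ y, of "\<lambda>j. cnj (\<Sum>k=1..n. noise A zs W j k * decode (h r) g k)"] r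
      unfolding noise_form_left h_def by auto
    have "(f, g) \<in> S r" using f g le2 h2 unfolding S_def small_def by fastforce
    then have "W \<notin> bad r (f, g)" "W \<in> space ?N" using W r unfolding F_def by auto
    then have "noise_form n A zs W (decode (h r) f) (decode (h r) g) \<le> t r" by (simp add: bad_def not_less)
    then show "noise_form n A zs W y x \<le> 100 * sqrt (n * (p * (real r)\<^sup>2 + \<theta> * r))"
      using gle fle by (simp add: t_def)
  qed
  ultimately show ?thesis by blast
qed

definition noise_row :: "nat \<Rightarrow> (nat \<times> nat \<Rightarrow> bool) \<Rightarrow> (nat \<Rightarrow> complex) \<Rightarrow> (nat \<times> nat \<Rightarrow> complex) \<Rightarrow> nat \<Rightarrow> complex" where
  "noise_row n A zs W j = (\<Sum>k=1..n. noise A zs W j k)"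

lemma noise_row_component:
  assumes "j \<in> {1..n}"
  shows "Re (cnj w * noise_row n A zs W j) =
    lin_form (index_pairs n) (noise_coef A zs (\<lambda>l. of_bool (l = j) * w) (\<lambda>_. 1)) W"
proof -
  have "lin_form (index_pairs n) (noise_coef A zs (\<lambda>l. of_bool (l = j) * w) (\<lambda>_. 1)) W =
      (\<Sum>l=1..n. of_bool (j = l) * Re (cnj w * noise_row n A zs W l))"
    unfolding noise_form_eq_lin_form[symmetric] noise_form_def
    by (intro sum.cong refl) (auto simp: noise_row_def sum_distrib_left simp del: times_complex.simps)
  then show ?thesis using assms by (simp only: sum_of_bool_eq_mult finite_atLeastAtMost)
qed

lemma near_regular_degree:
  assumes reg: "near_regular n p \<theta> A" and p: "0 \<le> p" and j: "j \<in> {1..n}"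
  shows "(\<Sum>k=1..n. adj A j k) \<le> (real n - 1) * p + \<theta>"
proof -
  have "(\<Sum>k=1..n. adj A j k) = (\<Sum>k=1..n. adj_dev p A j k + (p - of_bool (j = k) * p))"
    by (intro sum.cong refl) (auto simp: adj_dev_def)
  also have "\<dots> = (\<Sum>k=1..n. adj_dev p A j k) + (real n - 1) * p"
    using j sum_of_bool_eq_mult[of "{1..n}" j "\<lambda>_. p"]
    by (simp add: sum.distrib sum_subtractf left_diff_distrib)
  also have "(\<Sum>k=1..n. adj_dev p A j k) \<le> \<theta>" using reg j unfolding near_regular_def by (meson abs_le_D1)
  finally show ?thesis by simp
qed

text \<open>The quadratic form is that of the graph Laplacian \<open>D - A\<close>, with \<open>D\<close> the diagonal matrix of degrees.
  Its largest eigenvalue is close to the degree, not to twice the degree, because on the complement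
  of the constant vector \<open>A\<close> is negligible and on that vector it has the favourable sign.\<close>

lemma near_regular_Laplacian_le:
  fixes t :: "nat \<Rightarrow> real"
  assumes reg: "near_regular n p \<theta> A" and p: "0 \<le> p"
  shows "(\<Sum>(j, k)\<in>index_pairs n. adj A j k * (t j - t k)\<^sup>2) \<le> (n * p + 2 * \<theta>) * (\<Sum>j=1..n. (t j)\<^sup>2)"
proof -
  let ?S = "\<Sum>j=1..n. (t j)\<^sup>2"
  have "(\<Sum>(j, k)\<in>index_pairs n. adj A j k * (t j - t k)\<^sup>2) =
      (\<Sum>(j, k)\<in>index_pairs n. (adj A j k * (t j)\<^sup>2 - adj A j k * t j * t k) + (adj A k j * (t k)\<^sup>2 - adj A k j * t k * t j))"
    by (intro sum.cong refl, clarify, subst (3 4) adj_sym) (simp add: power2_eq_square algebra_simps)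
  also have "\<dots> = (\<Sum>j=1..n. \<Sum>k=1..n. adj A j k * (t j)\<^sup>2 - adj A j k * t j * t k)"
    by (rule sum_square_eq_sum_pairs[symmetric]) simp
  also have "\<dots> = (\<Sum>j=1..n. (\<Sum>k=1..n. adj A j k) * (t j)\<^sup>2) - (\<Sum>j=1..n. \<Sum>k=1..n. adj A j k * t j * t k)"
    by (simp add: sum_subtractf sum_distrib_right)
  also have "(\<Sum>j=1..n. \<Sum>k=1..n. adj A j k * t j * t k) =
      (\<Sum>j=1..n. \<Sum>k=1..n. adj_dev p A j k * t j * t k + (p * (t j * t k) - of_bool (j = k) * (p * (t j * t k))))"
    by (intro sum.cong refl) (auto simp: adj_dev_def algebra_simps)
  also have "\<dots> = (\<Sum>j=1..n. \<Sum>k=1..n. adj_dev p A j k * t j * t k) + (p * (\<Sum>j=1..n. t j)\<^sup>2 - p * ?S)"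
  proof -
    have "(\<Sum>j=1..n. \<Sum>k=1..n. of_bool (j = k) * (p * (t j * t k))) = (\<Sum>j=1..n. p * (t j * t j))"
      by (intro sum.cong refl sum_of_bool_eq_mult) auto
    then have diag: "(\<Sum>j=1..n. \<Sum>k=1..n. of_bool (j = k) * (p * (t j * t k))) = p * ?S"
      by (simp add: sum_distrib_left power2_eq_square)
    have full: "(\<Sum>j=1..n. \<Sum>k=1..n. p * (t j * t k)) = p * (\<Sum>j=1..n. t j)\<^sup>2"
      unfolding power2_eq_square sum_product by (simp only: sum_distrib_left)
    show ?thesis by (simp only: sum.distrib sum_subtractf diag full)
  qed
  also have "(\<Sum>j=1..n. (\<Sum>k=1..n. adj A j k) * (t j)\<^sup>2) \<le> (\<Sum>j=1..n. ((real n - 1) * p + \<theta>) * (t j)\<^sup>2)"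
    by (intro sum_mono mult_right_mono near_regular_degree[OF reg p]) auto
  also have "\<dots> = ((real n - 1) * p + \<theta>) * ?S" by (simp add: sum_distrib_left)
  also have "((real n - 1) * p + \<theta>) * ?S - ((\<Sum>j=1..n. \<Sum>k=1..n. adj_dev p A j k * t j * t k) + (p * (\<Sum>j=1..n. t j)\<^sup>2 - p * ?S))
      \<le> ((real n - 1) * p + \<theta>) * ?S + \<theta> * ?S + p * ?S"
  proof -
    have "\<bar>\<Sum>j=1..n. \<Sum>k=1..n. adj_dev p A j k * t j * t k\<bar> \<le> \<theta> * sqrt ?S * sqrt ?S"
      using reg unfolding near_regular_def by blast
    also have "\<dots> = \<theta> * ?S" by (simp add: mult.assoc sum_nonneg)
    finally have "- (\<Sum>j=1..n. \<Sum>k=1..n. adj_dev p A j k * t j * t k) \<le> \<theta> * ?S" by linarith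
    moreover have "0 \<le> p * (\<Sum>j=1..n. t j)\<^sup>2" using p by simp
    ultimately show ?thesis by linarith
  qed
  also have "\<dots> = (n * p + 2 * \<theta>) * ?S" by (simp add: algebra_simps)
  finally show ?thesis by simp
qed

text \<open>By Hermitian symmetry an edge enters the imaginary parts of its two rows with opposite signs. The combination
  \<open>\<Sum>\<^sub>j t\<^sub>j Im g\<^sub>j\<close> thus has the coefficients \<open>t\<^sub>j - t\<^sub>k\<close> on the edges, and the Laplacian bound supplies the eigenvalue
  \<open>n p + 2 \<theta>\<close>.\<close>

lemma noise_row_Im_tail:
  assumes reg: "near_regular n p \<theta> A" and p: "0 < p" and \<theta>: "0 < \<theta>" and n: "1 \<le> n"
    and zs: "\<And>j. j \<in> {1..n} \<Longrightarrow> cmod (zs j) = 1" and \<epsilon>: "0 < \<epsilon>" "\<epsilon> \<le> 1"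
  shows "measure (noise_law (index_pairs n)) {W \<in> space (noise_law (index_pairs n)).
     (1 + \<epsilon>) * (n * (n * p + 2 * \<theta>) / 2) < (\<Sum>j=1..n. (Im (noise_row n A zs W j))\<^sup>2)} \<le> exp (- real n * \<epsilon>\<^sup>2 / 16)"
proof -
  let ?I = "index_pairs n"
  define b where "b j = noise_coef A zs (\<lambda>l. of_bool (l = j) * \<i>) (\<lambda>_. 1)" for j
  have Im: "Im (noise_row n A zs W j) = lin_form ?I (b j) W" if "j \<in> {1..n}" for j W
    unfolding b_def noise_row_component[OF that, symmetric] by simp
  have K: "(\<Sum>e\<in>?I. (cmod (\<Sum>j=1..n. of_real (t j) * b j e))\<^sup>2) \<le> (n * p + 2 * \<theta>) * (\<Sum>j=1..n. (t j)\<^sup>2)" for t :: "nat \<Rightarrow> real"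
  proof -
    have "(\<Sum>e\<in>?I. (cmod (\<Sum>j=1..n. of_real (t j) * b j e))\<^sup>2) = (\<Sum>(j, k)\<in>?I. adj A j k * (t j - t k)\<^sup>2)"
    proof (intro sum.cong refl, clarify)
      fix j k assume "(j, k) \<in> ?I"
      then have jk: "j < k" "j \<in> {1..n}" "k \<in> {1..n}" by (auto simp: index_pairs_def)
      have "(\<Sum>l=1..n. of_real (t l) * b l (j, k)) = of_bool (A (j, k)) * (cnj (zs j) * zs k) *
          (\<Sum>l=1..n. of_bool (k = l) * (\<i> * of_real (t l)) - of_bool (j = l) * (\<i> * of_real (t l)))"
        unfolding sum_distrib_left b_def noise_coef_def
        by (intro sum.cong refl) (auto simp: algebra_simps)
      also have "\<dots> = of_bool (A (j, k)) * (cnj (zs j) * zs k) * (\<i> * of_real (t k - t j))"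
      proof -
        have "(\<Sum>l=1..n. of_bool (m = l) * (\<i> * of_real (t l))) = \<i> * of_real (t m)" if "m \<in> {1..n}" for m
        proof -
          have "(\<Sum>l=1..n. of_bool (m = l) * (\<i> * of_real (t l))) = (\<Sum>l=1..n. if m = l then \<i> * of_real (t l) else 0)"
            by (intro sum.cong) auto
          then show ?thesis using that by simp
        qed
        then show ?thesis using jk by (simp only: sum_subtractf of_real_diff right_diff_distrib)
      qed
      finally show "(cmod (\<Sum>l=1..n. of_real (t l) * b l (j, k)))\<^sup>2 = adj A j k * (t j - t k)\<^sup>2"
        using jk zs by (simp add: norm_mult power_mult_distrib adj_def power2_commute del: of_real_diff)
    qed
    also have "\<dots> \<le> (n * p + 2 * \<theta>) * (\<Sum>j=1..n. (t j)\<^sup>2)"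
      using near_regular_Laplacian_le[OF reg] p by simp
    finally show ?thesis .
  qed
  have pos: "0 < n * p + 2 * \<theta>" using p \<theta> by (simp add: add_nonneg_pos)
  have "{W \<in> space (noise_law ?I). (1 + \<epsilon>) * (n * (n * p + 2 * \<theta>) / 2) < (\<Sum>j=1..n. (Im (noise_row n A zs W j))\<^sup>2)} =
      {W \<in> space (noise_law ?I). (1 + \<epsilon>) * (card {1..n} * (n * p + 2 * \<theta>) / 2) < (\<Sum>j=1..n. (lin_form ?I (b j) W)\<^sup>2)}"
    by (simp add: Im)
  then show ?thesis
    using quadratic_form_tail[OF finite_index_pairs _ pos K \<epsilon>] by simp
qed

lemma noise_row_modulus_tail:
  assumes reg: "near_regular n p \<theta> A" and p: "0 < p" and \<theta>: "0 < \<theta>" "\<theta> \<le> n * p"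
    and zs: "\<And>j. j \<in> {1..n} \<Longrightarrow> cmod (zs j) = 1" and T: "0 < T" and B: "0 < B"
  shows "measure (noise_law (index_pairs n)) {W \<in> space (noise_law (index_pairs n)).
      B \<le> (\<Sum>j=1..n. cmod (noise_row n A zs W j) * of_bool (T < cmod (noise_row n A zs W j)))}
    \<le> n * (64 * (n * p) / T) * exp (- T\<^sup>2 / (64 * (n * p))) / B"
proof -
  let ?I = "index_pairs n"
  define b where "b w j = noise_coef A zs (\<lambda>l. of_bool (l = j) * w) (\<lambda>_. 1)" for w j
  have comp: "lin_form ?I (b w j) W = Re (cnj w * noise_row n A zs W j)" if "j \<in> {1..n}" for w j W
    unfolding b_def noise_row_component[OF that] ..
  have g: "cmod (noise_row n A zs W j) = sqrt ((lin_form ?I (b 1 j) W)\<^sup>2 + (lin_form ?I (b \<i> j) W)\<^sup>2)" if "j \<in> {1..n}" for j W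
    by (simp add: comp[OF that] cmod_def)
  have norm: "(\<Sum>e\<in>?I. (cmod (b w j e))\<^sup>2) \<le> 4 * (n * p)" if "j \<in> {1..n}" "cmod w = 1" for w j
  proof -
    have "(\<Sum>e\<in>?I. (cmod (b w j e))\<^sup>2) \<le>
        2 * (\<Sum>l=1..n. \<Sum>k=1..n. adj A l k * (cmod (of_bool (l = j) * w))\<^sup>2 * (cmod 1)\<^sup>2)"
      unfolding b_def by (rule noise_coef_norm_le[OF zs])
    also have "(\<Sum>l=1..n. \<Sum>k=1..n. adj A l k * (cmod (of_bool (l = j) * w))\<^sup>2 * (cmod 1)\<^sup>2) =
        (\<Sum>l=1..n. of_bool (j = l) * (\<Sum>k=1..n. adj A l k))"
      using that(2) by (intro sum.cong refl) auto
    also have "\<dots> = (\<Sum>k=1..n. adj A j k)" by (rule sum_of_bool_eq_mult) (use that in auto)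
    also have "\<dots> \<le> (real n - 1) * p + \<theta>" using near_regular_degree[OF reg _ that(1)] p by simp
    also have "\<dots> \<le> 2 * (n * p)" unfolding left_diff_distrib using p \<theta> by linarith
    finally show ?thesis by simp
  qed
  have np: "0 < n * p" using \<theta> by linarith
  have "{W \<in> space (noise_law ?I). B \<le> (\<Sum>j=1..n. cmod (noise_row n A zs W j) * of_bool (T < cmod (noise_row n A zs W j)))} =
      {W \<in> space (noise_law ?I). B \<le> (\<Sum>j=1..n. sqrt ((lin_form ?I (b 1 j) W)\<^sup>2 + (lin_form ?I (b \<i> j) W)\<^sup>2) *
         of_bool (T < sqrt ((lin_form ?I (b 1 j) W)\<^sup>2 + (lin_form ?I (b \<i> j) W)\<^sup>2)))}"
    by (simp add: g)
  then show ?thesis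
    using truncated_modulus_sum_tail[of ?I "{1..n}" "4 * (n * p)" "b 1" "b \<i>" T B] norm np T B by simp
qed

lemma borel_measurable_noise_row [measurable]:
  "j \<in> {1..n} \<Longrightarrow> (\<lambda>W. Im (noise_row n A zs W j)) \<in> borel_measurable (noise_law (index_pairs n))"
  "j \<in> {1..n} \<Longrightarrow> (\<lambda>W. cmod (noise_row n A zs W j)) \<in> borel_measurable (noise_law (index_pairs n))"
proof -
  assume j: "j \<in> {1..n}"
  let ?L = "\<lambda>w. lin_form (index_pairs n) (noise_coef A zs (\<lambda>l. of_bool (l = j) * w) (\<lambda>_. 1))"
  have Im: "(\<lambda>W. Im (noise_row n A zs W j)) = ?L \<i>" and Re: "(\<lambda>W. Re (noise_row n A zs W j)) = ?L 1"
    using noise_row_component[OF j, of \<i>] noise_row_component[OF j, of 1] by (auto simp: fun_eq_iff)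
  show "(\<lambda>W. Im (noise_row n A zs W j)) \<in> borel_measurable (noise_law (index_pairs n))"
    unfolding Im by measurable
  have "(\<lambda>W. cmod (noise_row n A zs W j)) = (\<lambda>W. sqrt ((?L 1 W)\<^sup>2 + (?L \<i> W)\<^sup>2))"
    unfolding cmod_def using Im Re by (auto simp: fun_eq_iff)
  then show "(\<lambda>W. cmod (noise_row n A zs W j)) \<in> borel_measurable (noise_law (index_pairs n))" by simp
qed

section \<open>Maximizers of the alignment\<close>

definition data_matrix :: "real \<Rightarrow> (nat \<times> nat \<Rightarrow> bool) \<Rightarrow> (nat \<Rightarrow> complex) \<Rightarrow> (nat \<times> nat \<Rightarrow> complex) \<Rightarrow> nat \<Rightarrow> nat \<Rightarrow> complex" where
  "data_matrix \<sigma> A zs W j k = of_real (adj A j k) + of_real \<sigma> * noise A zs W j k"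

lemma noise_hermitian: "noise A zs W k j = cnj (noise A zs W j k)"
  by (cases j k rule: linorder_cases) (auto simp: noise_def adj_def)

lemma data_matrix_hermitian: "data_matrix \<sigma> A zs W k j = cnj (data_matrix \<sigma> A zs W j k)"
  by (simp add: data_matrix_def adj_sym[of A k j] noise_hermitian[of A zs W k j])

lemma data_matrix_diag [simp]: "data_matrix \<sigma> A zs W j j = 0"
  by (simp add: data_matrix_def noise_def)

text \<open>The real number \<open>w\<^sup>* M w\<close>. Minimizing the sum of squares over phase vectors amounts to maximizing it.\<close>

definition alignment :: "nat \<Rightarrow> (nat \<Rightarrow> nat \<Rightarrow> complex) \<Rightarrow> (nat \<Rightarrow> complex) \<Rightarrow> real" where
  "alignment n M w = (\<Sum>j=1..n. \<Sum>k=1..n. Re (cnj (w j) * M j k * w k))"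

text \<open>All \<open>|z\<^sub>j conj (z\<^sub>k)|\<close> are 1, so that only the cross terms of the squares depend on \<open>w\<close>. The global phase \<open>a\<close> cancels.\<close>

lemma sync_objective_eq_alignment:
  assumes zs: "\<And>j. j \<in> {1..n} \<Longrightarrow> cmod (zs j) = 1" and w: "\<And>j. j \<in> {1..n} \<Longrightarrow> cmod (w j) = 1"
    and a: "cmod a = 1"
  shows "sync_objective n A (observation \<sigma> zs W) (\<lambda>j\<in>{1..n}. zs j * w j * a) =
    (\<Sum>e\<in>index_pairs n. of_bool (A e) * ((cmod (observation \<sigma> zs W e))\<^sup>2 + 1)) - alignment n (data_matrix \<sigma> A zs W) w"
proof -
  let ?M = "data_matrix \<sigma> A zs W" and ?Y = "observation \<sigma> zs W"
  have unit: "z * cnj z = 1" if "cmod z = 1" for z using that by (simp add: complex_norm_square[symmetric])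
  have "alignment n ?M w = (\<Sum>(j, k)\<in>index_pairs n. Re (cnj (w j) * ?M j k * w k) + Re (cnj (w k) * ?M k j * w j))"
    unfolding alignment_def by (rule sum_square_eq_sum_pairs) simp
  also have "\<dots> = (\<Sum>(j, k)\<in>index_pairs n. 2 * Re (cnj (w j) * ?M j k * w k))"
  proof (intro sum.cong refl, clarify)
    fix j k
    have "cnj (w k) * ?M k j * w j = cnj (cnj (w j) * ?M j k * w k)"
      by (simp add: data_matrix_hermitian[of \<sigma> A zs W k j] mult_ac)
    then show "Re (cnj (w j) * ?M j k * w k) + Re (cnj (w k) * ?M k j * w j) = 2 * Re (cnj (w j) * ?M j k * w k)"
      by (simp only: cnj.simps(1))
  qed
  finally have al: "alignment n ?M w = (\<Sum>(j, k)\<in>index_pairs n. 2 * Re (cnj (w j) * ?M j k * w k))" .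
  have "sync_objective n A ?Y (\<lambda>j\<in>{1..n}. zs j * w j * a) =
     (\<Sum>(j, k)\<in>index_pairs n. of_bool (A (j, k)) * ((cmod (?Y (j, k)))\<^sup>2 + 1) - 2 * Re (cnj (w j) * ?M j k * w k))"
    unfolding sync_objective_def
  proof (intro sum.cong refl, clarify)
    fix j k assume e: "(j, k) \<in> index_pairs n"
    then have jk: "j < k" "j \<in> {1..n}" "k \<in> {1..n}" by (auto simp: index_pairs_def)
    note u = unit[OF zs[OF jk(2)]] unit[OF zs[OF jk(3)]] unit[OF a]
    define q where "q = zs j * cnj (zs k) * (w j * cnj (w k))"
    have z: "(\<lambda>j\<in>{1..n}. zs j * w j * a) j * cnj ((\<lambda>j\<in>{1..n}. zs j * w j * a) k) = q"
    proof -
      have "zs j * w j * a * cnj (zs k * w k * a) = q * (a * cnj a)" by (simp add: q_def mult_ac)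
      then show ?thesis using jk u by simp
    qed
    have q1: "cmod q = 1" using zs w jk by (simp add: q_def norm_mult)
    have expand: "(cmod (?Y (j, k) - q))\<^sup>2 = (cmod (?Y (j, k)))\<^sup>2 + 1 - 2 * Re (?Y (j, k) * cnj q)"
    proof -
      have "(cmod (?Y (j, k) - q))\<^sup>2 = (cmod (?Y (j, k)))\<^sup>2 + (cmod q)\<^sup>2 - 2 * Re (?Y (j, k) * cnj q)"
        unfolding cmod_power2 by (simp add: power2_eq_square algebra_simps)
      then show ?thesis using q1 by simp
    qed
    have cross: "of_bool (A (j, k)) * Re (?Y (j, k) * cnj q) = Re (cnj (w j) * ?M j k * w k)"
    proof (cases "A (j, k)")
      case True
      have "?Y (j, k) * cnj q = cnj (w j) * w k * ((zs j * cnj (zs j)) * (zs k * cnj (zs k)) + of_real \<sigma> * (cnj (zs j) * zs k * W (j, k)))"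
        by (simp add: observation_def q_def algebra_simps)
      also have "\<dots> = cnj (w j) * ?M j k * w k"
        using True jk u by (simp add: data_matrix_def noise_def adj_def algebra_simps)
      finally show ?thesis using True by simp
    next
      case False
      then have "?M j k = 0" using jk by (simp add: data_matrix_def noise_def adj_def)
      then show ?thesis using False by simp
    qed
    show "of_bool (A (j, k)) * (cmod (?Y (j, k) - (\<lambda>j\<in>{1..n}. zs j * w j * a) j * cnj ((\<lambda>j\<in>{1..n}. zs j * w j * a) k)))\<^sup>2
       = of_bool (A (j, k)) * ((cmod (?Y (j, k)))\<^sup>2 + 1) - 2 * Re (cnj (w j) * ?M j k * w k)"
      unfolding z expand cross[symmetric] by (simp only: right_diff_distrib mult.left_commute)
  qed
  also have "\<dots> = (\<Sum>e\<in>index_pairs n. of_bool (A e) * ((cmod (?Y e))\<^sup>2 + 1)) - alignment n ?M w"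
    unfolding al by (simp add: case_prod_unfold sum_subtractf)
  finally show ?thesis .
qed

text \<open>The alignment is affine in each single coordinate; this isolates the part that depends on \<open>w\<^sub>j\<close>.\<close>

lemma alignment_split:
  assumes herm: "\<And>i k. M k i = cnj (M i k)" and diag: "M j j = 0" and j: "j \<in> {1..n}"
  shows "alignment n M w = 2 * Re (cnj (w j) * (\<Sum>k\<in>{1..n} - {j}. M j k * w k)) +
    (\<Sum>i\<in>{1..n} - {j}. \<Sum>k\<in>{1..n} - {j}. Re (cnj (w i) * M i k * w k))"
proof -
  let ?G = "\<lambda>i k. Re (cnj (w i) * M i k * w k)" and ?V = "{1..n} - {j}"
  have sym: "?G i j = ?G j i" for i
  proof -
    have "cnj (w i) * M i j * w j = cnj (cnj (w j) * M j i * w i)" using herm[of i j] by (simp add: mult_ac)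
    then show ?thesis by (simp only: cnj.simps(1))
  qed
  have split: "(\<Sum>k=1..n. f k) = f j + (\<Sum>k\<in>?V. f k)" for f :: "nat \<Rightarrow> real"
    using j by (simp add: sum.remove)
  have "alignment n M w = (\<Sum>k\<in>?V. ?G j k) + ((\<Sum>i\<in>?V. ?G i j) + (\<Sum>i\<in>?V. \<Sum>k\<in>?V. ?G i k))"
    unfolding alignment_def split using diag by (simp add: sum.distrib)
  also have "(\<Sum>i\<in>?V. ?G i j) = (\<Sum>k\<in>?V. ?G j k)" by (intro sum.cong refl sym)
  finally show ?thesis by (simp add: sum_distrib_left mult.assoc Re_sum del: times_complex.simps)
qed

text \<open>Replacing the single phase \<open>u\<^sub>j\<close> by \<open>v / |v|\<close> changes the alignment by \<open>2 |v| - 2 Re (conj (u\<^sub>j) v)\<close>. Maximality forces equality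
  in \<open>Re (conj (u\<^sub>j) v) \<le> |v|\<close>.\<close>

lemma alignment_max_imp_fixed_point:
  assumes herm: "\<And>i k. M k i = cnj (M i k)" and diag: "\<And>i. M i i = 0" and j: "j \<in> {1..n}"
    and u: "\<And>j. j \<in> {1..n} \<Longrightarrow> cmod (u j) = 1"
    and max: "\<And>w. (\<And>j. j \<in> {1..n} \<Longrightarrow> cmod (w j) = 1) \<Longrightarrow> alignment n M w \<le> alignment n M u"
  defines "v \<equiv> \<Sum>k=1..n. M j k * u k"
  shows "v = of_real (cmod v) * u j"
proof (cases "v = 0")
  case False
  define b where "b = v / of_real (cmod v)"
  have b: "cmod b = 1" using False by (simp add: b_def norm_divide)
  have v: "v = (\<Sum>k\<in>{1..n} - {j}. M j k * u k)"
    unfolding v_def using j diag by (simp add: sum.remove)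
  define rest where "rest = (\<Sum>i\<in>{1..n} - {j}. \<Sum>k\<in>{1..n} - {j}. Re (cnj (u i) * M i k * u k))"
  have "(\<Sum>k\<in>{1..n} - {j}. M j k * (u(j := b)) k) = v" unfolding v by (intro sum.cong) auto
  moreover have "(\<Sum>i\<in>{1..n} - {j}. \<Sum>k\<in>{1..n} - {j}. Re (cnj ((u(j := b)) i) * M i k * (u(j := b)) k)) = rest"
    unfolding rest_def by (intro sum.cong) auto
  ultimately have "alignment n M (u(j := b)) = 2 * Re (cnj b * v) + rest"
    using alignment_split[of M, OF herm diag j, of "u(j := b)"] by (simp only: fun_upd_same)
  moreover have "alignment n M u = 2 * Re (cnj (u j) * v) + rest"
    unfolding v rest_def by (rule alignment_split[of M, OF herm diag j])
  moreover have "alignment n M (u(j := b)) \<le> alignment n M u" using u b by (intro max) auto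
  ultimately have le: "Re (cnj b * v) \<le> Re (cnj (u j) * v)" by linarith
  have "cnj b * v = of_real (cmod v)"
    using False complex_norm_square[of v] by (simp add: b_def power2_eq_square mult.commute divide_eq_eq)
  then have "cmod v \<le> Re (cnj (u j) * v)" using le by simp
  moreover have "cmod (cnj (u j) * v) = cmod v" using u[OF j] by (simp add: norm_mult)
  ultimately have "cnj (u j) * v = of_real (cmod v)"
    using complex_Re_le_cmod[of "cnj (u j) * v"] cmod_eq_Re[of "cnj (u j) * v"]
    by (smt (verit) cmod_power2 complex_eq_iff Re_complex_of_real Im_complex_of_real zero_eq_power2)
  then have "u j * (cnj (u j) * v) = u j * of_real (cmod v)" by (simp only:)
  then have "u j * cnj (u j) * v = u j * of_real (cmod v)" by (simp only: mult.assoc)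
  moreover have "u j * cnj (u j) = 1" using u[OF j] complex_norm_square[of "u j"] by simp
  ultimately have "v = u j * of_real (cmod v)" by (simp only: mult_1_left)
  then show ?thesis by (simp only: mult.commute)
qed simp

text \<open>The summand \<open>i Im(u) u\<close> is tangent to the circle at \<open>u\<close> and contributes \<open>- (Im u)\<^sup>2 = - |x|\<^sup>2 + |x|\<^sup>4 / 4\<close> to the real part.
  The multiple of \<open>x\<close> corrects it to exactly \<open>- |x|\<^sup>2\<close>, and stays in the half-plane of \<open>u\<close> because \<open>Re (conj x u) = |x|\<^sup>2 / 2\<close>. The
  exact value matters for phases far from 1, such as \<open>u = - 1\<close>, where the tangent vanishes.\<close>

lemma tangent_test_vector:
  fixes u :: complex
  assumes u: "cmod u = 1"
  defines "x \<equiv> u - 1" 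
  defines "\<tau> \<equiv> \<i> * of_real (Im u) * u + of_real ((cmod x)\<^sup>2 / 2) * x"
  shows "Re \<tau> = - (cmod x)\<^sup>2" "0 \<le> Re (cnj \<tau> * u)" "cmod \<tau> \<le> 3 * cmod x"
    "cmod (\<tau> - \<i> * of_real (Im u)) \<le> 2 * (cmod x)\<^sup>2" "cmod x \<le> 2" "\<bar>Im u\<bar> \<le> cmod x"
    "(cmod x)\<^sup>2 = 2 - 2 * Re u"
proof -
  define a b where "a = Re u" and "b = Im u"
  have ab: "a\<^sup>2 + b\<^sup>2 = 1" using u cmod_power2[of u] by (simp add: a_def b_def)
  have ueq: "u = Complex a b" by (simp add: a_def b_def)
  have x2: "(cmod x)\<^sup>2 = 2 - 2 * a"
  proof -
    have "(cmod x)\<^sup>2 = (a - 1)\<^sup>2 + b\<^sup>2" unfolding cmod_power2 x_def a_def b_def by simp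
    also have "\<dots> = (a\<^sup>2 + b\<^sup>2) + 1 - 2 * a" by (simp add: power2_eq_square algebra_simps)
    finally show ?thesis using ab by simp
  qed
  then show x2': "(cmod x)\<^sup>2 = 2 - 2 * Re u" by (simp add: a_def)
  have b2: "b * b = 1 - a * a" using ab by (simp add: power2_eq_square)
  have \<tau>: "\<tau> = \<i> * of_real b * u + of_real (1 - a) * x" unfolding \<tau>_def x2 b_def by simp
  have "Re \<tau> = - (2 - 2 * a)" unfolding \<tau> x_def ueq using b2 by (simp add: algebra_simps)
  then show "Re \<tau> = - (cmod x)\<^sup>2" using x2 by simp
  have "Re (cnj \<tau> * u) = (1 - a) * (1 - a)"
  proof -
    have "Re (cnj \<tau> * u) = (1 - a) * (a * a + b * b - a)" unfolding \<tau> x_def ueq by (simp add: algebra_simps)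
    then show ?thesis using b2 by simp
  qed
  then show "0 \<le> Re (cnj \<tau> * u)" by simp
  show x_le: "cmod x \<le> 2" unfolding x_def using norm_triangle_ineq4[of u 1] u by simp
  show Im_le: "\<bar>Im u\<bar> \<le> cmod x" using abs_Im_le_cmod[of x] by (simp add: x_def)
  have "cmod \<tau> \<le> cmod (\<i> * of_real (Im u) * u) + cmod (of_real ((cmod x)\<^sup>2 / 2) * x)" unfolding \<tau>_def by (rule norm_triangle_ineq)
  also have "\<dots> = \<bar>Im u\<bar> + (cmod x * cmod x / 2) * cmod x" using u by (simp add: norm_mult power2_eq_square)
  also have "\<dots> \<le> cmod x + (2 * 2 / 2) * cmod x"
    using Im_le x_le by (intro add_mono mult_right_mono divide_right_mono mult_mono) auto
  finally show "cmod \<tau> \<le> 3 * cmod x" by simp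
  have "\<tau> - \<i> * of_real (Im u) = \<i> * of_real (Im u) * x + of_real ((cmod x)\<^sup>2 / 2) * x"
    by (simp add: \<tau>_def x_def algebra_simps)
  then have "cmod (\<tau> - \<i> * of_real (Im u)) \<le> cmod (\<i> * of_real (Im u) * x) + cmod (of_real ((cmod x)\<^sup>2 / 2) * x)"
    by (simp only: norm_triangle_ineq)
  also have "\<dots> = \<bar>Im u\<bar> * cmod x + (cmod x / 2) * (cmod x * cmod x)" by (simp add: norm_mult power2_eq_square)
  also have "\<dots> \<le> cmod x * cmod x + (2 / 2) * (cmod x * cmod x)"
    using Im_le x_le by (intro add_mono mult_right_mono divide_right_mono) auto
  finally show "cmod (\<tau> - \<i> * of_real (Im u)) \<le> 2 * (cmod x)\<^sup>2" by (simp add: power2_eq_square)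
qed

lemma near_regular_complex_form:
  assumes reg: "near_regular n p \<theta> A" and \<theta>: "0 \<le> \<theta>"
    and f: "(\<Sum>j=1..n. (cmod (f j))\<^sup>2) \<le> F\<^sup>2" "0 \<le> F" and g: "(\<Sum>j=1..n. (cmod (g j))\<^sup>2) \<le> G\<^sup>2" "0 \<le> G"
  shows "\<bar>\<Sum>j=1..n. \<Sum>k=1..n. adj_dev p A j k * Re (cnj (f j) * g k)\<bar> \<le> 2 * \<theta> * F * G"
proof -
  have part: "\<bar>\<Sum>j=1..n. \<Sum>k=1..n. adj_dev p A j k * a j * b k\<bar> \<le> \<theta> * F * G"
    if "\<And>j. \<bar>a j\<bar> \<le> cmod (f j)" "\<And>j. \<bar>b j\<bar> \<le> cmod (g j)" for a b :: "nat \<Rightarrow> real"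
  proof -
    have "\<bar>\<Sum>j=1..n. \<Sum>k=1..n. adj_dev p A j k * a j * b k\<bar> \<le> \<theta> * sqrt (\<Sum>j=1..n. (a j)\<^sup>2) * sqrt (\<Sum>j=1..n. (b j)\<^sup>2)"
      using reg unfolding near_regular_def by blast
    also have "\<dots> \<le> \<theta> * F * G"
    proof (intro mult_mono)
      have "(\<Sum>j=1..n. (a j)\<^sup>2) \<le> (\<Sum>j=1..n. (cmod (f j))\<^sup>2)" using that by (intro sum_mono) (simp add: abs_le_square_iff[symmetric])
      then show "sqrt (\<Sum>j=1..n. (a j)\<^sup>2) \<le> F" using f by (intro real_le_lsqrt) auto
      have "(\<Sum>j=1..n. (b j)\<^sup>2) \<le> (\<Sum>j=1..n. (cmod (g j))\<^sup>2)" using that by (intro sum_mono) (simp add: abs_le_square_iff[symmetric])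
      then show "sqrt (\<Sum>j=1..n. (b j)\<^sup>2) \<le> G" using g by (intro real_le_lsqrt) auto
    qed (use \<theta> f g in \<open>auto intro: sum_nonneg\<close>)
    finally show ?thesis .
  qed
  have "(\<Sum>j=1..n. \<Sum>k=1..n. adj_dev p A j k * Re (cnj (f j) * g k)) =
      (\<Sum>j=1..n. \<Sum>k=1..n. adj_dev p A j k * Re (f j) * Re (g k)) + (\<Sum>j=1..n. \<Sum>k=1..n. adj_dev p A j k * Im (f j) * Im (g k))"
    by (simp add: sum.distrib[symmetric] algebra_simps)
  then show ?thesis
    using part[of "\<lambda>j. Re (f j)" "\<lambda>j. Re (g j)"] part[of "\<lambda>j. Im (f j)" "\<lambda>j. Im (g j)"]
      abs_Re_le_cmod abs_Im_le_cmod by (simp add: abs_le_iff)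
qed

lemma adj_eq_dev: "adj A j k = p + adj_dev p A j k - of_bool (j = k) * p"
  by (simp add: adj_dev_def)

lemma sum_adj_form:
  fixes f :: "nat \<Rightarrow> nat \<Rightarrow> real"
  shows "(\<Sum>j=1..n. \<Sum>k=1..n. adj A j k * f j k) =
    p * (\<Sum>j=1..n. \<Sum>k=1..n. f j k) + (\<Sum>j=1..n. \<Sum>k=1..n. adj_dev p A j k * f j k) - p * (\<Sum>j=1..n. f j j)"
proof -
  have "(\<Sum>j=1..n. \<Sum>k=1..n. of_bool (j = k) * (p * f j k)) = (\<Sum>j=1..n. p * f j j)"
    by (intro sum.cong refl sum_of_bool_eq_mult) auto
  then show ?thesis
    by (subst adj_eq_dev[where p = p])
      (simp add: distrib_right left_diff_distrib sum.distrib sum_subtractf mult.assoc sum_distrib_left)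
qed

text \<open>The conditions \<open>Re (conj \<tau>\<^sub>j (M u)\<^sub>j) \<ge> 0\<close> are summed over \<open>j\<close>. The mean \<open>p J\<close> of the graph contributes \<open>- p s L\<close> because
  \<open>\<Sum>\<^sub>k u\<^sub>k = s\<close> is real; the diagonal correction has the right sign. In the deviation from the mean the constant part
  of \<open>u = 1 + x\<close> meets only row sums, weighted by \<open>Re \<tau>\<^sub>j = - |x\<^sub>j|\<^sup>2\<close>, so that both parts are \<open>O(\<theta> L)\<close>.\<close>

lemma fixed_point_inequality:
  fixes u :: "nat \<Rightarrow> complex"
  assumes reg: "near_regular n p \<theta> A" and \<theta>: "0 \<le> \<theta>" and p: "0 \<le> p" and \<sigma>: "0 \<le> \<sigma>"
    and u: "\<And>j. j \<in> {1..n} \<Longrightarrow> cmod (u j) = 1" and s: "(\<Sum>j=1..n. u j) = of_real s"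
    and fixed: "\<And>j. j \<in> {1..n} \<Longrightarrow> \<exists>c\<ge>0. (\<Sum>k=1..n. data_matrix \<sigma> A zs W j k * u k) = of_real c * u j"
  defines "x \<equiv> \<lambda>j. u j - 1"
  defines "\<tau> \<equiv> \<lambda>j. \<i> * of_real (Im (u j)) * u j + of_real ((cmod (x j))\<^sup>2 / 2) * x j"
  defines "L \<equiv> \<Sum>j=1..n. (cmod (x j))\<^sup>2"
  shows "p * s * L \<le> 7 * \<theta> * L + \<sigma> * ((\<Sum>j=1..n. Im (u j) * Im (noise_row n A zs W j)) +
     2 * (\<Sum>j=1..n. (cmod (x j))\<^sup>2 * cmod (noise_row n A zs W j)) + noise_form n A zs W \<tau> x)"
proof -
  have tv: "Re (\<tau> j) = - (cmod (x j))\<^sup>2" "0 \<le> Re (cnj (\<tau> j) * u j)" "cmod (\<tau> j) \<le> 3 * cmod (x j)"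
      "cmod (\<tau> j - \<i> * of_real (Im (u j))) \<le> 2 * (cmod (x j))\<^sup>2" if "j \<in> {1..n}" for j
    using tangent_test_vector(1-4)[OF u[OF that]] unfolding \<tau>_def x_def by blast+
  let ?g = "noise_row n A zs W"
  have L0: "0 \<le> L" unfolding L_def by (intro sum_nonneg) auto
  have Lsq: "(sqrt L)\<^sup>2 = L" using L0 by simp
  have \<tau>sq: "(\<Sum>j=1..n. (cmod (\<tau> j))\<^sup>2) \<le> (3 * sqrt L)\<^sup>2"
  proof -
    have "(\<Sum>j=1..n. (cmod (\<tau> j))\<^sup>2) \<le> (\<Sum>j=1..n. 9 * (cmod (x j))\<^sup>2)"
    proof (rule sum_mono)
      fix j assume "j \<in> {1..n}"
      then have "(cmod (\<tau> j))\<^sup>2 \<le> (3 * cmod (x j))\<^sup>2" using tv(3) by (intro power_mono) auto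
      then show "(cmod (\<tau> j))\<^sup>2 \<le> 9 * (cmod (x j))\<^sup>2" by (simp add: power_mult_distrib)
    qed
    then show ?thesis using Lsq by (simp add: L_def sum_distrib_left power_mult_distrib)
  qed
  have "0 \<le> (\<Sum>j=1..n. Re (cnj (\<tau> j) * (\<Sum>k=1..n. data_matrix \<sigma> A zs W j k * u k)))"
  proof (rule sum_nonneg)
    fix j assume j: "j \<in> {1..n}"
    obtain c where c: "0 \<le> c" "(\<Sum>k=1..n. data_matrix \<sigma> A zs W j k * u k) = of_real c * u j" using fixed[OF j] by auto
    have "Re (cnj (\<tau> j) * (of_real c * u j)) = c * Re (cnj (\<tau> j) * u j)" by (simp add: algebra_simps)
    then show "0 \<le> Re (cnj (\<tau> j) * (\<Sum>k=1..n. data_matrix \<sigma> A zs W j k * u k))"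
      unfolding c(2) using c(1) tv(2)[OF j] by simp
  qed
  also have "\<dots> = (\<Sum>j=1..n. \<Sum>k=1..n. adj A j k * Re (cnj (\<tau> j) * u k)) +
      \<sigma> * (\<Sum>j=1..n. \<Sum>k=1..n. Re (cnj (\<tau> j) * noise A zs W j k * u k))"
  proof -
    have "Re (cnj (\<tau> j) * (\<Sum>k=1..n. data_matrix \<sigma> A zs W j k * u k)) =
        (\<Sum>k=1..n. adj A j k * Re (cnj (\<tau> j) * u k) + \<sigma> * Re (cnj (\<tau> j) * noise A zs W j k * u k))" for j
      unfolding sum_distrib_left Re_sum by (intro sum.cong refl) (simp add: data_matrix_def algebra_simps)
    then show ?thesis by (simp add: sum.distrib sum_distrib_left)
  qed
  also have "(\<Sum>j=1..n. \<Sum>k=1..n. adj A j k * Re (cnj (\<tau> j) * u k)) \<le> - (p * s * L) + 7 * \<theta> * L"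
  proof -
    have Re\<tau>: "(\<Sum>j=1..n. Re (\<tau> j)) = - L" using tv(1) by (simp add: L_def sum_negf)
    have "(\<Sum>j=1..n. \<Sum>k=1..n. Re (cnj (\<tau> j) * u k)) = (\<Sum>j=1..n. Re (cnj (\<tau> j) * of_real s))"
      by (simp only: s[symmetric] sum_distrib_left Re_sum)
    also have "\<dots> = - (L * s)" using Re\<tau> by (simp add: sum_distrib_right[symmetric])
    finally have main: "(\<Sum>j=1..n. \<Sum>k=1..n. Re (cnj (\<tau> j) * u k)) = - (L * s)" .
    have "(\<Sum>j=1..n. \<Sum>k=1..n. adj_dev p A j k * Re (cnj (\<tau> j) * u k)) =
        (\<Sum>j=1..n. Re (\<tau> j) * (\<Sum>k=1..n. adj_dev p A j k)) + (\<Sum>j=1..n. \<Sum>k=1..n. adj_dev p A j k * Re (cnj (\<tau> j) * x k))"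
      by (simp add: x_def sum_distrib_left sum.distrib[symmetric] algebra_simps)
    also have "(\<Sum>j=1..n. Re (\<tau> j) * (\<Sum>k=1..n. adj_dev p A j k)) \<le> (\<Sum>j=1..n. (cmod (x j))\<^sup>2 * \<theta>)"
    proof (rule sum_mono)
      fix j assume j: "j \<in> {1..n}"
      have "\<bar>\<Sum>k=1..n. adj_dev p A j k\<bar> \<le> \<theta>" using reg j unfolding near_regular_def by blast
      then have "(cmod (x j))\<^sup>2 * (- (\<Sum>k=1..n. adj_dev p A j k)) \<le> (cmod (x j))\<^sup>2 * \<theta>"
        by (intro mult_left_mono) auto
      then show "Re (\<tau> j) * (\<Sum>k=1..n. adj_dev p A j k) \<le> (cmod (x j))\<^sup>2 * \<theta>" using tv(1)[OF j] by simp
    qed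
    also have "\<dots> = \<theta> * L" by (simp add: L_def sum_distrib_left mult.commute)
    also have "(\<Sum>j=1..n. \<Sum>k=1..n. adj_dev p A j k * Re (cnj (\<tau> j) * x k)) \<le> 6 * \<theta> * L"
    proof -
      have "\<bar>\<Sum>j=1..n. \<Sum>k=1..n. adj_dev p A j k * Re (cnj (\<tau> j) * x k)\<bar> \<le> 2 * \<theta> * (3 * sqrt L) * sqrt L"
        using \<tau>sq L0 by (intro near_regular_complex_form[OF reg \<theta>]) (auto simp: L_def)
      also have "\<dots> = 6 * \<theta> * L" using L0 by (simp add: mult.assoc)
      finally show ?thesis by linarith
    qed
    finally have dev: "(\<Sum>j=1..n. \<Sum>k=1..n. adj_dev p A j k * Re (cnj (\<tau> j) * u k)) \<le> 7 * \<theta> * L" by linarith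
    have "0 \<le> p * (\<Sum>j=1..n. Re (cnj (\<tau> j) * u j))" using p tv(2) by (intro mult_nonneg_nonneg sum_nonneg) auto
    moreover have "p * - (L * s) = - (p * s * L)" by simp
    ultimately show ?thesis unfolding sum_adj_form[where p = p] main using dev by linarith
  qed
  also have "(\<Sum>j=1..n. \<Sum>k=1..n. Re (cnj (\<tau> j) * noise A zs W j k * u k)) =
      (\<Sum>j=1..n. Re (cnj (\<tau> j) * ?g j)) + noise_form n A zs W \<tau> x"
    unfolding noise_form_def noise_row_def sum_distrib_left Re_sum sum.distrib[symmetric]
    by (intro sum.cong refl) (simp add: x_def algebra_simps)
  also have "(\<Sum>j=1..n. Re (cnj (\<tau> j) * ?g j)) \<le> (\<Sum>j=1..n. Im (u j) * Im (?g j) + 2 * ((cmod (x j))\<^sup>2 * cmod (?g j)))"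
  proof (rule sum_mono)
    fix j assume j: "j \<in> {1..n}"
    define d where "d = \<tau> j - \<i> * of_real (Im (u j))"
    have "Re (cnj (\<tau> j) * ?g j) = Im (u j) * Im (?g j) + Re (cnj d * ?g j)" by (simp add: d_def algebra_simps)
    also have "Re (cnj d * ?g j) \<le> cmod d * cmod (?g j)" using complex_Re_le_cmod[of "cnj d * ?g j"] by (simp add: norm_mult)
    also have "\<dots> \<le> 2 * (cmod (x j))\<^sup>2 * cmod (?g j)" using tv(4)[OF j] by (intro mult_right_mono) (auto simp: d_def)
    finally show "Re (cnj (\<tau> j) * ?g j) \<le> Im (u j) * Im (?g j) + 2 * ((cmod (x j))\<^sup>2 * cmod (?g j))" by (simp add: mult.assoc)
  qed
  finally show ?thesis using \<sigma>
    by (simp add: sum.distrib sum_distrib_left[symmetric] add_mono mult_left_mono)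
qed

lemma alignment_data_matrix:
  "alignment n (data_matrix \<sigma> A zs W) w =
    (\<Sum>j=1..n. \<Sum>k=1..n. adj A j k * Re (cnj (w j) * w k)) + \<sigma> * noise_form n A zs W w w"
proof -
  have "Re (cnj (w j) * data_matrix \<sigma> A zs W j k * w k) =
      adj A j k * Re (cnj (w j) * w k) + \<sigma> * Re (cnj (w j) * noise A zs W j k * w k)" for j k
    by (simp add: data_matrix_def algebra_simps)
  then show ?thesis unfolding alignment_def noise_form_def by (simp only: sum.distrib sum_distrib_left)
qed

text \<open>Here \<open>u\<close> is compared with the constant vector 1, that is, with the truth. The mean of the graph loses \<open>p (n\<^sup>2 - s\<^sup>2) \<ge> n p L / 2\<close>, which
  the noise has to make up for. The bound is far from sharp, but it makes \<open>L / n\<close> small, so that \<open>s\<close> can be replaced by \<open>n\<close>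
  in \<open>fixed_point_inequality\<close>.\<close>

lemma a_priori_loss_bound:
  fixes u :: "nat \<Rightarrow> complex"
  assumes reg: "near_regular n p \<theta> A" and \<theta>: "0 \<le> \<theta>" "\<theta> \<le> n * p" and p: "0 < p" and \<sigma>: "0 \<le> \<sigma>" and n: "1 \<le> n"
    and u: "\<And>j. j \<in> {1..n} \<Longrightarrow> cmod (u j) = 1" and s: "(\<Sum>j=1..n. u j) = of_real s" "0 \<le> s"
    and noise: "noise_bounded n p \<theta> A zs W"
    and better: "alignment n (data_matrix \<sigma> A zs W) (\<lambda>_. 1) \<le> alignment n (data_matrix \<sigma> A zs W) u"
  shows "n * p * (\<Sum>j=1..n. (cmod (u j - 1))\<^sup>2) \<le> 6 * \<theta> * n + 600 * \<sigma> * n * sqrt (n * p)"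
proof -
  define L where "L = (\<Sum>j=1..n. (cmod (u j - 1))\<^sup>2)"
  have "L = (\<Sum>j=1..n. 2 - 2 * Re (u j))" unfolding L_def using tangent_test_vector(7)[OF u] by simp
  also have "\<dots> = 2 * n - 2 * Re (\<Sum>j=1..n. u j)" by (simp add: sum_subtractf sum_distrib_left)
  finally have L: "L = 2 * (real n - s)" unfolding s(1) by simp
  have L0: "0 \<le> L" unfolding L_def by (intro sum_nonneg) auto
  have unit2: "(\<Sum>j=1..n. (cmod (u j))\<^sup>2) = n" using u by simp
  have form: "noise_form n A zs W y x \<le> 150 * (n * sqrt (n * p))"
    if "\<And>j. j \<in> {1..n} \<Longrightarrow> cmod (y j) = 1" "\<And>j. j \<in> {1..n} \<Longrightarrow> cmod (x j) = 1" for y x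
  proof -
    have "noise_form n A zs W y x \<le> 100 * sqrt (n * (p * (real n)\<^sup>2 + \<theta> * n))"
      using noise n that unfolding noise_bounded_def by (intro noise[unfolded noise_bounded_def, rule_format]) auto
    also have "sqrt (n * (p * (real n)\<^sup>2 + \<theta> * n)) \<le> sqrt ((3 / 2 * (n * sqrt (n * p)))\<^sup>2)"
    proof (rule real_sqrt_le_mono)
      have "n * (p * (real n)\<^sup>2 + \<theta> * n) = (real n)\<^sup>2 * (n * p + \<theta>)" by (simp add: power2_eq_square algebra_simps)
      also have "\<dots> \<le> (real n)\<^sup>2 * (9 / 4 * (n * p))" using \<theta> by (intro mult_left_mono) (linarith, simp)
      also have "\<dots> = (3 / 2 * (n * sqrt (n * p)))\<^sup>2" using p by (simp add: power_mult_distrib power_divide)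
      finally show "n * (p * (real n)\<^sup>2 + \<theta> * n) \<le> (3 / 2 * (n * sqrt (n * p)))\<^sup>2" .
    qed
    also have "\<dots> = 3 / 2 * (n * sqrt (n * p))" using p by (simp add: abs_mult)
    finally show ?thesis by simp
  qed
  have neg: "- noise_form n A zs W (\<lambda>_. 1) (\<lambda>_. 1) = noise_form n A zs W (\<lambda>_. -1) (\<lambda>_. 1)"
    by (simp add: noise_form_def sum_negf)
  have ones: "(\<Sum>j=1..n. \<Sum>k=1..n. adj A j k * Re (cnj 1 * 1)) =
      p * (real n * n) + (\<Sum>j=1..n. \<Sum>k=1..n. adj_dev p A j k * 1) - p * n"
    using sum_adj_form[where p = p and A = A and n = n and f = "\<lambda>_ _. 1"] by simp
  have us: "(\<Sum>j=1..n. \<Sum>k=1..n. adj A j k * Re (cnj (u j) * u k)) =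
      p * (s * s) + (\<Sum>j=1..n. \<Sum>k=1..n. adj_dev p A j k * Re (cnj (u j) * u k)) - p * n"
  proof -
    have "(\<Sum>j=1..n. \<Sum>k=1..n. Re (cnj (u j) * u k)) = Re ((\<Sum>j=1..n. cnj (u j)) * (\<Sum>k=1..n. u k))"
      unfolding sum_product Re_sum ..
    also have "\<dots> = s * s"
    proof -
      have "(\<Sum>j=1..n. cnj (u j)) = of_real s" using s(1) by (metis cnj_sum complex_cnj_complex_of_real)
      then show ?thesis unfolding s(1) by simp
    qed
    finally have "(\<Sum>j=1..n. \<Sum>k=1..n. Re (cnj (u j) * u k)) = s * s" .
    moreover have "(\<Sum>j=1..n. Re (cnj (u j) * u j)) = n"
    proof -
      have "Re (cnj (u j) * u j) = 1" if "j \<in> {1..n}" for j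
        using u[OF that] complex_norm_square[of "u j"] by (simp only: mult.commute[of "cnj (u j)"]) (metis Re_complex_of_real of_real_1 one_power2 of_real_power)
      then show ?thesis by simp
    qed
    ultimately show ?thesis unfolding sum_adj_form[where p = p] by simp
  qed
  have dev: "\<bar>\<Sum>j=1..n. \<Sum>k=1..n. adj_dev p A j k * Re (cnj (u j) * u k)\<bar> \<le> 2 * \<theta> * n"
  proof -
    have "\<bar>\<Sum>j=1..n. \<Sum>k=1..n. adj_dev p A j k * Re (cnj (u j) * u k)\<bar> \<le> 2 * \<theta> * sqrt n * sqrt n"
      using \<theta> by (intro near_regular_complex_form[OF reg]) (use unit2 in auto)
    then show ?thesis by (simp add: mult.assoc)
  qed
  have dev1: "\<bar>\<Sum>j=1..n. \<Sum>k=1..n. adj_dev p A j k * 1\<bar> \<le> \<theta> * n"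
  proof -
    have "\<bar>\<Sum>j=1..n. \<Sum>k=1..n. adj_dev p A j k * 1\<bar> \<le> (\<Sum>j=1..n. \<bar>\<Sum>k=1..n. adj_dev p A j k * 1\<bar>)" by (rule sum_abs)
    also have "\<dots> \<le> (\<Sum>j=1..n. \<theta>)" using reg unfolding near_regular_def by (intro sum_mono) simp
    finally show ?thesis by (simp add: mult.commute)
  qed
  have "p * (real n * n - s * s) \<le> 3 * \<theta> * n + \<sigma> * (noise_form n A zs W u u + noise_form n A zs W (\<lambda>_. -1) (\<lambda>_. 1))"
    using better dev dev1 unfolding alignment_data_matrix ones us neg[symmetric]
    by (simp add: right_diff_distrib distrib_left)
  also have "\<dots> \<le> 3 * \<theta> * n + \<sigma> * (150 * (n * sqrt (n * p)) + 150 * (n * sqrt (n * p)))"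
    using u \<sigma> by (intro add_left_mono mult_left_mono add_mono form) auto
  finally have upper: "p * (real n * n - s * s) \<le> 3 * \<theta> * n + 300 * (\<sigma> * n * sqrt (n * p))" by (simp add: mult_ac)
  have "s \<le> n" using L L0 by simp
  then have "s * s \<le> n * s" using s(2) by (intro mult_right_mono) auto
  then have "p * (n * (real n - s)) \<le> p * (real n * n - s * s)" using p by (intro mult_left_mono) (auto simp: right_diff_distrib)
  then show ?thesis using upper unfolding L_def[symmetric] L by (simp add: algebra_simps)
qed

text \<open>With \<open>R = \<sigma>\<^sup>2 / p\<close> and \<open>N = n p\<close> the net bound at scale \<open>r\<close> consists of \<open>\<sigma> sqrt N r \<le> \<epsilon> N r\<close> and
  \<open>\<sigma> sqrt (n \<theta> r) \<le> sqrt \<kappa> \<epsilon> N sqrt (R r)\<close>, the latter because \<open>n \<sigma>\<^sup>2 = N R\<close>; the square root is where the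
  fourth root in the definition of \<open>\<epsilon>\<close> is needed. If \<open>L + R \<ge> 1\<close>, rounding \<open>L\<close> up to an integer scale costs at most
  a factor 2 relative to \<open>L + R\<close>. Otherwise \<open>x\<close> is scaled to norm 1.\<close>

lemma noise_form_small:
  fixes y x :: "nat \<Rightarrow> complex"
  assumes noise: "noise_bounded n p \<theta> A zs W" and n: "1 \<le> n" and p: "0 < p" and \<sigma>: "0 < \<sigma>"
    and \<epsilon>: "0 < \<epsilon>" "\<epsilon> \<le> 1" and s_le: "\<sigma>\<^sup>2 \<le> \<epsilon> ^ 4 * (n * p)"
    and \<theta>: "0 \<le> \<theta>" "\<theta> \<le> \<kappa> * \<epsilon>\<^sup>2 * (n * p)" and \<kappa>: "0 \<le> \<kappa>"
    and y: "\<And>j. j \<in> {1..n} \<Longrightarrow> cmod (y j) \<le> cmod (x j)" and x: "\<And>j. j \<in> {1..n} \<Longrightarrow> cmod (x j) \<le> 2"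
  defines "L \<equiv> \<Sum>j=1..n. (cmod (x j))\<^sup>2"
  shows "\<sigma> * noise_form n A zs W y x \<le> 200 * (1 + sqrt \<kappa>) * \<epsilon> * (n * p) * (L + \<sigma>\<^sup>2 / p)"
proof -
  define N where "N = n * p"
  define R where "R = \<sigma>\<^sup>2 / p"
  have N: "0 < N" using n p by (simp add: N_def)
  have R: "0 < R" using p \<sigma> by (simp add: R_def)
  have nR: "n * \<sigma>\<^sup>2 = N * R" using p by (simp add: N_def R_def)
  have L0: "0 \<le> L" unfolding L_def by (intro sum_nonneg) auto
  have yL: "(\<Sum>j=1..n. (cmod (y j))\<^sup>2) \<le> L" unfolding L_def using y by (intro sum_mono power_mono) auto
  have s1: "\<sigma> * sqrt N \<le> \<epsilon> * N"
  proof -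
    have "\<sigma>\<^sup>2 \<le> \<epsilon>\<^sup>2 * N"
    proof -
      have "\<epsilon> ^ 4 \<le> \<epsilon>\<^sup>2" using \<epsilon> by (intro power_decreasing) auto
      then have "\<epsilon> ^ 4 * N \<le> \<epsilon>\<^sup>2 * N" using N by (intro mult_right_mono) auto
      then show ?thesis using s_le by (simp add: N_def)
    qed
    then have "\<sigma> \<le> sqrt (\<epsilon>\<^sup>2 * N)" by (rule real_le_rsqrt)
    then have "\<sigma> * sqrt N \<le> (\<epsilon> * sqrt N) * sqrt N"
      using \<epsilon> N by (intro mult_right_mono) (auto simp: real_sqrt_mult)
    then show ?thesis using N by (simp add: mult.assoc)
  qed
  have key: "\<sigma> * sqrt (n * (p * r\<^sup>2 + \<theta> * r)) \<le> (1 + sqrt \<kappa>) * \<epsilon> * N * t"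
    if "0 < r" "r \<le> t" "sqrt (R * r) \<le> t" for r t
  proof -
    have "sqrt (n * (p * r\<^sup>2 + \<theta> * r)) = sqrt (N * r\<^sup>2 + n * \<theta> * r)" by (simp add: N_def algebra_simps)
    also have "\<dots> \<le> sqrt (N * r\<^sup>2) + sqrt (n * \<theta> * r)" using N \<theta> that by (intro sqrt_add_le_add_sqrt) auto
    also have "sqrt (N * r\<^sup>2) = sqrt N * r" using that by (simp add: real_sqrt_mult)
    finally have "\<sigma> * sqrt (n * (p * r\<^sup>2 + \<theta> * r)) \<le> (\<sigma> * sqrt N) * r + \<sigma> * sqrt (n * \<theta> * r)"
      using mult_left_mono[OF _ less_imp_le[OF \<sigma>]] by (simp add: distrib_left[symmetric] mult.assoc)
    also have "(\<sigma> * sqrt N) * r \<le> \<epsilon> * N * t" using that \<epsilon> N by (intro mult_mono[OF s1 that(2)]) auto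
    also have "\<sigma> * sqrt (n * \<theta> * r) \<le> sqrt \<kappa> * \<epsilon> * N * t"
    proof -
      have "\<sigma> * sqrt (n * \<theta> * r) = sqrt (\<sigma>\<^sup>2 * (n * \<theta> * r))" using \<sigma> by (simp add: real_sqrt_mult)
      also have "\<sigma>\<^sup>2 * (n * \<theta> * r) = \<theta> * (N * (R * r))" using nR by (simp add: algebra_simps)
      also have "sqrt \<dots> \<le> sqrt (\<kappa> * \<epsilon>\<^sup>2 * N * (N * (R * r)))"
        using \<theta> N R that by (intro real_sqrt_le_mono mult_right_mono) (auto simp: N_def)
      also have "\<kappa> * \<epsilon>\<^sup>2 * N * (N * (R * r)) = \<kappa> * (\<epsilon> * N)\<^sup>2 * (R * r)" by (simp add: power2_eq_square)
      also have "sqrt \<dots> = sqrt \<kappa> * (\<epsilon> * N) * sqrt (R * r)" using \<epsilon> N by (simp add: real_sqrt_mult)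
      also have "\<dots> \<le> sqrt \<kappa> * (\<epsilon> * N) * t" using \<epsilon> N \<kappa> that by (intro mult_left_mono) auto
      finally show ?thesis by (simp add: mult.assoc)
    qed
    finally show ?thesis by (simp add: algebra_simps)
  qed
  have "\<sigma> * noise_form n A zs W y x \<le> 100 * ((1 + sqrt \<kappa>) * \<epsilon> * N * (2 * (L + R)))"
  proof (cases "1 \<le> L + R")
    case True
    define r where "r = nat \<lceil>max L 1\<rceil>"
    have r1: "1 \<le> r" "L \<le> r" "real r \<le> max L 1 + 1" unfolding r_def by linarith+
    have r_le: "real r \<le> 2 * (L + R)"
    proof (cases "1 < L")
      case False
      then have "r = 1" by (simp add: r_def)
      then show ?thesis using True by simp
    qed (use r1 R in auto)
    have "L \<le> (\<Sum>j=1..n. 2\<^sup>2)" unfolding L_def using x by (intro sum_mono power_mono) auto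
    then have "max L 1 \<le> real_of_int (int (4 * n))" using n by simp
    then have "\<lceil>max L 1\<rceil> \<le> int (4 * n)" unfolding ceiling_le_iff .
    then have r4: "r \<in> {1..4 * n}" using r1 by (auto simp: r_def)
    have "noise_form n A zs W y x \<le> 100 * sqrt (n * (p * (real r)\<^sup>2 + \<theta> * r))"
      using r4 yL r1 x y by (intro noise[unfolded noise_bounded_def, rule_format]) (force simp: L_def)+
    then have "\<sigma> * noise_form n A zs W y x \<le> \<sigma> * (100 * sqrt (n * (p * (real r)\<^sup>2 + \<theta> * r)))"
      using \<sigma> by (intro mult_left_mono) auto
    also have "\<dots> = 100 * (\<sigma> * sqrt (n * (p * (real r)\<^sup>2 + \<theta> * r)))" by simp
    also have "\<dots> \<le> 100 * ((1 + sqrt \<kappa>) * \<epsilon> * N * (2 * (L + R)))"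
    proof (intro mult_left_mono key)
      have "R * r \<le> (2 * (L + R)) * (2 * (L + R))" using r_le R L0 by (intro mult_mono) auto
      then show "sqrt (R * r) \<le> 2 * (L + R)" using R L0 by (intro real_le_lsqrt) (auto simp: power2_eq_square)
    qed (use r1 r_le in auto)
    finally show ?thesis .
  next
    case False
    show ?thesis
    proof (cases "L = 0")
      case True
      then have "x j = 0" if "j \<in> {1..n}" for j
        using that unfolding L_def by (simp add: sum_nonneg_eq_0_iff)
      then have "noise_form n A zs W y x = 0" by (simp add: noise_form_def)
      then show ?thesis using \<kappa> \<epsilon> N R L0 by simp
    next
      case False
      then have L: "0 < L" using L0 by simp
      define c where "c = 1 / sqrt L"
      have c: "0 < c" "c\<^sup>2 = 1 / L" using L by (auto simp: c_def power_divide)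
      let ?y = "\<lambda>j. of_real c * y j" and ?x = "\<lambda>j. of_real c * x j"
      have small: "cmod (?x j) \<le> 2" if j: "j \<in> {1..n}" for j
      proof -
        have "(cmod (x j))\<^sup>2 \<le> L" unfolding L_def using j by (intro member_le_sum) auto
        then have "cmod (x j) \<le> sqrt L" by (rule real_le_rsqrt)
        then have "cmod (?x j) \<le> c * sqrt L" using c by (simp add: norm_mult)
        then show ?thesis using L by (simp add: c_def)
      qed
      have small': "cmod (?y j) \<le> 2" if j: "j \<in> {1..n}" for j
      proof -
        have "cmod (?y j) \<le> cmod (?x j)" using y[OF j] c by (simp add: norm_mult)
        then show ?thesis using small[OF j] by linarith
      qed
      have sc: "(\<Sum>j=1..n. (cmod (of_real c * z j))\<^sup>2) = (\<Sum>j=1..n. (cmod (z j))\<^sup>2) / L" for z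
        by (simp add: norm_mult power_mult_distrib c(2) sum_divide_distrib)
      have "noise_form n A zs W ?y ?x \<le> 100 * sqrt (n * (p * (real 1)\<^sup>2 + \<theta> * real 1))"
      proof (rule noise[unfolded noise_bounded_def, rule_format])
        show "(\<Sum>j=1..n. (cmod (?y j))\<^sup>2) \<le> real 1" unfolding sc using yL L by simp
        show "(\<Sum>j=1..n. (cmod (?x j))\<^sup>2) \<le> real 1" unfolding sc L_def[symmetric] using L by simp
      qed (use n small small' in auto)
      moreover have "noise_form n A zs W ?y ?x = noise_form n A zs W y x / L"
      proof -
        have "Re (cnj (?y j) * noise A zs W j k * ?x k) = Re (cnj (y j) * noise A zs W j k * x k) / L" for j k
        proof -
          have "cnj (?y j) * noise A zs W j k * ?x k = of_real (c\<^sup>2) * (cnj (y j) * noise A zs W j k * x k)"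
            by (simp add: power2_eq_square)
          also have "Re \<dots> = c\<^sup>2 * Re (cnj (y j) * noise A zs W j k * x k)"
          proof -
            have "Re (of_real r * z) = r * Re z" for r z by simp
            then show ?thesis .
          qed
          finally show ?thesis by (simp only: c(2)) simp
        qed
        then show ?thesis unfolding noise_form_def by (simp only: sum_divide_distrib)
      qed
      ultimately have "noise_form n A zs W y x \<le> L * (100 * sqrt (n * (p * 1\<^sup>2 + \<theta> * 1)))"
        using L by (simp add: divide_le_eq mult.commute)
      then have "\<sigma> * noise_form n A zs W y x \<le> \<sigma> * (L * (100 * sqrt (n * (p * 1\<^sup>2 + \<theta> * 1))))"
        using \<sigma> by (intro mult_left_mono) auto
      also have "\<dots> = L * 100 * (\<sigma> * sqrt (n * (p * 1\<^sup>2 + \<theta> * 1)))" by simp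
      also have "\<dots> \<le> L * 100 * ((1 + sqrt \<kappa>) * \<epsilon> * N * 1)"
      proof (intro mult_left_mono key)
        show "sqrt (R * 1) \<le> 1" using \<open>\<not> 1 \<le> L + R\<close> L0 by simp
      qed (use L0 in auto)
      also have "\<dots> = 100 * ((1 + sqrt \<kappa>) * \<epsilon> * N * L)" by simp
      also have "\<dots> \<le> 100 * ((1 + sqrt \<kappa>) * \<epsilon> * N * (2 * (L + R)))"
        using \<kappa> \<epsilon> N R L0 by (intro mult_left_mono) auto
      finally show ?thesis .
    qed
  qed
  also have "\<dots> = 200 * (1 + sqrt \<kappa>) * \<epsilon> * N * (L + R)" by (simp add: algebra_simps)
  finally show ?thesis unfolding N_def R_def .
qed

text \<open>The sum of the constants of all error terms relative to \<open>\<epsilon> N (L + R)\<close> in \<open>aligned_loss_bound\<close>.\<close>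

definition error_const :: "real \<Rightarrow> real" where
  "error_const \<kappa> = 10 * \<kappa> + 932 + 600 * sqrt \<kappa>"

definition loss_const :: "real \<Rightarrow> real" where
  "loss_const \<kappa> = 2 * (1 + 4 * \<kappa>) + 12 * error_const \<kappa>"

text \<open>Every term of \<open>fixed_point_inequality\<close> except \<open>\<sigma> \<Sum>\<^sub>j Im(u\<^sub>j) Im(g\<^sub>j)\<close> is \<open>O(\<epsilon> N (L + R))\<close>, where \<open>N = n p\<close> and \<open>R = \<sigma>\<^sup>2 / p\<close>.
  The leading term is split by the inequality of arithmetic and geometric means with the weights that are optimal at
  the expected value \<open>L = R / 2\<close>; this leads to \<open>L \<le> L / 2 + R / 4\<close> up to errors, hence \<open>L \<le> R / 2\<close> up to a factor
  \<open>1 + O(\<epsilon>)\<close>.\<close>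

lemma aligned_loss_bound:
  fixes u :: "nat \<Rightarrow> complex"
  assumes reg: "near_regular n p \<theta> A" and n: "1 \<le> n" and p: "0 < p" and \<sigma>: "0 < \<sigma>"
    and \<epsilon>: "0 < \<epsilon>" "\<epsilon> \<le> 1" "4 * error_const \<kappa> * \<epsilon> \<le> 1" and s_le: "\<sigma>\<^sup>2 \<le> \<epsilon> ^ 4 * (n * p)"
    and \<theta>: "0 \<le> \<theta>" "\<theta> \<le> \<kappa> * \<epsilon>\<^sup>2 * (n * p)" "\<theta> \<le> n * p" and \<kappa>: "0 \<le> \<kappa>"
    and u: "\<And>j. j \<in> {1..n} \<Longrightarrow> cmod (u j) = 1" and s: "(\<Sum>j=1..n. u j) = of_real s" "0 \<le> s"
    and max: "\<And>w. (\<And>j. j \<in> {1..n} \<Longrightarrow> cmod (w j) = 1) \<Longrightarrow>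
      alignment n (data_matrix \<sigma> A zs W) w \<le> alignment n (data_matrix \<sigma> A zs W) u"
    and noise: "noise_bounded n p \<theta> A zs W"
    and rows: "(\<Sum>j=1..n. (Im (noise_row n A zs W j))\<^sup>2) \<le> (1 + \<epsilon>) * (n * (n * p + 2 * \<theta>) / 2)"
    and large: "(\<Sum>j=1..n. cmod (noise_row n A zs W j) * of_bool (16 * \<epsilon> * (n * p) / \<sigma> < cmod (noise_row n A zs W j))) \<le> \<epsilon> * n * \<sigma>"
  shows "(\<Sum>j=1..n. (cmod (u j - 1))\<^sup>2) \<le> (1 + loss_const \<kappa> * \<epsilon>) * (\<sigma>\<^sup>2 / (2 * p))"
proof -
  define N where "N = n * p"
  define R where "R = \<sigma>\<^sup>2 / p"
  define x where "x j = u j - 1" for j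
  define \<tau> where "\<tau> j = \<i> * of_real (Im (u j)) * u j + of_real ((cmod (x j))\<^sup>2 / 2) * x j" for j
  define L where "L = (\<Sum>j=1..n. (cmod (x j))\<^sup>2)"
  let ?g = "noise_row n A zs W"
  let ?e = "error_const \<kappa>"
  have N: "0 < N" using n p by (simp add: N_def)
  have R: "0 < R" using p \<sigma> by (simp add: R_def)
  have nR: "n * \<sigma>\<^sup>2 = N * R" using p by (simp add: N_def R_def)
  have L0: "0 \<le> L" unfolding L_def by (intro sum_nonneg) auto
  have e0: "0 \<le> ?e" using \<kappa> by (simp add: error_const_def)
  have eps2: "\<epsilon>\<^sup>2 \<le> \<epsilon>" using \<epsilon> by (simp add: power2_eq_square mult_left_le_one_le)
  have tv: "cmod (\<tau> j) \<le> 3 * cmod (x j)" "cmod (x j) \<le> 2" "\<bar>Im (u j)\<bar> \<le> cmod (x j)" "(cmod (x j))\<^sup>2 = 2 - 2 * Re (u j)"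
    if "j \<in> {1..n}" for j
    using tangent_test_vector(3,5,6,7)[OF u[OF that]] unfolding \<tau>_def x_def by blast+
  have sL: "s = n - L / 2"
  proof -
    have "L = (\<Sum>j=1..n. 2 - 2 * Re (u j))" unfolding L_def using tv(4) by simp
    also have "\<dots> = 2 * n - 2 * Re (\<Sum>j=1..n. u j)" by (simp add: sum_subtractf sum_distrib_left)
    finally have "L = 2 * n - 2 * s" unfolding s(1) by simp
    then show ?thesis by linarith
  qed
  have fixed: "\<exists>c\<ge>0. (\<Sum>k=1..n. data_matrix \<sigma> A zs W j k * u k) = of_real c * u j" if j: "j \<in> {1..n}" for j
    using alignment_max_imp_fixed_point[OF data_matrix_hermitian data_matrix_diag j u max] norm_ge_zero by blast
  have main: "p * s * L \<le> 7 * \<theta> * L + \<sigma> * ((\<Sum>j=1..n. Im (u j) * Im (?g j)) +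
     2 * (\<Sum>j=1..n. (cmod (x j))\<^sup>2 * cmod (?g j)) + noise_form n A zs W \<tau> x)"
    using fixed_point_inequality[OF reg \<theta>(1) less_imp_le[OF p] less_imp_le[OF \<sigma>] u s(1) fixed]
    unfolding L_def \<tau>_def[abs_def] x_def[abs_def] .
  have apriori: "L \<le> (6 * \<kappa> + 600) * \<epsilon> * n"
  proof -
    have "\<sigma> \<le> \<epsilon>\<^sup>2 * sqrt N"
    proof -
      have "\<sigma> \<le> sqrt (\<epsilon> ^ 4 * N)" using s_le by (intro real_le_rsqrt) (simp add: N_def)
      also have "\<epsilon> ^ 4 = (\<epsilon>\<^sup>2)\<^sup>2" by simp
      also have "sqrt ((\<epsilon>\<^sup>2)\<^sup>2 * N) = \<epsilon>\<^sup>2 * sqrt N" by (simp only: real_sqrt_mult real_sqrt_abs) simp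
      finally show ?thesis .
    qed
    then have "\<sigma> * sqrt N \<le> \<epsilon>\<^sup>2 * sqrt N * sqrt N" using N by (intro mult_right_mono) auto
    then have sN: "\<sigma> * sqrt N \<le> \<epsilon>\<^sup>2 * N" using N by (simp add: mult.assoc)
    have "N * L \<le> 6 * \<theta> * n + 600 * \<sigma> * n * sqrt N"
      using a_priori_loss_bound[OF reg \<theta>(1,3) p less_imp_le[OF \<sigma>] n u s noise max[of "\<lambda>_. 1"]]
      by (simp add: N_def L_def x_def)
    also have "\<dots> = 6 * \<theta> * n + 600 * n * (\<sigma> * sqrt N)" by simp
    also have "\<dots> \<le> 6 * (\<kappa> * \<epsilon>\<^sup>2 * N) * n + 600 * n * (\<epsilon>\<^sup>2 * N)"
    proof (rule add_mono)
      show "6 * \<theta> * n \<le> 6 * (\<kappa> * \<epsilon>\<^sup>2 * N) * n"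
        using \<theta>(2) by (intro mult_right_mono mult_left_mono) (auto simp: N_def)
    qed (use sN in \<open>auto intro: mult_left_mono\<close>)
    also have "\<dots> = N * ((6 * \<kappa> + 600) * \<epsilon>\<^sup>2 * n)" by (simp add: algebra_simps)
    also have "\<dots> \<le> N * ((6 * \<kappa> + 600) * \<epsilon> * n)"
      using eps2 \<kappa> N by (intro mult_left_mono mult_right_mono) auto
    finally show ?thesis using N by simp
  qed
  have t1: "N * L \<le> p * s * L + (3 * \<kappa> + 300) * \<epsilon> * N * L"
  proof -
    have "p * L / 2 * L \<le> p * ((6 * \<kappa> + 600) * \<epsilon> * n) / 2 * L"
      using apriori p L0 by (intro mult_right_mono divide_right_mono mult_left_mono) auto
    also have "\<dots> = (3 * \<kappa> + 300) * \<epsilon> * N * L" by (simp add: N_def algebra_simps)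
    finally show ?thesis unfolding sL by (simp add: N_def algebra_simps)
  qed
  have t2: "7 * \<theta> * L \<le> 7 * \<kappa> * \<epsilon> * N * L"
  proof -
    have "\<theta> \<le> \<kappa> * \<epsilon>\<^sup>2 * N" using \<theta>(2) by (simp add: N_def)
    also have "\<dots> \<le> \<kappa> * \<epsilon> * N" using eps2 \<kappa> N by (intro mult_left_mono mult_right_mono) auto
    finally have "\<theta> * L \<le> \<kappa> * \<epsilon> * N * L" using L0 by (rule mult_right_mono)
    then show ?thesis by linarith
  qed
  have t3: "\<sigma> * (\<Sum>j=1..n. Im (u j) * Im (?g j)) \<le> N * L / 2 + (1 + (1 + 4 * \<kappa>) * \<epsilon>) * N * R / 4"
  proof -
    have "\<sigma> * (\<Sum>j=1..n. Im (u j) * Im (?g j)) \<le> (\<Sum>j=1..n. N / 2 * (cmod (x j))\<^sup>2 + \<sigma>\<^sup>2 / (2 * N) * (Im (?g j))\<^sup>2)"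
      unfolding sum_distrib_left
    proof (rule sum_mono)
      fix j assume j: "j \<in> {1..n}"
      have "0 \<le> (N * Im (u j) - \<sigma> * Im (?g j))\<^sup>2" by simp
      then have "2 * N * (\<sigma> * (Im (u j) * Im (?g j))) \<le> N\<^sup>2 * (Im (u j))\<^sup>2 + \<sigma>\<^sup>2 * (Im (?g j))\<^sup>2"
        by (simp add: power2_eq_square algebra_simps)
      also have "(Im (u j))\<^sup>2 \<le> (cmod (x j))\<^sup>2" using tv(3)[OF j] by (simp add: abs_le_square_iff[symmetric])
      then have "N\<^sup>2 * (Im (u j))\<^sup>2 + \<sigma>\<^sup>2 * (Im (?g j))\<^sup>2 \<le> N\<^sup>2 * (cmod (x j))\<^sup>2 + \<sigma>\<^sup>2 * (Im (?g j))\<^sup>2"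
        by (intro add_right_mono mult_left_mono) auto
      finally show "\<sigma> * (Im (u j) * Im (?g j)) \<le> N / 2 * (cmod (x j))\<^sup>2 + \<sigma>\<^sup>2 / (2 * N) * (Im (?g j))\<^sup>2"
        using N by (simp add: field_simps power2_eq_square)
    qed
    also have "\<dots> = N / 2 * L + \<sigma>\<^sup>2 / (2 * N) * (\<Sum>j=1..n. (Im (?g j))\<^sup>2)"
      by (simp only: sum.distrib sum_distrib_left L_def)
    also have "\<sigma>\<^sup>2 / (2 * N) * (\<Sum>j=1..n. (Im (?g j))\<^sup>2) \<le> \<sigma>\<^sup>2 / (2 * N) * ((1 + (1 + 4 * \<kappa>) * \<epsilon>) * n * N / 2)"
    proof (rule mult_left_mono)
      have "(\<Sum>j=1..n. (Im (?g j))\<^sup>2) \<le> (1 + \<epsilon>) * (n * (N + 2 * \<theta>) / 2)" using rows by (simp add: N_def)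
      also have "\<dots> \<le> (1 + \<epsilon>) * (n * (N + 2 * (\<kappa> * \<epsilon>\<^sup>2 * N)) / 2)"
        using \<theta>(2) \<epsilon> by (intro mult_left_mono divide_right_mono add_left_mono) (auto simp: N_def)
      also have "\<dots> = (1 + \<epsilon>) * (1 + 2 * \<kappa> * \<epsilon>\<^sup>2) * (n * N / 2)" by (simp add: algebra_simps)
      also have "\<dots> \<le> (1 + (1 + 4 * \<kappa>) * \<epsilon>) * (n * N / 2)"
      proof (rule mult_right_mono)
        have "\<epsilon> * \<epsilon>\<^sup>2 \<le> \<epsilon>" using \<epsilon> eps2 by (intro mult_left_le) auto
        then have "2 * \<kappa> * (\<epsilon>\<^sup>2 + \<epsilon> * \<epsilon>\<^sup>2) \<le> 2 * \<kappa> * (\<epsilon> + \<epsilon>)" using eps2 \<kappa> by (intro mult_left_mono) auto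
        then show "(1 + \<epsilon>) * (1 + 2 * \<kappa> * \<epsilon>\<^sup>2) \<le> 1 + (1 + 4 * \<kappa>) * \<epsilon>" by (simp add: algebra_simps)
      qed (use N in auto)
      finally show "(\<Sum>j=1..n. (Im (?g j))\<^sup>2) \<le> (1 + (1 + 4 * \<kappa>) * \<epsilon>) * n * N / 2" by simp
    qed (use N in auto)
    also have "\<sigma>\<^sup>2 / (2 * N) * ((1 + (1 + 4 * \<kappa>) * \<epsilon>) * n * N / 2) = (1 + (1 + 4 * \<kappa>) * \<epsilon>) * (n * \<sigma>\<^sup>2) / 4"
      using N by simp
    finally show ?thesis unfolding nR by simp
  qed
  have t4: "2 * \<sigma> * (\<Sum>j=1..n. (cmod (x j))\<^sup>2 * cmod (?g j)) \<le> 32 * \<epsilon> * N * L + 8 * \<epsilon> * N * R"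
  proof -
    define T where "T = 16 * \<epsilon> * N / \<sigma>"
    have T: "0 \<le> T" "\<sigma> * T = 16 * \<epsilon> * N" using \<epsilon> N \<sigma> by (auto simp: T_def)
    \<comment> \<open>Rows above the threshold are charged with the trivial bound \<open>|x\<^sub>j|\<^sup>2 \<le> 4\<close>.\<close>
    have "(\<Sum>j=1..n. (cmod (x j))\<^sup>2 * cmod (?g j)) \<le> (\<Sum>j=1..n. T * (cmod (x j))\<^sup>2 + 4 * (cmod (?g j) * of_bool (T < cmod (?g j))))"
    proof (rule sum_mono)
      fix j assume j: "j \<in> {1..n}"
      show "(cmod (x j))\<^sup>2 * cmod (?g j) \<le> T * (cmod (x j))\<^sup>2 + 4 * (cmod (?g j) * of_bool (T < cmod (?g j)))"
      proof (cases "T < cmod (?g j)")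
        case True
        have "(cmod (x j))\<^sup>2 \<le> 2\<^sup>2" using tv(2)[OF j] by (intro power_mono) auto
        then have "(cmod (x j))\<^sup>2 * cmod (?g j) \<le> 4 * cmod (?g j)" by (intro mult_right_mono) auto
        moreover have "0 \<le> T * (cmod (x j))\<^sup>2" using T by simp
        ultimately show ?thesis using True by simp
      next
        case False
        then show ?thesis using mult_left_mono[of "cmod (?g j)" T "(cmod (x j))\<^sup>2"] by (simp add: mult.commute)
      qed
    qed
    also have "\<dots> = T * L + 4 * (\<Sum>j=1..n. cmod (?g j) * of_bool (T < cmod (?g j)))"
      by (simp only: sum.distrib sum_distrib_left L_def)
    also have "\<dots> \<le> T * L + 4 * (\<epsilon> * n * \<sigma>)" using large by (simp add: T_def N_def)
    finally have "2 * \<sigma> * (\<Sum>j=1..n. (cmod (x j))\<^sup>2 * cmod (?g j)) \<le> 2 * \<sigma> * (T * L + 4 * (\<epsilon> * n * \<sigma>))"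
      using \<sigma> by (intro mult_left_mono) auto
    also have "\<dots> = 2 * (\<sigma> * T) * L + 8 * \<epsilon> * (n * \<sigma>\<^sup>2)" by (simp add: power2_eq_square algebra_simps)
    finally show ?thesis unfolding T(2) nR by simp
  qed
  have t5: "\<sigma> * noise_form n A zs W \<tau> x \<le> 600 * (1 + sqrt \<kappa>) * \<epsilon> * N * (L + R)"
  proof -
    have "noise_form n A zs W \<tau> x = 3 * noise_form n A zs W (\<lambda>j. \<tau> j / 3) x"
      unfolding noise_form_def sum_distrib_left by (intro sum.cong refl) simp
    moreover have "\<sigma> * noise_form n A zs W (\<lambda>j. \<tau> j / 3) x \<le> 200 * (1 + sqrt \<kappa>) * \<epsilon> * (n * p) * ((\<Sum>j=1..n. (cmod (x j))\<^sup>2) + \<sigma>\<^sup>2 / p)"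
    proof (rule noise_form_small[OF noise n p \<sigma> \<epsilon>(1,2) s_le \<theta>(1,2) \<kappa> _ tv(2)])
      show "cmod (\<tau> j / 3) \<le> cmod (x j)" if "j \<in> {1..n}" for j
        using tv(1)[OF that] by (simp add: norm_divide)
    qed
    moreover define Z where "Z = (1 + sqrt \<kappa>) * \<epsilon> * N * (L + R)"
    ultimately have "\<sigma> * noise_form n A zs W \<tau> x \<le> 3 * (200 * Z)"
      by (simp only: N_def[symmetric] R_def[symmetric] L_def[symmetric] mult.assoc mult.left_commute[of \<sigma> 3])
    then show ?thesis by (simp only: Z_def mult.assoc)
  qed
  have "N * L \<le> (3 * \<kappa> + 300) * \<epsilon> * N * L + 7 * \<kappa> * \<epsilon> * N * L + (N * L / 2 + (1 + (1 + 4 * \<kappa>) * \<epsilon>) * N * R / 4) +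
      (32 * \<epsilon> * N * L + 8 * \<epsilon> * N * R) + 600 * (1 + sqrt \<kappa>) * \<epsilon> * N * (L + R)"
    using t1 main t2 t3 t4 t5 unfolding distrib_left mult.assoc[symmetric] by (simp add: mult.commute[of \<sigma> 2])
  also have "\<dots> \<le> N * L / 2 + (1 + (1 + 4 * \<kappa>) * \<epsilon>) * N * R / 4 + ?e * \<epsilon> * N * (L + R)"
  proof -
    have "0 \<le> (10 * \<kappa> + 324) * (\<epsilon> * N * R)" using \<kappa> \<epsilon> N R by simp
    moreover have "?e * \<epsilon> * N * (L + R) = (3 * \<kappa> + 300) * \<epsilon> * N * L + 7 * \<kappa> * \<epsilon> * N * L + 32 * \<epsilon> * N * L +
        8 * \<epsilon> * N * R + 600 * (1 + sqrt \<kappa>) * \<epsilon> * N * (L + R) + (10 * \<kappa> + 324) * (\<epsilon> * N * R)"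
      by (simp add: error_const_def algebra_simps)
    ultimately show ?thesis by linarith
  qed
  finally have "N * L \<le> N * (L / 2 + (1 + (1 + 4 * \<kappa>) * \<epsilon>) * R / 4 + ?e * \<epsilon> * (L + R))"
    by (simp add: algebra_simps)
  then have "L \<le> L / 2 + (1 + (1 + 4 * \<kappa>) * \<epsilon>) * R / 4 + ?e * \<epsilon> * (L + R)" using N by simp
  moreover have "?e * \<epsilon> * (L + R) = ?e * \<epsilon> * L + ?e * \<epsilon> * R" by (rule distrib_left)
  moreover have "(1 - 2 * (?e * \<epsilon>)) * L = L - 2 * (?e * \<epsilon> * L)" by (simp add: algebra_simps)
  moreover have "(1 + (1 + 4 * \<kappa>) * \<epsilon> + 4 * (?e * \<epsilon>)) * (R / 2) =
      (1 + (1 + 4 * \<kappa>) * \<epsilon>) * R / 2 + 2 * (?e * \<epsilon> * R)"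
    by (simp add: algebra_simps add_divide_distrib)
  ultimately have "(1 - 2 * (?e * \<epsilon>)) * L \<le> (1 + (1 + 4 * \<kappa>) * \<epsilon> + 4 * (?e * \<epsilon>)) * (R / 2)"
    by linarith
  also have "\<dots> \<le> ((1 - 2 * (?e * \<epsilon>)) * (1 + loss_const \<kappa> * \<epsilon>)) * (R / 2)"
  proof (rule mult_right_mono)
    \<comment> \<open>The constant \<open>loss_const\<close> is chosen so that half of it covers the linear terms on both sides.\<close>
    have "(?e * \<epsilon>) * (loss_const \<kappa> * \<epsilon>) \<le> (1 / 4) * (loss_const \<kappa> * \<epsilon>)"
      using \<epsilon> e0 \<kappa> by (intro mult_right_mono) (auto simp: loss_const_def mult.assoc)
    then show "1 + (1 + 4 * \<kappa>) * \<epsilon> + 4 * (?e * \<epsilon>) \<le> (1 - 2 * (?e * \<epsilon>)) * (1 + loss_const \<kappa> * \<epsilon>)"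
      by (simp add: loss_const_def algebra_simps)
  qed (use R in auto)
  finally have "(1 - 2 * (?e * \<epsilon>)) * L \<le> (1 - 2 * (?e * \<epsilon>)) * ((1 + loss_const \<kappa> * \<epsilon>) * (R / 2))" by (simp only: mult.assoc)
  moreover have "0 < 1 - 2 * (?e * \<epsilon>)" using \<epsilon>(3) by simp
  ultimately have "L \<le> (1 + loss_const \<kappa> * \<epsilon>) * (R / 2)" by simp
  then show ?thesis by (simp add: L_def x_def R_def mult.commute)
qed

text \<open>The global phase is \<open>a = conj S / |S|\<close> with \<open>S = \<Sum>\<^sub>j conj (zs j) zhat\<^sub>j\<close>. The value 1 for \<open>S = 0\<close> is as good as any.\<close>

lemma MLE_alignment:
  assumes zs: "zs \<in> phase_vectors n" and mle: "is_MLE n A (observation \<sigma> zs W) zhat"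
  obtains u s where "\<And>j. j \<in> {1..n} \<Longrightarrow> cmod (u j) = 1" "(\<Sum>j=1..n. u j) = of_real s" "0 \<le> s"
    "\<And>w. (\<And>j. j \<in> {1..n} \<Longrightarrow> cmod (w j) = 1) \<Longrightarrow>
      alignment n (data_matrix \<sigma> A zs W) w \<le> alignment n (data_matrix \<sigma> A zs W) u"
    "sync_loss n zhat zs \<le> (\<Sum>j=1..n. (cmod (u j - 1))\<^sup>2)"
proof -
  let ?f = "sync_objective n A (observation \<sigma> zs W)"
  have zs1: "cmod (zs j) = 1" if "j \<in> {1..n}" for j
    using zs that by (auto simp: phase_vectors_def PiE_iff)
  have zhat: "zhat \<in> phase_vectors n" and best: "\<And>z. z \<in> phase_vectors n \<Longrightarrow> ?f zhat \<le> ?f z"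
    using mle by (auto simp: is_MLE_def is_arg_min_def not_less)
  have zhat1: "cmod (zhat j) = 1" if "j \<in> {1..n}" for j
    using zhat that by (auto simp: phase_vectors_def PiE_iff)
  define S where "S = (\<Sum>j=1..n. cnj (zs j) * zhat j)"
  define a where "a = (if S = 0 then 1 else cnj S / of_real (cmod S))"
  have a: "cmod a = 1" by (simp add: a_def norm_divide)
  have aS: "S * a = of_real (cmod S)"
    using complex_norm_square[of S] by (simp add: a_def power2_eq_square divide_eq_eq)
  have a_unit: "a * cnj a = 1" using complex_norm_square[of a] a by simp
  define u where "u j = cnj (zs j) * zhat j * a" for j
  have u1: "cmod (u j) = 1" if "j \<in> {1..n}" for j using zs1[OF that] zhat1[OF that] a by (simp add: u_def norm_mult)
  have unrotate: "zs j * u j * cnj a = zhat j" if "j \<in> {1..n}" for j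
  proof -
    have "zs j * u j * cnj a = (zs j * cnj (zs j)) * zhat j * (a * cnj a)" by (simp add: u_def mult_ac)
    moreover have "zs j * cnj (zs j) = 1" using complex_norm_square[of "zs j"] zs1[OF that] by simp
    ultimately show ?thesis by (simp only: a_unit mult_1_left mult_1_right)
  qed
  have zhat_eq: "zhat = (\<lambda>j\<in>{1..n}. zs j * u j * cnj a)"
    using zhat unrotate by (auto simp: phase_vectors_def PiE_iff extensional_def restrict_def fun_eq_iff)
  show thesis
  proof (rule that[of u "cmod S"])
    show "(\<Sum>j=1..n. u j) = of_real (cmod S)"
    proof -
      have "(\<Sum>j=1..n. u j) = S * a" unfolding S_def u_def by (simp add: sum_distrib_right)
      then show ?thesis using aS by simp
    qed
    fix w :: "nat \<Rightarrow> complex" assume w: "\<And>j. j \<in> {1..n} \<Longrightarrow> cmod (w j) = 1"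
    have "(\<lambda>j\<in>{1..n}. zs j * w j * cnj a) \<in> phase_vectors n"
      using zs1 w a by (auto simp: phase_vectors_def norm_mult)
    then have "?f zhat \<le> ?f (\<lambda>j\<in>{1..n}. zs j * w j * cnj a)" by (rule best)
    then have "?f (\<lambda>j\<in>{1..n}. zs j * u j * cnj a) \<le> ?f (\<lambda>j\<in>{1..n}. zs j * w j * cnj a)"
      by (simp only: zhat_eq[symmetric])
    moreover have "cmod (cnj a) = 1" using a by simp
    ultimately show "alignment n (data_matrix \<sigma> A zs W) w \<le> alignment n (data_matrix \<sigma> A zs W) u"
      using sync_objective_eq_alignment[of n zs w "cnj a" A \<sigma> W] sync_objective_eq_alignment[of n zs u "cnj a" A \<sigma> W]
        zs1 w u1 by simp
  next
    have "sync_loss n zhat zs \<le> (\<Sum>j=1..n. (cmod (zhat j * a - zs j))\<^sup>2)"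
      unfolding sync_loss_def using a
      by (intro cINF_lower bdd_belowI2[of _ 0] sum_nonneg) auto
    also have "\<dots> = (\<Sum>j=1..n. (cmod (u j - 1))\<^sup>2)"
    proof (intro sum.cong refl arg_cong[of _ _ "\<lambda>r. r\<^sup>2"])
      fix j assume j: "j \<in> {1..n}"
      have "zhat j * a - zs j = zs j * (u j - 1)"
      proof -
        have "zs j * (u j - 1) = (zs j * cnj (zs j)) * zhat j * a - zs j" by (simp add: u_def algebra_simps)
        then show ?thesis using complex_norm_square[of "zs j"] zs1[OF j] by simp
      qed
      then show "cmod (zhat j * a - zs j) = cmod (u j - 1)" using zs1[OF j] by (simp add: norm_mult)
    qed
    finally show "sync_loss n zhat zs \<le> (\<Sum>j=1..n. (cmod (u j - 1))\<^sup>2)" .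
  qed (use u1 in auto)
qed

section \<open>The loss of the maximum likelihood estimator\<close>

text \<open>The good noise event depends on the graph. As there are finitely many graphs, the joint event is a finite union
  of rectangles.\<close>

lemma measure_pair_Sigma_ge:
  fixes M1 :: "'a measure" and M2 :: "'b measure"
  assumes P1: "prob_space M1" and P2: "prob_space M2"
    and fin: "finite (space M1)" and sets: "sets M1 = Pow (space M1)" and G: "G \<subseteq> space M1"
    and F: "\<And>A. A \<in> G \<Longrightarrow> F A \<in> sets M2"
    and \<alpha>: "measure M1 (space M1 - G) \<le> \<alpha>" and \<beta>: "\<And>A. A \<in> G \<Longrightarrow> measure M2 (space M2 - F A) \<le> \<beta>" and \<beta>0: "0 \<le> \<beta>"
  shows "Sigma G F \<in> sets (M1 \<Otimes>\<^sub>M M2)" "1 - \<alpha> - \<beta> \<le> measure (M1 \<Otimes>\<^sub>M M2) (Sigma G F)"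
proof -
  interpret P1: prob_space M1 by fact
  interpret P2: prob_space M2 by fact
  interpret P: pair_prob_space M1 M2 ..
  have finG: "finite G" using fin G by (rule finite_subset[rotated])
  have Gs: "{A} \<in> sets M1" if "A \<in> G" for A using that G sets by auto
  have eq: "Sigma G F = (\<Union>A\<in>G. {A} \<times> F A)" by auto
  have rect: "{A} \<times> F A \<in> sets (M1 \<Otimes>\<^sub>M M2)" if "A \<in> G" for A using Gs F that by auto
  show "Sigma G F \<in> sets (M1 \<Otimes>\<^sub>M M2)" unfolding eq using finG rect by (intro sets.finite_UN) auto
  have "measure (M1 \<Otimes>\<^sub>M M2) (Sigma G F) = (\<Sum>A\<in>G. measure (M1 \<Otimes>\<^sub>M M2) ({A} \<times> F A))"
    unfolding eq using finG rect by (intro P.finite_measure_finite_Union) (auto simp: disjoint_family_on_def)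
  also have "\<dots> = (\<Sum>A\<in>G. measure M1 {A} * measure M2 (F A))"
    using Gs F by (intro sum.cong refl) (simp add: measure_def P2.emeasure_pair_measure_Times enn2real_mult)
  also have "\<dots> \<ge> (\<Sum>A\<in>G. measure M1 {A} * (1 - \<beta>))"
  proof (intro sum_mono mult_left_mono)
    fix A assume "A \<in> G"
    then show "1 - \<beta> \<le> measure M2 (F A)" using P2.prob_compl[of "F A"] F \<beta> by fastforce
  qed auto
  also have "(\<Sum>A\<in>G. measure M1 {A} * (1 - \<beta>)) = measure M1 G * (1 - \<beta>)"
  proof -
    have "measure M1 G = measure M1 (\<Union>A\<in>G. {A})" by simp
    also have "\<dots> = (\<Sum>A\<in>G. measure M1 {A})"
      using finG Gs by (intro P1.finite_measure_finite_Union) (auto simp: disjoint_family_on_def)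
    finally show ?thesis by (simp add: sum_distrib_right)
  qed
  finally have ge: "measure M1 G * (1 - \<beta>) \<le> measure (M1 \<Otimes>\<^sub>M M2) (Sigma G F)" .
  have G1: "1 - \<alpha> \<le> measure M1 G" using P1.prob_compl[of G] G sets \<alpha> by auto
  have "measure M1 G - measure M1 G * \<beta> \<ge> 1 - \<alpha> - \<beta>"
    using G1 mult_right_mono[OF P1.prob_le_1[of G] \<beta>0] by simp
  then show "1 - \<alpha> - \<beta> \<le> measure (M1 \<Otimes>\<^sub>M M2) (Sigma G F)" using ge by (simp add: right_diff_distrib)
qed

text \<open>This is \<open>4 w exp (- 4 w) \<le> exp (- w)\<close> at \<open>w = sqrt q\<close>, as \<open>\<epsilon>\<^sup>2 \<ge> 1 / w\<close>.\<close>

lemma truncation_probability: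
  fixes q \<epsilon> :: real
  assumes \<epsilon>: "0 < \<epsilon>" and q: "1 \<le> q" "1 \<le> \<epsilon> ^ 4 * q"
  shows "4 / \<epsilon>\<^sup>2 * exp (- (4 * \<epsilon>\<^sup>2 * q)) \<le> exp (- (q powr (1/4)))"
proof -
  define w where "w = sqrt q"
  have w: "1 \<le> w" "w * w = q" using q by (auto simp: w_def)
  have "1 \<le> (\<epsilon>\<^sup>2 * w)\<^sup>2" using q w by (simp add: power_mult_distrib power2_eq_square eval_nat_numeral mult_ac)
  then have ew: "1 \<le> \<epsilon>\<^sup>2 * w" using power2_le_imp_le[of 1 "\<epsilon>\<^sup>2 * w"] w by simp
  have "4 / \<epsilon>\<^sup>2 \<le> 4 * w" using ew \<epsilon> by (simp add: divide_le_eq mult.commute)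
  moreover have "4 * w \<le> 4 * \<epsilon>\<^sup>2 * q"
    using mult_right_mono[OF ew, of w] w by (simp add: mult.assoc)
  ultimately have "4 / \<epsilon>\<^sup>2 * exp (- (4 * \<epsilon>\<^sup>2 * q)) \<le> (4 * w) * exp (- (4 * w))"
    using w by (intro mult_mono) auto
  also have "\<dots> \<le> exp (3 * w) * exp (- (4 * w))"
  proof (rule mult_right_mono)
    have "4 * w \<le> 1 + 3 * w + (3 * w)\<^sup>2 / 2"
    proof -
      have "w * 1 \<le> w * w" using w(1) by (intro mult_left_mono) auto
      moreover have "(3 * w)\<^sup>2 = 9 * (w * w)" by (simp add: power2_eq_square)
      ultimately show ?thesis using w(1) by linarith
    qed
    also have "\<dots> \<le> exp (3 * w)" using w by (intro exp_lower_Taylor_quadratic) auto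
    finally show "4 * w \<le> exp (3 * w)" .
  qed simp
  also have "\<dots> = exp (- w)" by (simp add: exp_add[symmetric])
  also have "\<dots> \<le> exp (- (q powr (1/4)))"
  proof -
    have "q powr (1/4) \<le> q powr (1/2)" using q by (intro powr_mono) auto
    then show ?thesis using q by (simp add: w_def powr_half_sqrt)
  qed
  finally show ?thesis .
qed

text \<open>The event requires a nearly regular graph and, given the graph, the three noise bounds. Their failure probabilities are \<open>3 n\<^bsup>-3\<^esup>\<close>, the two
  other terms of the hypothesis \<open>num\<close>, and \<open>exp (- q\<^bsup>1/4\<^esup>)\<close> with \<open>q = n p / \<sigma>\<^sup>2\<close>.
  The event is chosen before the estimator, so that the bound holds for every minimizer on it.\<close>

lemma MLE_loss_event:
  fixes n :: nat and p \<sigma> \<epsilon> :: real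
  defines "\<kappa> \<equiv> sqrt (32 * exp 7)"
  assumes n: "3 \<le> n" and p: "0 < p" "p \<le> 1" and \<sigma>: "0 < \<sigma>"
    and \<epsilon>: "0 < \<epsilon>" "\<epsilon> \<le> 1" "4 * error_const \<kappa> * \<epsilon> \<le> 1" "\<kappa> * \<epsilon>\<^sup>2 \<le> 1"
    and s_le: "\<sigma>\<^sup>2 \<le> \<epsilon> ^ 4 * (n * p)" and ln_le: "ln n \<le> \<epsilon> ^ 4 * (n * p)"
    and num: "3 / real n ^ 3 + 4 * real n * exp (- 5 * real n) + exp (- sqrt (real n * ln (real n)) / 16) \<le> 1 / real n"
    and zs: "zs \<in> phase_vectors n"
  shows "\<exists>E\<in>sets (sync_law n p). measure (sync_law n p) E \<ge> 1 - 1 / real n - exp (- ((real n * p / \<sigma>\<^sup>2) powr (1/4))) \<and>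
     (\<forall>(A, W)\<in>E. \<forall>zhat. is_MLE n A (observation \<sigma> zs W) zhat \<longrightarrow>
       sync_loss n zhat zs \<le> (1 + loss_const \<kappa> * \<epsilon>) * (\<sigma>\<^sup>2 / (2 * p)))"
proof -
  define N where "N = n * p"
  define q where "q = N / \<sigma>\<^sup>2"
  define \<theta> where "\<theta> = sqrt (32 * exp 7 * ln n * (n * p))"
  let ?I = "index_pairs n"
  let ?G = "graph_law ?I p" and ?N = "noise_law ?I"
  interpret PN: prob_space ?N by (rule prob_space_noise_law)
  have N: "0 < N" using n p by (simp add: N_def)
  have n1: "1 \<le> n" using n by simp
  have ln0: "0 < ln (real n)" using n by simp
  have \<kappa>: "0 < \<kappa>" "\<kappa>\<^sup>2 = 32 * exp 7" by (auto simp: \<kappa>_def)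
  have zs1: "cmod (zs j) = 1" if "j \<in> {1..n}" for j
    using zs that by (auto simp: phase_vectors_def PiE_iff)
  have \<theta>0: "0 < \<theta>" using N ln0 by (simp add: \<theta>_def N_def)
  have \<theta>1: "\<theta> \<le> \<kappa> * \<epsilon>\<^sup>2 * (n * p)"
    unfolding \<theta>_def
  proof (rule real_le_lsqrt)
    have "32 * exp 7 * ln n * (n * p) = \<kappa>\<^sup>2 * ln n * N" by (simp add: \<kappa>(2) N_def)
    also have "\<dots> \<le> \<kappa>\<^sup>2 * (\<epsilon> ^ 4 * N) * N" using ln_le N by (intro mult_right_mono mult_left_mono) (auto simp: N_def)
    also have "\<dots> = (\<kappa> * \<epsilon>\<^sup>2 * (n * p))\<^sup>2" by (simp add: N_def power_mult_distrib power2_eq_square eval_nat_numeral)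
    finally show "32 * exp 7 * ln n * (n * p) \<le> (\<kappa> * \<epsilon>\<^sup>2 * (n * p))\<^sup>2" .
  qed (use \<kappa> \<epsilon> N in \<open>auto simp: N_def\<close>)
  also have "\<dots> \<le> 1 * (n * p)" using \<epsilon>(4) N by (intro mult_right_mono) (auto simp: N_def)
  finally have \<theta>2: "\<theta> \<le> n * p" by simp
  have dense: "32 * exp 7 * ln n \<le> n * p"
  proof -
    have "32 * exp 7 * ln n \<le> \<kappa>\<^sup>2 * (\<epsilon> ^ 4 * (n * p))" unfolding \<kappa>(2) using ln_le by (intro mult_left_mono) auto
    also have "\<dots> = (\<kappa> * \<epsilon>\<^sup>2)\<^sup>2 * N" by (simp add: N_def power_mult_distrib power2_eq_square eval_nat_numeral)
    also have "\<dots> \<le> 1 * N" using \<epsilon> \<kappa> N by (intro mult_right_mono power_le_one) auto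
    finally show ?thesis by (simp add: N_def)
  qed
  have q4: "1 \<le> \<epsilon> ^ 4 * q" using s_le \<sigma> by (simp add: q_def N_def)
  have q1: "1 \<le> q"
  proof -
    have "\<epsilon> ^ 4 * q \<le> 1 * q" using \<epsilon> N by (intro mult_right_mono power_le_one) (auto simp: q_def)
    then show ?thesis using q4 by simp
  qed
  define G where "G = {A \<in> space ?G. near_regular n p \<theta> A}"
  define T where "T = 16 * \<epsilon> * (n * p) / \<sigma>"
  define B where "B = \<epsilon> * n * \<sigma>"
  have T0: "0 < T" and B0: "0 < B" using \<epsilon> \<sigma> N n by (auto simp: T_def B_def N_def)
  have T_N: "T = 16 * \<epsilon> * N / \<sigma>" by (simp add: T_def N_def)
  define bad1 where "bad1 A = {W \<in> space ?N. (1 + \<epsilon>) * (n * (n * p + 2 * \<theta>) / 2) < (\<Sum>j=1..n. (Im (noise_row n A zs W j))\<^sup>2)}" for A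
  define bad2 where "bad2 A = {W \<in> space ?N. B \<le> (\<Sum>j=1..n. cmod (noise_row n A zs W j) * of_bool (T < cmod (noise_row n A zs W j)))}" for A
  define \<beta> where "\<beta> = 4 * real n * exp (- 5 * real n) + exp (- sqrt (real n * ln (real n)) / 16) + exp (- (q powr (1/4)))"
  have meas: "bad1 A \<in> sets ?N" "bad2 A \<in> sets ?N" for A
  proof -
    have [measurable]: "(\<lambda>W. \<Sum>j=1..n. (Im (noise_row n A zs W j))\<^sup>2) \<in> borel_measurable ?N"
      by (intro borel_measurable_sum borel_measurable_power borel_measurable_noise_row)
    have [measurable]: "(\<lambda>W. \<Sum>j=1..n. cmod (noise_row n A zs W j) * of_bool (T < cmod (noise_row n A zs W j))) \<in> borel_measurable ?N"
    proof (rule borel_measurable_sum)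
      fix j assume "j \<in> {1..n}"
      then have [measurable]: "(\<lambda>W. cmod (noise_row n A zs W j)) \<in> borel_measurable ?N"
        by (rule borel_measurable_noise_row)
      show "(\<lambda>W. cmod (noise_row n A zs W j) * of_bool (T < cmod (noise_row n A zs W j))) \<in> borel_measurable ?N"
        by measurable
    qed
    show "bad1 A \<in> sets ?N" unfolding bad1_def by measurable
    show "bad2 A \<in> sets ?N" unfolding bad2_def by measurable
  qed
  have "\<exists>F. F \<in> sets ?N \<and> measure ?N (space ?N - F) \<le> \<beta> \<and> (\<forall>W\<in>F. W \<in> space ?N - bad1 A - bad2 A \<and> noise_bounded n p \<theta> A zs W)"
    if A: "A \<in> G" for A
  proof -
    have reg: "near_regular n p \<theta> A" using A by (simp add: G_def)
    obtain F0 where "F0 \<in> sets ?N" "measure ?N (space ?N - F0) \<le> 4 * real n * exp (- 5 * real n) \<and>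
        (\<forall>W\<in>F0. noise_bounded n p \<theta> A zs W)"
      using noise_bounded_probability[OF n1 p(1) \<theta>0 reg zs1] by (rule bexE)
    then have F0: "F0 \<in> sets ?N" "measure ?N (space ?N - F0) \<le> 4 * real n * exp (- 5 * real n)"
      "\<And>W. W \<in> F0 \<Longrightarrow> noise_bounded n p \<theta> A zs W" by auto
    have b1: "measure ?N (bad1 A) \<le> exp (- sqrt (real n * ln (real n)) / 16)"
    proof -
      have "measure ?N (bad1 A) \<le> exp (- real n * \<epsilon>\<^sup>2 / 16)"
        unfolding bad1_def by (rule noise_row_Im_tail[OF reg p(1) \<theta>0 n1 zs1 \<epsilon>(1,2)])
      also have "\<dots> \<le> exp (- sqrt (real n * ln (real n)) / 16)"
      proof -
        have "sqrt (real n * ln (real n)) \<le> real n * \<epsilon>\<^sup>2"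
        proof (rule real_le_lsqrt)
          have "\<epsilon> ^ 4 * (n * p) \<le> \<epsilon> ^ 4 * n" using p by (intro mult_left_mono) (auto simp: mult_left_le)
          then have "n * ln n \<le> n * (\<epsilon> ^ 4 * n)" using ln_le by (intro mult_left_mono) auto
          also have "\<dots> = (n * \<epsilon>\<^sup>2)\<^sup>2" by (simp add: power_mult_distrib power2_eq_square eval_nat_numeral)
          finally show "n * ln n \<le> (n * \<epsilon>\<^sup>2)\<^sup>2" .
        qed (use ln0 in auto)
        then show ?thesis by simp
      qed
      finally show ?thesis .
    qed
    have b2: "measure ?N (bad2 A) \<le> exp (- (q powr (1/4)))"
    proof -
      have "measure ?N (bad2 A) \<le> n * (64 * (n * p) / T) * exp (- T\<^sup>2 / (64 * (n * p))) / B"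
        unfolding bad2_def by (rule noise_row_modulus_tail[OF reg p(1) \<theta>0 \<theta>2 zs1 T0 B0])
      also have "n * (64 * (n * p) / T) * exp (- T\<^sup>2 / (64 * (n * p))) / B = n * (64 * N / T) / B * exp (- T\<^sup>2 / (64 * N))"
        by (simp add: N_def)
      also have "n * (64 * N / T) / B = 4 / \<epsilon>\<^sup>2"
        using \<epsilon> \<sigma> N n by (simp add: T_N B_def field_simps power2_eq_square)
      also have "- T\<^sup>2 / (64 * N) = - (4 * \<epsilon>\<^sup>2 * q)"
        using \<sigma> N by (simp add: T_N q_def field_simps power2_eq_square)
      also have "4 / \<epsilon>\<^sup>2 * exp (- (4 * \<epsilon>\<^sup>2 * q)) \<le> exp (- (q powr (1/4)))"
        by (rule truncation_probability[OF \<epsilon>(1) q1 q4])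
      finally show ?thesis .
    qed
    define F where "F = F0 - bad1 A - bad2 A"
    have "F \<in> sets ?N" unfolding F_def using F0 meas by auto
    moreover have "measure ?N (space ?N - F) \<le> \<beta>"
    proof -
      have "measure ?N (space ?N - F) \<le> measure ?N (((space ?N - F0) \<union> bad1 A) \<union> bad2 A)"
        using F0 meas by (intro PN.finite_measure_mono) (auto simp: F_def)
      also have "\<dots> \<le> measure ?N ((space ?N - F0) \<union> bad1 A) + measure ?N (bad2 A)"
        using F0 meas by (intro measure_Un_le) auto
      also have "measure ?N ((space ?N - F0) \<union> bad1 A) \<le> measure ?N (space ?N - F0) + measure ?N (bad1 A)"
        using F0 meas by (intro measure_Un_le) auto
      finally show ?thesis using F0(2) b1 b2 by (simp add: \<beta>_def)
    qed
    moreover have "W \<in> space ?N - bad1 A - bad2 A \<and> noise_bounded n p \<theta> A zs W" if "W \<in> F" for W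
      using that F0 sets.sets_into_space[OF F0(1)] by (auto simp: F_def)
    ultimately show ?thesis by blast
  qed
  then obtain F where F: "\<And>A. A \<in> G \<Longrightarrow> F A \<in> sets ?N" "\<And>A. A \<in> G \<Longrightarrow> measure ?N (space ?N - F A) \<le> \<beta>"
    "\<And>A W. A \<in> G \<Longrightarrow> W \<in> F A \<Longrightarrow> W \<in> space ?N - bad1 A - bad2 A \<and> noise_bounded n p \<theta> A zs W"
    by metis
  have \<alpha>: "measure ?G (space ?G - G) \<le> 3 / real n ^ 3"
  proof -
    have "space ?G - G = {A \<in> space ?G. \<not> near_regular n p \<theta> A}" by (auto simp: G_def)
    then show ?thesis using near_regular_probability[OF p n dense] by (simp add: \<theta>_def)
  qed
  have finite_space: "finite (space ?G)" unfolding space_graph_law by (intro finite_PiE) auto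
  have \<beta>0: "0 \<le> \<beta>" by (simp add: \<beta>_def)
  note pair = measure_pair_Sigma_ge[where F = F and G = G, OF prob_space_graph_law prob_space_noise_law finite_space _ _ F(1) \<alpha> F(2) \<beta>0]
  have sets_G: "sets ?G = Pow (space ?G)" by (simp add: sets_graph_law space_graph_law)
  have G_sub: "G \<subseteq> space ?G" by (auto simp: G_def)
  have "Sigma G F \<in> sets (sync_law n p)"
    unfolding sync_law_def by (rule pair(1)[OF sets_G G_sub])
  moreover have "1 - 1 / real n - exp (- ((real n * p / \<sigma>\<^sup>2) powr (1/4))) \<le> measure (sync_law n p) (Sigma G F)"
    using pair(2)[OF sets_G G_sub] num unfolding sync_law_def by (simp add: \<beta>_def q_def N_def)
  moreover have "sync_loss n zhat zs \<le> (1 + loss_const \<kappa> * \<epsilon>) * (\<sigma>\<^sup>2 / (2 * p))"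
    if AW: "(A, W) \<in> Sigma G F" and mle: "is_MLE n A (observation \<sigma> zs W) zhat" for A W zhat
  proof -
    have A: "A \<in> G" and W: "W \<in> F A" using AW by auto
    have reg: "near_regular n p \<theta> A" using A by (simp add: G_def)
    have Wb: "W \<in> space ?N - bad1 A - bad2 A" and noise: "noise_bounded n p \<theta> A zs W" using F(3)[OF A W] by auto
    have rows: "(\<Sum>j=1..n. (Im (noise_row n A zs W j))\<^sup>2) \<le> (1 + \<epsilon>) * (n * (n * p + 2 * \<theta>) / 2)"
      using Wb by (auto simp: bad1_def not_less)
    have large: "(\<Sum>j=1..n. cmod (noise_row n A zs W j) * of_bool (16 * \<epsilon> * (n * p) / \<sigma> < cmod (noise_row n A zs W j))) \<le> \<epsilon> * n * \<sigma>"
      using Wb unfolding bad2_def T_def B_def by auto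
    obtain u s where u: "\<And>j. j \<in> {1..n} \<Longrightarrow> cmod (u j) = 1" "(\<Sum>j=1..n. u j) = of_real s" "0 \<le> s"
      "\<And>w. (\<And>j. j \<in> {1..n} \<Longrightarrow> cmod (w j) = 1) \<Longrightarrow>
        alignment n (data_matrix \<sigma> A zs W) w \<le> alignment n (data_matrix \<sigma> A zs W) u"
      and loss: "sync_loss n zhat zs \<le> (\<Sum>j=1..n. (cmod (u j - 1))\<^sup>2)"
      using MLE_alignment[OF zs mle] by blast
    have "(\<Sum>j=1..n. (cmod (u j - 1))\<^sup>2) \<le> (1 + loss_const \<kappa> * \<epsilon>) * (\<sigma>\<^sup>2 / (2 * p))"
      by (rule aligned_loss_bound[OF reg n1 p(1) \<sigma> \<epsilon>(1-3) s_le less_imp_le[OF \<theta>0] \<theta>1 \<theta>2 less_imp_le[OF \<kappa>(1)] u noise rows large])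
    then show ?thesis using loss by linarith
  qed
  ultimately show ?thesis by (intro bexI[of _ "Sigma G F"]) auto
qed

theorem theorem3p2:
  fixes p \<sigma> :: "nat \<Rightarrow> real"
  assumes "\<And>n. 0 < p n \<and> p n \<le> 1"
    and "\<And>n. 0 < \<sigma> n"
    and "(\<lambda>n. (\<sigma> n)\<^sup>2) \<in> o(\<lambda>n. real n * p n)"
    and "filterlim (\<lambda>n. real n * p n / ln (real n)) at_top sequentially"
  shows "\<exists>\<delta> :: nat \<Rightarrow> real.
    \<delta> \<in> o(\<lambda>_. 1) \<and>
    \<delta> \<in> O(\<lambda>n. ((ln (real n) + (\<sigma> n)\<^sup>2) / (real n * p n)) powr (1/4)) \<and>
    (\<forall>\<^sub>F n in sequentially. \<forall>zstar\<in>phase_vectors n.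
      \<exists>E\<in>sets (sync_law n (p n)).
        measure (sync_law n (p n)) E
          \<ge> 1 - 1 / real n - exp (- ((real n * p n / (\<sigma> n)\<^sup>2) powr (1/4))) \<and>
        (\<forall>(A, W)\<in>E. \<forall>zhat. is_MLE n A (observation (\<sigma> n) zstar W) zhat \<longrightarrow>
          sync_loss n zhat zstar \<le> (1 + \<delta> n) * ((\<sigma> n)\<^sup>2 / (2 * p n))))"
proof -
  define \<kappa> :: real where "\<kappa> = sqrt (32 * exp 7)"
  define r where "r n = (ln (real n) + (\<sigma> n)\<^sup>2) / (real n * p n)" for n
  define \<epsilon> where "\<epsilon> n = r n powr (1/4)" for n
  have \<kappa>0: "0 < \<kappa>" by (simp add: \<kappa>_def)
  have e0: "0 < error_const \<kappa>" using \<kappa>0 by (simp add: error_const_def add_pos_nonneg)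
  have "(\<lambda>n. inverse (real n * p n / ln (real n))) \<longlonglongrightarrow> 0"
    by (rule tendsto_inverse_0_at_top[OF assms(4)])
  then have "(\<lambda>n. ln (real n) / (real n * p n)) \<longlonglongrightarrow> 0" by (simp add: inverse_eq_divide)
  moreover have "(\<lambda>n. (\<sigma> n)\<^sup>2 / (real n * p n)) \<longlonglongrightarrow> 0"
    by (rule smalloD_tendsto[OF assms(3)])
  ultimately have r_lim: "r \<longlonglongrightarrow> 0"
    using tendsto_add[of _ 0 sequentially _ 0] by (fastforce simp: r_def[abs_def] add_divide_distrib)
  have r_pos: "eventually (\<lambda>n. 0 < r n) sequentially"
    using eventually_ge_at_top[of 2]
  proof eventually_elim
    case (elim n)
    have "0 < real n * p n" "0 < (\<sigma> n)\<^sup>2" using elim assms(1,2)[of n] by auto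
    moreover have "0 \<le> ln (real n)" using elim by simp
    ultimately show ?case unfolding r_def by (intro divide_pos_pos add_nonneg_pos)
  qed
  have \<epsilon>_lim: "\<epsilon> \<longlonglongrightarrow> 0"
    unfolding \<epsilon>_def[abs_def]
    by (rule tendsto_zero_powrI[OF r_lim tendsto_const]) (use r_pos in \<open>auto elim: eventually_mono\<close>)
  define \<epsilon>0 where "\<epsilon>0 = min 1 (min (1 / (4 * error_const \<kappa>)) (1 / \<kappa>))"
  have "0 < \<epsilon>0" using \<kappa>0 e0 by (simp add: \<epsilon>0_def)
  then have small: "eventually (\<lambda>n. \<epsilon> n < \<epsilon>0) sequentially" by (rule order_tendstoD(2)[OF \<epsilon>_lim])
  have num: "eventually (\<lambda>n. 3 / real n ^ 3 + 4 * real n * exp (- 5 * real n) + exp (- sqrt (real n * ln (real n)) / 16) \<le> 1 / real n) sequentially"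
    by real_asymp
  have "\<forall>\<^sub>F n in sequentially. \<forall>zstar\<in>phase_vectors n.
      \<exists>E\<in>sets (sync_law n (p n)).
        measure (sync_law n (p n)) E
          \<ge> 1 - 1 / real n - exp (- ((real n * p n / (\<sigma> n)\<^sup>2) powr (1/4))) \<and>
        (\<forall>(A, W)\<in>E. \<forall>zhat. is_MLE n A (observation (\<sigma> n) zstar W) zhat \<longrightarrow>
          sync_loss n zhat zstar \<le> (1 + loss_const \<kappa> * \<epsilon> n) * ((\<sigma> n)\<^sup>2 / (2 * p n)))"
    using r_pos small num eventually_ge_at_top[of 3]
  proof eventually_elim
    case (elim n)
    have np: "0 < real n * p n" using elim(4) assms(1)[of n] by auto
    have \<epsilon>: "0 < \<epsilon> n" using elim(1) by (simp add: \<epsilon>_def)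
    have le: "\<epsilon> n \<le> 1" "\<epsilon> n \<le> 1 / (4 * error_const \<kappa>)" "\<epsilon> n \<le> 1 / \<kappa>"
      using elim(2) by (auto simp: \<epsilon>0_def)
    have e1: "4 * error_const \<kappa> * \<epsilon> n \<le> 1" using le(2) e0 by (simp add: pos_le_divide_eq mult.commute)
    have e2: "\<kappa> * (\<epsilon> n)\<^sup>2 \<le> 1"
    proof -
      have "(\<epsilon> n)\<^sup>2 \<le> \<epsilon> n" using le(1) \<epsilon> by (simp add: power2_eq_square mult_left_le_one_le)
      then have "\<kappa> * (\<epsilon> n)\<^sup>2 \<le> \<kappa> * \<epsilon> n" using \<kappa>0 by simp
      also have "\<dots> \<le> 1" using le(3) \<kappa>0 by (simp add: pos_le_divide_eq mult.commute)
      finally show ?thesis .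
    qed
    have "\<epsilon> n ^ 4 = r n"
      using elim(1) by (simp add: \<epsilon>_def powr_power)
    moreover have "r n * (real n * p n) = ln (real n) + (\<sigma> n)\<^sup>2"
      unfolding r_def by (rule nonzero_eq_divide_eq[THEN iffD1, OF _ refl]) (use np in linarith)
    ultimately have e4: "\<epsilon> n ^ 4 * (real n * p n) = ln (real n) + (\<sigma> n)\<^sup>2" by simp
    have "0 \<le> ln (real n)" using elim(4) by simp
    then have s_le: "(\<sigma> n)\<^sup>2 \<le> \<epsilon> n ^ 4 * (real n * p n)" and ln_le: "ln (real n) \<le> \<epsilon> n ^ 4 * (real n * p n)"
      unfolding e4 by auto
    show ?case
      unfolding \<kappa>_def
      by (intro ballI MLE_loss_event elim s_le ln_le \<epsilon> le e1[unfolded \<kappa>_def] e2[unfolded \<kappa>_def])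
        (use assms(1,2) in auto)
  qed
  moreover have "(\<lambda>n. loss_const \<kappa> * \<epsilon> n) \<in> o(\<lambda>_. 1)"
    using tendsto_mult_right_zero[OF \<epsilon>_lim] by (intro smalloI_tendsto) auto
  moreover have "(\<lambda>n. loss_const \<kappa> * \<epsilon> n) \<in> O(\<lambda>n. ((ln (real n) + (\<sigma> n)\<^sup>2) / (real n * p n)) powr (1/4))"
    unfolding \<epsilon>_def r_def by simp
  ultimately show ?thesis by blast
qed

end
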